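(* Let $(X,d)$ be a metric space and let $\mathcal{B}$ be a bornology on $X$ with a closed base such that $(C(X),\tau_{\mathcal{B}})$ is a fundamental elcs. Then there exists $D\in\mathcal{B}$ such that $((C(X),\tau_{\mathcal{B}})^*,\tau_{ucb})$ is isomorphic (as a topological vector space) to the product space $(\mathscr{M}_{\mathcal{B}}(X),\sigma)\times(M^*,\tau_{w^*})$, where $C(X)=C(X)_{fin}^D\oplus M$ and $\tau_{w^*}$ is the weak$^*$ topology on the dual $M^*$ of $M$.
   Context: $C(X)$ is the real vector space of continuous functions $X\to\mathbb{R}$. A bornology $\mathcal{B}$ on $X$ is a collection of non-empty subsets of $X$ that covers $X$ and is closed under finite unions and under taking (non-empty) subsets of its members; it has a closed base if every member of $\mathcal{B}$ is contained in a closed member of $\mathcal{B}$. For $B\in\mathcal{B}$ let $\rho_B(f)=\sup_{x\in B}|f(x)|\in[0,\infty]$ and $C(X)_{fin}^B=\{f\in C(X):\rho_B(f)<\infty\}$. $\tau_{\mathcal{B}}$ is the translation-invariant topology on $C(X)$ for which the sets $\rho_B^{-1}([0,r))$ ($B\in\mathcal{B}$, $r>0$) form a neighborhood base at $0$. A superscript $*$ denotes the space of all continuous linear functionals into $\mathbb{R}$. An extended locally convex space (elcs) is a vector space $Z$ with a topology $\tau$ induced by a family of extended seminorms (functions with the properties of a seminorm that may take the value $\infty$); $(C(X),\tau_{\mathcal{B}})$ is one. It is a fundamental elcs if $Z_{fin}=\bigcap\{\{x\in Z:\rho(x)<\infty\}:\rho$ a continuous extended seminorm on $(Z,\tau)\}$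 is open in $(Z,\tau)$. A subset $A$ of an elcs $(Z,\tau)$ is bounded if for every neighborhood $U$ of $0$ there exist $r>0$ and a finite set $E\subseteq Z$ with $A\subseteq E+rU$. $\tau_{ucb}$ is the locally convex topology on $Z^*$ induced by the seminorms $F\mapsto\sup_{x\in A}|F(x)|$, $A$ ranging over the bounded subsets of $(Z,\tau)$. $\mathscr{M}_{\mathcal{B}}(X)$ is the vector space of all closed regular, finite (signed) Borel measures $\mu$ on $X$ for which there is a closed $B\in\mathcal{B}$ with $|\mu|(X\setminus B)=0$; closed regular means that for every Borel set $A$ and $\epsilon>0$ there are a closed $C$ and an open $U$ with $C\subseteq A\subseteq U$ and $|\mu|(U\setminus C)<\epsilon$. When $(C(X),\tau_{\mathcal{B}})$ is a fundamental elcs there is $D\in\mathcal{B}$ with $C(X)_{fin}^D\subseteq C(X)_{fin}^B$ for all $B\in\mathcal{B}$ (so $C(X)_{fin}^D=\bigcap_{B\in\mathcal{B}}C(X)_{fin}^B$ does not depend on the choice of such $D$). The topology $\sigma$ on $\mathscr{M}_{\mathcal{B}}(X)$ is defined using such a $D$: it is the locally convex topology induced by the seminorms $\omega_{\mathbb{B}}(\mu)=\sup_{f\in\mathbb{B}}\left|\int_X f\,d\mu\right|$, where $\mathbb{B}$ ranges over the bounded subsets of $C(X)_{fin}^D$. The $D$ in the claim is such a $D$. $M$ is an algebraic complement of $C(X)_{fin}^D$ in $C(X)$, with the topology inherited from $(C(X),\tau_{\mathcal{B}})$ (which is discrete).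
   Formalization: "Closed regular, finite Borel measure" is taken as a finitely additive, closed regular set function of bounded variation on the algebra generated by the closed sets; with countably additive measures the claim fails for X = ℕ discrete and all non-empty subsets as bornology. *)

theory Defs
  imports "HOL-Analysis.Analysis" "HOL-Library.Function_Algebras" "HOL-Library.Disjoint_Sets"
begin

text \<open>
  All vector spaces below are subspaces of spaces of real-valued functions with the pointwise
  operations: continuous functions are functions on the points, functionals are functions on
  vectors, measures are functions on sets. A function whose natural domain is a proper part of
  its type is set to 0 outside that domain, which keeps equality and the operations pointwise.
\<close>

instantiation "fun" :: (type, real_vector) real_vector
begin

definition scaleR_fun :: "real \<Rightarrow> ('a \<Rightarrow> 'b) \<Rightarrow> 'a \<Rightarrow> 'b"
  where "scaleR_fun c f = (\<lambda>x. c *\<^sub>R f x)"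

instance
  by standard (auto simp: scaleR_fun_def fun_eq_iff scaleR_add_right scaleR_add_left)

end


section \<open>Extended locally convex spaces\<close>

definition extended_seminorm :: "'v::real_vector set \<Rightarrow> ('v \<Rightarrow> ennreal) \<Rightarrow> bool" where
  "extended_seminorm S \<rho> \<longleftrightarrow>
     (\<forall>c. \<forall>x\<in>S. \<rho> (c *\<^sub>R x) = ennreal \<bar>c\<bar> * \<rho> x) \<and>
     (\<forall>x\<in>S. \<forall>y\<in>S. \<rho> (x + y) \<le> \<rho> x + \<rho> y)"

text \<open>The topology on \<open>S\<close> induced by a family \<open>P\<close> of (extended) seminorms.\<close>

definition seminorm_topology :: "'v::real_vector set \<Rightarrow> ('v \<Rightarrow> ennreal) set \<Rightarrow> 'v topology" where
  "seminorm_topology S P = topology (\<lambda>U. U \<subseteq> S \<and>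
     (\<forall>x\<in>U. \<exists>F r. finite F \<and> F \<subseteq> P \<and> r > 0 \<and>
        {y\<in>S. \<forall>\<rho>\<in>F. \<rho> (y - x) < ennreal r} \<subseteq> U))"

lemma openin_seminorm_topology:
  "openin (seminorm_topology S P) U \<longleftrightarrow> U \<subseteq> S \<and>
     (\<forall>x\<in>U. \<exists>F r. finite F \<and> F \<subseteq> P \<and> r > 0 \<and>
        {y\<in>S. \<forall>\<rho>\<in>F. \<rho> (y - x) < ennreal r} \<subseteq> U)"
proof -
  let ?O = "\<lambda>U. U \<subseteq> S \<and>
     (\<forall>x\<in>U. \<exists>F r. finite F \<and> F \<subseteq> P \<and> r > 0 \<and>
        {y\<in>S. \<forall>\<rho>\<in>F. \<rho> (y - x) < ennreal r} \<subseteq> U)"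
  have "istopology ?O"
    unfolding istopology_def
  proof (intro conjI allI impI)
    fix U V assume U: "?O U" and V: "?O V"
    show "U \<inter> V \<subseteq> S" using U by blast
    show "\<forall>x\<in>U \<inter> V. \<exists>F r. finite F \<and> F \<subseteq> P \<and> r > 0 \<and>
        {y\<in>S. \<forall>\<rho>\<in>F. \<rho> (y - x) < ennreal r} \<subseteq> U \<inter> V"
    proof
      fix x assume x: "x \<in> U \<inter> V"
      obtain F r where F: "finite F" "F \<subseteq> P" "r > 0"
        "{y\<in>S. \<forall>\<rho>\<in>F. \<rho> (y - x) < ennreal r} \<subseteq> U"
        using U x by blast
      obtain G s where G: "finite G" "G \<subseteq> P" "s > 0"
        "{y\<in>S. \<forall>\<rho>\<in>G. \<rho> (y - x) < ennreal s} \<subseteq> V"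
        using V x by blast
      have le: "ennreal (min r s) \<le> ennreal r" "ennreal (min r s) \<le> ennreal s"
        by (simp_all add: ennreal_leI)
      have "{y\<in>S. \<forall>\<rho>\<in>F \<union> G. \<rho> (y - x) < ennreal (min r s)} \<subseteq> U \<inter> V"
      proof
        fix y assume y: "y \<in> {y\<in>S. \<forall>\<rho>\<in>F \<union> G. \<rho> (y - x) < ennreal (min r s)}"
        have "y \<in> {y\<in>S. \<forall>\<rho>\<in>F. \<rho> (y - x) < ennreal r}"
          using y less_le_trans[OF _ le(1)] by blast
        moreover have "y \<in> {y\<in>S. \<forall>\<rho>\<in>G. \<rho> (y - x) < ennreal s}"
          using y less_le_trans[OF _ le(2)] by blast
        ultimately show "y \<in> U \<inter> V" using F(4) G(4) by blast
      qed
      moreover have "finite (F \<union> G)" "F \<union> G \<subseteq> P" "min r s > 0"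
        using F G by simp_all
      ultimately show "\<exists>F r. finite F \<and> F \<subseteq> P \<and> r > 0 \<and>
          {y\<in>S. \<forall>\<rho>\<in>F. \<rho> (y - x) < ennreal r} \<subseteq> U \<inter> V"
        by blast
    qed
  next
    fix \<K> assume K: "\<forall>K\<in>\<K>. ?O K"
    show "\<Union>\<K> \<subseteq> S"
      by (rule Union_least) (rule conjunct1[OF bspec[OF K]])
    show "\<forall>x\<in>\<Union>\<K>. \<exists>F r. finite F \<and> F \<subseteq> P \<and> r > 0 \<and>
        {y\<in>S. \<forall>\<rho>\<in>F. \<rho> (y - x) < ennreal r} \<subseteq> \<Union>\<K>"
    proof
      fix x assume "x \<in> \<Union>\<K>"
      then obtain K where KK: "K \<in> \<K>" and x: "x \<in> K" by (rule UnionE)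
      from bspec[OF conjunct2[OF bspec[OF K KK]] x]
      obtain F r where F: "finite F" "F \<subseteq> P" "r > 0"
        "{y\<in>S. \<forall>\<rho>\<in>F. \<rho> (y - x) < ennreal r} \<subseteq> K"
        by (elim exE conjE)
      from F(4) Union_upper[OF KK]
      have "{y\<in>S. \<forall>\<rho>\<in>F. \<rho> (y - x) < ennreal r} \<subseteq> \<Union>\<K>"
        by (rule subset_trans)
      with F(1-3) show "\<exists>F r. finite F \<and> F \<subseteq> P \<and> r > 0 \<and>
        {y\<in>S. \<forall>\<rho>\<in>F. \<rho> (y - x) < ennreal r} \<subseteq> \<Union>\<K>"
        by (intro exI conjI)
    qed
  qed
  then show ?thesis
    unfolding seminorm_topology_def by simp
qed

lemma topspace_seminorm_topology [simp]: "topspace (seminorm_topology S P) = S"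
proof -
  have "openin (seminorm_topology S P) S"
    unfolding openin_seminorm_topology
    by (intro conjI ballI exI[of _ "{}"] exI[of _ "1::real"]) auto
  then show ?thesis
    by (meson openin_seminorm_topology openin_subset openin_topspace subset_antisym)
qed

definition elcs :: "'v::real_vector set \<Rightarrow> 'v topology \<Rightarrow> bool" where
  "elcs S T \<longleftrightarrow> subspace S \<and>
     (\<exists>P. (\<forall>\<rho>\<in>P. extended_seminorm S \<rho>) \<and> T = seminorm_topology S P)"

definition finite_part :: "'v::real_vector set \<Rightarrow> 'v topology \<Rightarrow> 'v set" where
  "finite_part S T =
     {x\<in>S. \<forall>\<rho>. extended_seminorm S \<rho> \<and> continuous_map T euclidean \<rho> \<longrightarrow> \<rho> x < \<infinity>}"

definition fundamental_elcs :: "'v::real_vector set \<Rightarrow> 'v topology \<Rightarrow> bool" where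
  "fundamental_elcs S T \<longleftrightarrow> elcs S T \<and> openin T (finite_part S T)"

definition elcs_bounded :: "'v::real_vector set \<Rightarrow> 'v topology \<Rightarrow> 'v set \<Rightarrow> bool" where
  "elcs_bounded S T A \<longleftrightarrow> A \<subseteq> S \<and>
     (\<forall>U. U \<subseteq> S \<and> (\<exists>V. openin T V \<and> 0 \<in> V \<and> V \<subseteq> U) \<longrightarrow>
        (\<exists>r>0. \<exists>E. finite E \<and> E \<subseteq> S \<and> A \<subseteq> {e + r *\<^sub>R u | e u. e \<in> E \<and> u \<in> U}))"

definition dual :: "'v::real_vector set \<Rightarrow> 'v topology \<Rightarrow> ('v \<Rightarrow> real) set" where
  "dual S T = {F. (\<forall>x\<in>S. \<forall>y\<in>S. F (x + y) = F x + F y) \<and>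
                  (\<forall>c. \<forall>x\<in>S. F (c *\<^sub>R x) = c * F x) \<and>
                  continuous_map T euclideanreal F \<and>
                  (\<forall>x. x \<notin> S \<longrightarrow> F x = 0)}"

definition tau_ucb :: "'v::real_vector set \<Rightarrow> 'v topology \<Rightarrow> ('v \<Rightarrow> real) topology" where
  "tau_ucb S T = seminorm_topology (dual S T)
     {\<lambda>F. (SUP x\<in>A. ennreal \<bar>F x\<bar>) | A. elcs_bounded S T A}"

definition weak_star :: "'v::real_vector set \<Rightarrow> 'v topology \<Rightarrow> ('v \<Rightarrow> real) topology" where
  "weak_star S T = seminorm_topology (dual S T) {\<lambda>F. ennreal \<bar>F x\<bar> | x. x \<in> S}"

definition tvs_isomorphic ::
  "'v::real_vector topology \<Rightarrow> 'w::real_vector topology \<Rightarrow> bool" where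
  "tvs_isomorphic T T' \<longleftrightarrow> (\<exists>\<Phi>. homeomorphic_map T T' \<Phi> \<and>
     (\<forall>x\<in>topspace T. \<forall>y\<in>topspace T. \<Phi> (x + y) = \<Phi> x + \<Phi> y) \<and>
     (\<forall>c. \<forall>x\<in>topspace T. \<Phi> (c *\<^sub>R x) = c *\<^sub>R \<Phi> x))"

definition algebraic_complement ::
  "'v::real_vector set \<Rightarrow> 'v set \<Rightarrow> 'v set \<Rightarrow> bool" where
  "algebraic_complement S L M \<longleftrightarrow> subspace M \<and> M \<subseteq> S \<and> L \<inter> M = {0} \<and>
     S = {x + y | x y. x \<in> L \<and> y \<in> M}"


section \<open>Bornologies and uniform convergence on bornologies\<close>

definition bornology :: "'a set set \<Rightarrow> bool" where
  "bornology \<B> \<longleftrightarrow> (\<forall>B\<in>\<B>. B \<noteq> {}) \<and> \<Union>\<B> = UNIV \<and>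
     (\<forall>A\<in>\<B>. \<forall>B\<in>\<B>. A \<union> B \<in> \<B>) \<and>
     (\<forall>B\<in>\<B>. \<forall>A. A \<subseteq> B \<and> A \<noteq> {} \<longrightarrow> A \<in> \<B>)"

definition has_closed_base :: "'a::topological_space set set \<Rightarrow> bool" where
  "has_closed_base \<B> \<longleftrightarrow> (\<forall>B\<in>\<B>. \<exists>C\<in>\<B>. closed C \<and> B \<subseteq> C)"

definition CX :: "('a::topological_space \<Rightarrow> real) set" where
  "CX = {f. continuous_on UNIV f}"

definition rho :: "'a set \<Rightarrow> ('a \<Rightarrow> real) \<Rightarrow> ennreal" where
  "rho B f = (SUP x\<in>B. ennreal \<bar>f x\<bar>)"

definition CX_fin :: "'a::topological_space set \<Rightarrow> ('a \<Rightarrow> real) set" where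
  "CX_fin B = {f\<in>CX. rho B f < \<infinity>}"

definition tau :: "'a::topological_space set set \<Rightarrow> ('a \<Rightarrow> real) topology" where
  "tau \<B> = seminorm_topology CX (rho ` \<B>)"

text \<open>
  Since a bornology is closed under finite unions, the sets \<open>{g. rho B g < r}\<close> already form a
  neighbourhood base at 0, as the following characterization shows.
\<close>

lemma rho_mono: "A \<subseteq> B \<Longrightarrow> rho A f \<le> rho B f"
  unfolding rho_def by (rule SUP_subset_mono) auto

lemma openin_tau:
  fixes \<B> :: "'a::topological_space set set"
  assumes "bornology \<B>"
  shows "openin (tau \<B>) U \<longleftrightarrow> U \<subseteq> CX \<and>
     (\<forall>f\<in>U. \<exists>B\<in>\<B>. \<exists>r>0. {g\<in>CX. rho B (g - f) < ennreal r} \<subseteq> U)"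
proof -
  have un: "A \<union> B \<in> \<B>" if "A \<in> \<B>" "B \<in> \<B>" for A B
    using assms that unfolding bornology_def by blast
  have "\<B> \<noteq> {}"
    using assms unfolding bornology_def by (metis Union_empty empty_not_UNIV)
  then obtain B0 where "B0 \<in> \<B>" by blast
  have union: "\<exists>B\<in>\<B>. \<Union>\<F> \<subseteq> B" if "finite \<F>" "\<F> \<subseteq> \<B>" for \<F>
    using that
  proof (induction rule: finite_induct)
    case empty
    show ?case using \<open>B0 \<in> \<B>\<close> by (rule bexI[rotated]) simp
  next
    case (insert A \<F>)
    from insert.prems have "\<F> \<subseteq> \<B>" by simp
    then obtain B where "B \<in> \<B>" "\<Union>\<F> \<subseteq> B" by (rule insert.IH[THEN bexE])
    have "A \<union> B \<in> \<B>"
      using insert.prems \<open>B \<in> \<B>\<close> by (intro un) simp_all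
    moreover have "\<Union>(insert A \<F>) \<subseteq> A \<union> B"
      using \<open>\<Union>\<F> \<subseteq> B\<close> by blast
    ultimately show ?case by (rule bexI[rotated])
  qed
  have "(\<exists>F r. finite F \<and> F \<subseteq> rho ` \<B> \<and> r > 0 \<and>
           {g\<in>CX. \<forall>\<rho>\<in>F. \<rho> (g - f) < ennreal r} \<subseteq> U) \<longleftrightarrow>
        (\<exists>B\<in>\<B>. \<exists>r>0. {g\<in>CX. rho B (g - f) < ennreal r} \<subseteq> U)"
    (is "?L \<longleftrightarrow> ?R") for f
  proof
    assume ?L
    then obtain F r where F: "finite F" "F \<subseteq> rho ` \<B>" "r > 0"
      "{g\<in>CX. \<forall>\<rho>\<in>F. \<rho> (g - f) < ennreal r} \<subseteq> U" by blast
    obtain \<F> where \<F>: "\<F> \<subseteq> \<B>" "finite \<F>" "F = rho ` \<F>"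
      using F(1,2) by (meson finite_subset_image)
    obtain B where B: "B \<in> \<B>" "\<Union>\<F> \<subseteq> B"
      using union[OF \<F>(2,1)] by (rule bexE)
    have "rho A (g - f) < ennreal r" if "rho B (g - f) < ennreal r" "A \<in> \<F>" for g A
      using that B(2) rho_mono[of A B "g - f"] by (meson Union_upper le_less_trans order_trans)
    then have "{g\<in>CX. rho B (g - f) < ennreal r} \<subseteq> U"
      using F(4) \<F>(3) by blast
    then show ?R using B(1) F(3) by blast
  next
    assume ?R
    then obtain B r where "B \<in> \<B>" "r > 0" "{g\<in>CX. rho B (g - f) < ennreal r} \<subseteq> U" by blast
    then show ?L by (intro exI[of _ "{rho B}"] exI[of _ r]) auto
  qed
  then show ?thesis
    unfolding tau_def openin_seminorm_topology by simp
qed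


section \<open>Closed regular Borel measures\<close>

text \<open>
  Measures are understood in the sense of the duality theory of spaces of bounded continuous
  functions (Alexandroff, Varadarajan, Wheeler; the space rba in Dunford and Schwartz, Theorem
  IV.6.2): finitely additive set functions of bounded variation on the algebra generated by the
  closed sets. Countable additivity is not required and cannot be: if every non-empty subset
  of the discrete space of natural numbers belongs to the bornology, then the finite part of
  \<open>CX\<close> is \<open>l\<^sup>\<infinity>\<close> with the sup norm, whose dual contains finitely additive set functions that are
  not countably additive. The domain is the algebra, and not the sigma-algebra, since in general
  an element of the dual has no closed regular finitely additive representative on the latter.
\<close>

definition borel_algebra :: "'a::topological_space set set" where
  "borel_algebra = \<Inter>{\<A>. algebra UNIV \<A> \<and> {C. closed C} \<subseteq> \<A>}"

definition borel_partition :: "'a::topological_space set \<Rightarrow> 'a set set \<Rightarrow> bool" where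
  "borel_partition A P \<longleftrightarrow> finite P \<and> P \<subseteq> borel_algebra \<and> partition_on A P"

definition total_variation ::
  "('a::topological_space set \<Rightarrow> real) \<Rightarrow> 'a set \<Rightarrow> ennreal" where
  "total_variation \<mu> A = (SUP P\<in>{P. borel_partition A P}. \<Sum>E\<in>P. ennreal \<bar>\<mu> E\<bar>)"

definition finite_borel_measure :: "('a::topological_space set \<Rightarrow> real) \<Rightarrow> bool" where
  "finite_borel_measure \<mu> \<longleftrightarrow> additive borel_algebra \<mu> \<and> total_variation \<mu> UNIV < \<infinity> \<and>
     (\<forall>A. A \<notin> borel_algebra \<longrightarrow> \<mu> A = 0)"

definition closed_regular :: "('a::topological_space set \<Rightarrow> real) \<Rightarrow> bool" where
  "closed_regular \<mu> \<longleftrightarrow> (\<forall>A\<in>borel_algebra. \<forall>\<epsilon>>0. \<exists>C U. closed C \<and> open U \<and>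
     C \<subseteq> A \<and> A \<subseteq> U \<and> total_variation \<mu> (U - C) < ennreal \<epsilon>)"

definition measures_on :: "'a::topological_space set set \<Rightarrow> ('a set \<Rightarrow> real) set" where
  "measures_on \<B> = {\<mu>. finite_borel_measure \<mu> \<and> closed_regular \<mu> \<and>
     (\<exists>B\<in>\<B>. closed B \<and> total_variation \<mu> (UNIV - B) = 0)}"

text \<open>
  The integral is the limit of the Riemann sums along the partitions into finitely many members
  of the algebra, directed by refinement. It exists if \<open>f\<close> is continuous and bounded outside a
  null set, and is then the usual integral with respect to a (finitely additive) measure; it is
  the Lebesgue integral if \<open>\<mu>\<close> is countably additive. Note that the blocks of a partition are
  non-empty.
\<close>

definition has_measure_integral ::
  "('a::topological_space set \<Rightarrow> real) \<Rightarrow> ('a \<Rightarrow> real) \<Rightarrow> real \<Rightarrow> bool" where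
  "has_measure_integral \<mu> f I \<longleftrightarrow> (\<forall>\<epsilon>>0. \<exists>P. borel_partition UNIV P \<and>
     (\<forall>Q t. borel_partition UNIV Q \<and> (\<forall>E\<in>Q. \<exists>E'\<in>P. E \<subseteq> E') \<and> (\<forall>E\<in>Q. t E \<in> E) \<longrightarrow>
        \<bar>(\<Sum>E\<in>Q. f (t E) * \<mu> E) - I\<bar> < \<epsilon>))"

definition measure_integral ::
  "('a::topological_space set \<Rightarrow> real) \<Rightarrow> ('a \<Rightarrow> real) \<Rightarrow> real" where
  "measure_integral \<mu> f = (THE I. has_measure_integral \<mu> f I)"

definition sigma_top ::
  "'a::topological_space set set \<Rightarrow> 'a set \<Rightarrow> ('a set \<Rightarrow> real) topology" where
  "sigma_top \<B> D = seminorm_topology (measures_on \<B>)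
     {\<lambda>\<mu>. (SUP f\<in>A. ennreal \<bar>measure_integral \<mu> f\<bar>) | A.
        elcs_bounded (CX_fin D) (subtopology (tau \<B>) (CX_fin D)) A}"

end

theory Submission
  imports Defs
begin

text \<open>
The finite part of \<open>C(X)\<close> is a space \<open>L\<close> of functions that are bounded on every member of the
bornology. That it is open has two effects. First, it contains the ball of a single \<open>rho D\<close>, and
scaling turns this into \<open>L = CX_fin D\<close>. Second, a complement \<open>M\<close> of \<open>L\<close> is discrete, so continuity of a
functional is a condition on its restriction to \<open>L\<close> alone, while on \<open>M\<close> every linear functional is
allowed. Hence the dual is, as a vector space, the product of the dual of \<open>L\<close> and the algebraic
dual of \<open>M\<close>, and it remains to identify the former with the measures and to compare topologies.

The dual of \<open>L\<close>. A continuous functional \<open>F\<close> satisfies \<open>\<bar>F f\<bar> \<le> k * sup\<^sub>B \<bar>f\<bar>\<close> for some closed \<open>B\<close> in the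
bornology (\<open>dual_set_bounded\<close>). It therefore does not see values outside \<open>B\<close>, and by truncation it is
determined by its values on bounded functions. On the cone of nonnegative bounded continuous
functions, \<open>F\<close> is the difference of two positive functionals, its positive part in the sense of Riesz
and the remainder (\<open>pos_add\<close>). For a positive functional the infimum of its values on the functions
that are at least 1 on a closed set \<open>C\<close> is a tight content (\<open>content_tight\<close>); the inner measure of a
tight content is finitely additive on the algebra generated by the closed sets, by the argument of
Caratheodory, and Darboux sums show that it represents the functional. This is the theorem of
Alexandroff; the lemma of Urysohn supplies the continuous functions it needs. Conversely, a measure carried by a closed
member of the bornology integrates every function in \<open>L\<close>, since such a function is bounded where the
measure lives, and the integral is dominated by the total variation. Regularity and the lemma of
Urysohn make the measure unique (\<open>closed_regular_eq_0\<close>).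

The topologies. The seminorms agree because bounded sets do. Testing boundedness against an open
set inside \<open>L\<close> shows that a bounded set has a finite projection to \<open>M\<close>, and a bounded projection to \<open>L\<close>
(\<open>bounded_split\<close>); conversely bounded subsets of \<open>L\<close> and points of \<open>M\<close> are bounded in \<open>C(X)\<close>. So a
supremum over a bounded set is controlled by a supremum over a bounded subset of \<open>L\<close> together with
finitely many evaluations on \<open>M\<close>, which are the seminorms of the two factors.
\<close>

section \<open>Finitely additive set functions on the algebra generated by the closed sets\<close>

lemma algebra_borel_algebra: "algebra UNIV (borel_algebra :: 'a::topological_space set set)"
  unfolding algebra_iff_Un borel_algebra_def by (auto simp: algebra_iff_Un)

interpretation borel_algebra: algebra UNIV "borel_algebra :: 'a::topological_space set set"
  by (rule algebra_borel_algebra)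

lemma closed_in_borel_algebra [intro]: "closed C \<Longrightarrow> C \<in> borel_algebra"
  unfolding borel_algebra_def by blast

lemma Compl_in_borel_algebra [intro]: "A \<in> borel_algebra \<Longrightarrow> - A \<in> borel_algebra"
  using borel_algebra.compl_sets[of A] by (simp add: Compl_eq_Diff_UNIV)

lemma open_in_borel_algebra [intro]: "open U \<Longrightarrow> U \<in> borel_algebra"
  using Compl_in_borel_algebra[of "- U"] by (auto simp: closed_Compl)

lemma borel_algebra_subset:
  assumes "algebra UNIV \<A>" "\<And>C. closed C \<Longrightarrow> C \<in> \<A>"
  shows "borel_algebra \<subseteq> \<A>"
  using assms unfolding borel_algebra_def by blast

lemma borel_partitionD:
  assumes "borel_partition A P"
  shows "finite P" "P \<subseteq> borel_algebra" "partition_on A P" "\<Union>P = A" "disjoint P" "{} \<notin> P"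
  using assms by (auto simp: borel_partition_def partition_on_def)

text \<open>
  Most partitions below arise as level sets of a function with finitely many values; indexing them
  by the attained values keeps the blocks non-empty, as a partition requires.
\<close>

lemma borel_partition_fibres:
  assumes "finite (g ` A)" and "\<And>k. {x\<in>A. g x = k} \<in> borel_algebra"
  shows "borel_partition A ((\<lambda>k. {x\<in>A. g x = k}) ` g ` A)"
  unfolding borel_partition_def partition_on_def disjoint_def using assms by auto

lemma borel_partition_singleton:
  "A \<in> borel_algebra \<Longrightarrow> A \<noteq> {} \<Longrightarrow> borel_partition A {A}"
  by (simp add: borel_partition_def partition_on_space)

lemma borel_partition_Un:
  assumes "borel_partition A P" "borel_partition B Q" "A \<inter> B = {}"
  shows "borel_partition (A \<union> B) (P \<union> Q)"
  using assms unfolding borel_partition_def partition_on_def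
  by (auto intro!: disjoint_union)

text \<open>
  Adding the complement as a further block makes the total variation monotone.
\<close>

lemma borel_partition_extend:
  assumes P: "borel_partition A P" and "A \<in> borel_algebra" "B \<in> borel_algebra" "A \<subseteq> B"
  shows "\<exists>Q. borel_partition B Q \<and> P \<subseteq> Q"
proof (cases "B - A = {}")
  case True
  then show ?thesis using assms by (intro exI[of _ P]) (auto dest: subset_antisym)
next
  case False
  have "B - A \<in> borel_algebra" using assms by blast
  then have "borel_partition (A \<union> (B - A)) (P \<union> {B - A})"
    using False by (intro borel_partition_Un P borel_partition_singleton) auto
  moreover have "A \<union> (B - A) = B" using assms by blast
  ultimately show ?thesis by auto
qed

lemma borel_partition_common_refinement:
  assumes P: "borel_partition A P" and Q: "borel_partition A Q"
  shows "\<exists>R. borel_partition A R \<and> refines A R P \<and> refines A R Q"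
proof -
  let ?R = "common_refinement {P, Q}"
  have part: "\<And>S. S \<in> {P, Q} \<Longrightarrow> partition_on A S"
    using P Q by (auto dest: borel_partitionD)
  have "partition_on A ?R"
    by (rule partition_on_common_refinement) (use part in auto)
  moreover have "finite ?R"
    by (rule finite_common_refinement) (use P Q in \<open>auto dest: borel_partitionD\<close>)
  moreover have "?R \<subseteq> borel_algebra"
    using P Q by (auto simp: common_refinement dest!: borel_partitionD(2))
  ultimately have "borel_partition A ?R" by (simp add: borel_partition_def)
  then show ?thesis
    using refines_common_refinement[of "{P, Q}" A, OF part] by blast
qed

lemma borel_partition_restrict:
  assumes "borel_partition A Q" "refines A Q P" "W \<in> P"
  shows "borel_partition W {E\<in>Q. E \<subseteq> W}"
  using refines_obtains_subset[OF assms(2,3)] assms(1)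
  by (auto simp: borel_partition_def)

lemma sum_refines:
  assumes Q: "finite Q" and P: "finite P" and ref: "refines A Q P"
  shows "(\<Sum>E\<in>Q. h E) = (\<Sum>W\<in>P. \<Sum>E\<in>{E\<in>Q. E \<subseteq> W}. h E)"
proof -
  have "Q = (\<Union>W\<in>P. {E\<in>Q. E \<subseteq> W})"
    using ref unfolding refines_def by blast
  then have "sum h Q = sum h (\<Union>W\<in>P. {E\<in>Q. E \<subseteq> W})" by simp
  also have "\<dots> = (\<Sum>W\<in>P. \<Sum>E\<in>{E\<in>Q. E \<subseteq> W}. h E)"
  proof (rule sum.UNION_disjoint)
    show "\<forall>W\<in>P. \<forall>V\<in>P. W \<noteq> V \<longrightarrow> {E\<in>Q. E \<subseteq> W} \<inter> {E\<in>Q. E \<subseteq> V} = {}"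
    proof (intro ballI impI)
      fix W V assume "W \<in> P" "V \<in> P" "W \<noteq> V"
      then have "W \<inter> V = {}"
        using ref by (auto simp: refines_def partition_on_def disjoint_def)
      then have "E = {}" if "E \<subseteq> W" "E \<subseteq> V" for E using that by blast
      moreover have "{} \<notin> Q" using ref by (auto simp: refines_def partition_on_def)
      ultimately show "{E\<in>Q. E \<subseteq> W} \<inter> {E\<in>Q. E \<subseteq> V} = {}" by blast
    qed
  qed (use P Q in auto)
  finally show ?thesis .
qed

lemma additive_empty:
  fixes \<mu> :: "'a::topological_space set \<Rightarrow> real"
  assumes "additive borel_algebra \<mu>"
  shows "\<mu> {} = 0"
  using additiveD[OF assms, of "{}" "{}"] by auto

lemma additive_Diff:
  fixes \<mu> :: "'a::topological_space set \<Rightarrow> real"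
  assumes "additive borel_algebra \<mu>" "A \<in> borel_algebra" "B \<in> borel_algebra" "A \<subseteq> B"
  shows "\<mu> (B - A) = \<mu> B - \<mu> A"
proof -
  have "\<mu> (A \<union> (B - A)) = \<mu> A + \<mu> (B - A)"
    using assms by (intro additiveD) auto
  moreover have "A \<union> (B - A) = B" using assms by blast
  ultimately show ?thesis by simp
qed

lemma additive_Union_disjoint:
  fixes \<mu> :: "'a::topological_space set \<Rightarrow> real"
  assumes add: "additive borel_algebra \<mu>"
    and "finite P" "P \<subseteq> borel_algebra" "disjoint P"
  shows "\<mu> (\<Union>P) = (\<Sum>E\<in>P. \<mu> E)"
  using assms(2-)
proof (induction rule: finite_induct)
  case empty
  then show ?case by (simp add: additive_empty[OF add])
next
  case (insert E P)
  have "\<Union>P \<in> borel_algebra" using insert by auto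
  moreover have "E \<inter> \<Union>P = {}" using insert by (auto simp: disjoint_def)
  ultimately have "\<mu> (E \<union> \<Union>P) = \<mu> E + \<mu> (\<Union>P)"
    using insert by (intro additiveD[OF add]) auto
  moreover have "disjoint P" using insert.prems by (auto simp: disjoint_def)
  ultimately show ?case using insert by simp
qed

lemma additive_borel_partition:
  fixes \<mu> :: "'a::topological_space set \<Rightarrow> real"
  assumes "additive borel_algebra \<mu>" "borel_partition A P"
  shows "\<mu> A = (\<Sum>E\<in>P. \<mu> E)"
  using additive_Union_disjoint[OF assms(1)] borel_partitionD[OF assms(2)] by metis


section \<open>Total variation\<close>

lemma sum_abs_le_total_variation:
  "borel_partition A P \<Longrightarrow> ennreal (\<Sum>E\<in>P. \<bar>\<mu> E\<bar>) \<le> total_variation \<mu> A"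
  unfolding total_variation_def by (auto intro: SUP_upper simp flip: sum_ennreal)

lemma total_variation_least:
  assumes "\<And>P. borel_partition A P \<Longrightarrow> ennreal (\<Sum>E\<in>P. \<bar>\<mu> E\<bar>) \<le> c"
  shows "total_variation \<mu> A \<le> c"
  unfolding total_variation_def using assms by (auto intro!: SUP_least)

lemma total_variation_mono:
  assumes "A \<in> borel_algebra" "B \<in> borel_algebra" "A \<subseteq> B"
  shows "total_variation \<mu> A \<le> total_variation \<mu> B"
proof (rule total_variation_least)
  fix P assume "borel_partition A P"
  then obtain Q where Q: "borel_partition B Q" "P \<subseteq> Q"
    using borel_partition_extend assms by blast
  have "(\<Sum>E\<in>P. \<bar>\<mu> E\<bar>) \<le> (\<Sum>E\<in>Q. \<bar>\<mu> E\<bar>)"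
    using Q by (intro sum_mono2) (auto dest: borel_partitionD)
  also note sum_abs_le_total_variation[OF Q(1)]
  finally show "ennreal (\<Sum>E\<in>P. \<bar>\<mu> E\<bar>) \<le> total_variation \<mu> B"
    by (auto intro: ennreal_leI)
qed

lemma total_variation_add:
  "total_variation (\<mu> + \<nu>) A \<le> total_variation \<mu> A + total_variation \<nu> A"
proof (rule total_variation_least)
  fix P assume P: "borel_partition A P"
  have "(\<Sum>E\<in>P. \<bar>(\<mu> + \<nu>) E\<bar>) \<le> (\<Sum>E\<in>P. \<bar>\<mu> E\<bar>) + (\<Sum>E\<in>P. \<bar>\<nu> E\<bar>)"
    by (auto simp flip: sum.distrib intro: sum_mono)
  then have "ennreal (\<Sum>E\<in>P. \<bar>(\<mu> + \<nu>) E\<bar>)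
      \<le> ennreal ((\<Sum>E\<in>P. \<bar>\<mu> E\<bar>) + (\<Sum>E\<in>P. \<bar>\<nu> E\<bar>))"
    by (rule ennreal_leI)
  also have "\<dots> = ennreal (\<Sum>E\<in>P. \<bar>\<mu> E\<bar>) + ennreal (\<Sum>E\<in>P. \<bar>\<nu> E\<bar>)"
    by (rule ennreal_plus) (auto intro: sum_nonneg)
  also have "\<dots> \<le> total_variation \<mu> A + total_variation \<nu> A"
    by (intro add_mono sum_abs_le_total_variation P)
  finally show "ennreal (\<Sum>E\<in>P. \<bar>(\<mu> + \<nu>) E\<bar>) \<le> total_variation \<mu> A + total_variation \<nu> A" .
qed

lemma total_variation_scaleR:
  "total_variation (c *\<^sub>R \<mu>) A \<le> ennreal \<bar>c\<bar> * total_variation \<mu> A"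
proof (rule total_variation_least)
  fix P assume P: "borel_partition A P"
  have "(\<Sum>E\<in>P. \<bar>(c *\<^sub>R \<mu>) E\<bar>) = \<bar>c\<bar> * (\<Sum>E\<in>P. \<bar>\<mu> E\<bar>)"
    by (simp add: scaleR_fun_def abs_mult sum_distrib_left)
  then show "ennreal (\<Sum>E\<in>P. \<bar>(c *\<^sub>R \<mu>) E\<bar>) \<le> ennreal \<bar>c\<bar> * total_variation \<mu> A"
    using sum_abs_le_total_variation[OF P, of \<mu>]
    by (simp add: ennreal_mult' mult_left_mono sum_nonneg)
qed

lemma abs_le_total_variation:
  assumes "additive borel_algebra \<mu>" "A \<in> borel_algebra"
  shows "ennreal \<bar>\<mu> A\<bar> \<le> total_variation \<mu> A"
proof (cases "A = {}")
  case True
  then show ?thesis by (simp add: additive_empty[OF assms(1)])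
next
  case False
  show ?thesis
    using sum_abs_le_total_variation[OF borel_partition_singleton[OF assms(2) False], of \<mu>] by simp
qed

text \<open>
  A set function that is merely additive may cancel on large sets; a vanishing total variation
  excludes this for all subsets.
\<close>

lemma null_subset:
  assumes "additive borel_algebra \<mu>" "total_variation \<mu> N = 0"
    "N \<in> borel_algebra" "E \<in> borel_algebra" "E \<subseteq> N"
  shows "\<mu> E = 0"
  using abs_le_total_variation[OF assms(1,4)] total_variation_mono[OF assms(4,3,5), of \<mu>] assms(2)
  by (simp add: ennreal_eq_0_iff)

text \<open>
  Without cancellation, every partition of \<open>A\<close> gives the same sum, the value at \<open>A\<close>.
\<close>

lemma total_variation_nonneg_measure:
  assumes "additive borel_algebra \<mu>" "\<And>E. E \<in> borel_algebra \<Longrightarrow> 0 \<le> \<mu> E"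
  shows "total_variation \<mu> A \<le> ennreal (\<mu> A)"
proof (rule total_variation_least)
  fix P assume P: "borel_partition A P"
  have "(\<Sum>E\<in>P. \<bar>\<mu> E\<bar>) = (\<Sum>E\<in>P. \<mu> E)"
    using assms(2) borel_partitionD(2)[OF P] by (intro sum.cong) auto
  then show "ennreal (\<Sum>E\<in>P. \<bar>\<mu> E\<bar>) \<le> ennreal (\<mu> A)"
    by (simp add: additive_borel_partition[OF assms(1) P])
qed

lemma finite_borel_measureD:
  assumes "finite_borel_measure \<mu>"
  shows "additive borel_algebra \<mu>" "total_variation \<mu> UNIV < \<infinity>"
    "A \<notin> borel_algebra \<Longrightarrow> \<mu> A = 0"
  using assms by (auto simp: finite_borel_measure_def)

lemma sum_abs_le_enn2real_total_variation:
  assumes "finite_borel_measure \<mu>" "borel_partition UNIV P"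
  shows "(\<Sum>E\<in>P. \<bar>\<mu> E\<bar>) \<le> enn2real (total_variation \<mu> UNIV)"
  using sum_abs_le_total_variation[OF assms(2), of \<mu>] finite_borel_measureD(2)[OF assms(1)]
  by (metis ennreal_enn2real enn2real_nonneg ennreal_le_iff infinity_ennreal_def)

lemma finite_borel_measure_add:
  assumes "finite_borel_measure \<mu>" "finite_borel_measure \<nu>"
  shows "finite_borel_measure (\<mu> + \<nu>)"
  unfolding finite_borel_measure_def
proof (intro conjI)
  show "additive borel_algebra (\<mu> + \<nu>)"
    using assms by (auto simp: finite_borel_measure_def additive_def)
  have "total_variation \<mu> UNIV + total_variation \<nu> UNIV < \<infinity>"
    using assms by (auto simp: finite_borel_measure_def)
  then show "total_variation (\<mu> + \<nu>) UNIV < \<infinity>"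
    using total_variation_add le_less_trans by blast
qed (use assms in \<open>auto simp: finite_borel_measure_def\<close>)

lemma finite_borel_measure_scaleR:
  assumes "finite_borel_measure \<mu>"
  shows "finite_borel_measure (c *\<^sub>R \<mu>)"
  unfolding finite_borel_measure_def
proof (intro conjI)
  show "additive borel_algebra (c *\<^sub>R \<mu>)"
    using assms by (auto simp: finite_borel_measure_def additive_def scaleR_fun_def distrib_left)
  have "ennreal \<bar>c\<bar> * total_variation \<mu> UNIV < \<infinity>"
    using assms by (auto simp: finite_borel_measure_def ennreal_mult_less_top)
  then show "total_variation (c *\<^sub>R \<mu>) UNIV < \<infinity>"
    using total_variation_scaleR le_less_trans by blast
qed (use assms in \<open>auto simp: finite_borel_measure_def scaleR_fun_def\<close>)

lemma closed_regularD:
  assumes "closed_regular \<mu>" "A \<in> borel_algebra" "e > 0"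
  obtains C U where "closed C" "open U" "C \<subseteq> A" "A \<subseteq> U" "total_variation \<mu> (U - C) < ennreal e"
  using assms unfolding closed_regular_def by metis

lemma closed_regular_add:
  assumes "closed_regular \<mu>" "closed_regular \<nu>"
  shows "closed_regular (\<mu> + \<nu>)"
  unfolding closed_regular_def
proof (intro ballI allI impI)
  fix A :: "'a set" and e :: real
  assume A: "A \<in> borel_algebra" and e: "e > 0"
  obtain C U where CU: "closed C" "open U" "C \<subseteq> A" "A \<subseteq> U" "total_variation \<mu> (U - C) < ennreal (e/2)"
    using closed_regularD[OF assms(1) A, of "e/2"] e by auto
  obtain K V where KV: "closed K" "open V" "K \<subseteq> A" "A \<subseteq> V" "total_variation \<nu> (V - K) < ennreal (e/2)"
    using closed_regularD[OF assms(2) A, of "e/2"] e by auto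
  let ?W = "U \<inter> V - (C \<union> K)"
  have W: "?W \<in> borel_algebra" "U - C \<in> borel_algebra" "V - K \<in> borel_algebra"
    using CU KV by auto
  have "total_variation (\<mu> + \<nu>) ?W \<le> total_variation \<mu> ?W + total_variation \<nu> ?W"
    by (rule total_variation_add)
  also have "\<dots> \<le> total_variation \<mu> (U - C) + total_variation \<nu> (V - K)"
    by (intro add_mono total_variation_mono W) auto
  also have "\<dots> < ennreal (e/2) + ennreal (e/2)"
    by (intro add_strict_mono CU KV)
  also have "\<dots> = ennreal e"
    using e by (subst ennreal_plus[symmetric]) auto
  finally show "\<exists>C U. closed C \<and> open U \<and> C \<subseteq> A \<and> A \<subseteq> U \<and> total_variation (\<mu> + \<nu>) (U - C) < ennreal e"
    using CU KV by (intro exI[of _ "C \<union> K"] exI[of _ "U \<inter> V"]) auto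
qed

lemma closed_regular_scaleR:
  assumes "closed_regular \<mu>"
  shows "closed_regular (c *\<^sub>R \<mu>)"
  unfolding closed_regular_def
proof (intro ballI allI impI)
  fix A :: "'a set" and e :: real
  assume A: "A \<in> borel_algebra" and e: "e > 0"
  obtain C U where CU: "closed C" "open U" "C \<subseteq> A" "A \<subseteq> U"
    "total_variation \<mu> (U - C) < ennreal (e / (\<bar>c\<bar> + 1))"
    using closed_regularD[OF assms(1) A, of "e / (\<bar>c\<bar> + 1)"] e by auto
  have "total_variation (c *\<^sub>R \<mu>) (U - C) \<le> ennreal \<bar>c\<bar> * total_variation \<mu> (U - C)"
    by (rule total_variation_scaleR)
  also have "\<dots> \<le> ennreal \<bar>c\<bar> * ennreal (e / (\<bar>c\<bar> + 1))"
    using CU by (intro mult_left_mono) auto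
  also have "\<dots> = ennreal (\<bar>c\<bar> * (e / (\<bar>c\<bar> + 1)))"
    using e by (subst ennreal_mult) auto
  also have "\<dots> < ennreal e"
    using e by (intro ennreal_lessI) (auto simp: field_simps)
  finally show "\<exists>C U. closed C \<and> open U \<and> C \<subseteq> A \<and> A \<subseteq> U \<and> total_variation (c *\<^sub>R \<mu>) (U - C) < ennreal e"
    using CU by blast
qed

section \<open>The integral as a limit along the refinement of partitions\<close>

definition riemann_sum :: "('a set \<Rightarrow> real) \<Rightarrow> ('a \<Rightarrow> real) \<Rightarrow> 'a set set \<times> ('a set \<Rightarrow> 'a) \<Rightarrow> real" where
  "riemann_sum \<mu> f = (\<lambda>(Q, t). \<Sum>E\<in>Q. f (t E) * \<mu> E)"

text \<open>
  The tagged partitions, directed by refinement. Along this filter the integral becomes an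
  ordinary limit, so that linearity, uniqueness and estimates are those of limits.
\<close>

definition riemann_filter :: "('a::topological_space set set \<times> ('a set \<Rightarrow> 'a)) filter" where
  "riemann_filter = (INF P\<in>{P. borel_partition UNIV P}.
     principal {(Q, t). borel_partition UNIV Q \<and> refines UNIV Q P \<and> (\<forall>E\<in>Q. t E \<in> E)})"

lemma eventually_riemann_filter:
  "eventually R riemann_filter \<longleftrightarrow> (\<exists>P. borel_partition UNIV P \<and>
     (\<forall>Q t. borel_partition UNIV Q \<and> refines UNIV Q P \<and> (\<forall>E\<in>Q. t E \<in> E) \<longrightarrow> R (Q, t)))"
proof -
  let ?F = "\<lambda>P. {(Q, t). borel_partition UNIV Q \<and> refines UNIV Q P \<and> (\<forall>E\<in>Q. t E \<in> E)}"
  have "borel_partition UNIV {UNIV}" by (rule borel_partition_singleton) auto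
  moreover have "\<exists>S. borel_partition UNIV S \<and> ?F S \<subseteq> ?F P \<inter> ?F Q"
    if PQ: "borel_partition UNIV P" "borel_partition UNIV Q" for P Q :: "'a set set"
  proof -
    obtain S where "borel_partition UNIV S" "refines UNIV S P" "refines UNIV S Q"
      using borel_partition_common_refinement[OF PQ] by blast
    then show ?thesis by (intro exI[of _ S]) (auto intro: refines_trans)
  qed
  ultimately have "eventually R riemann_filter \<longleftrightarrow>
      (\<exists>P\<in>{P. borel_partition UNIV P}. eventually R (principal (?F P)))"
    unfolding riemann_filter_def by (intro eventually_INF_base) auto
  then show ?thesis by (auto simp: eventually_principal)
qed

lemma borel_partition_tags:
  assumes "borel_partition A P"
  shows "\<exists>t. \<forall>E\<in>P. t E \<in> E"
proof (intro exI ballI)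
  fix E assume "E \<in> P"
  then have "E \<noteq> {}" using borel_partitionD(6)[OF assms] by blast
  then show "(SOME x. x \<in> E) \<in> E" by (rule some_in_eq[THEN iffD2])
qed

lemma riemann_filter_neq_bot [simp]: "riemann_filter \<noteq> bot"
proof
  assume "riemann_filter = (bot :: ('a set set \<times> ('a set \<Rightarrow> 'a)) filter)"
  then have "eventually (\<lambda>_. False) (riemann_filter :: ('a set set \<times> ('a set \<Rightarrow> 'a)) filter)"
    by simp
  then obtain P :: "'a set set" where P: "borel_partition UNIV P" and
    no: "\<forall>Q (t :: 'a set \<Rightarrow> 'a). borel_partition UNIV Q \<and> refines UNIV Q P \<and> (\<forall>E\<in>Q. t E \<in> E) \<longrightarrow> False"
    unfolding eventually_riemann_filter by (elim exE conjE)
  obtain t :: "'a set \<Rightarrow> 'a" where "\<forall>E\<in>P. t E \<in> E"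
    using borel_partition_tags[OF P] ..
  then show False
    using no P refines_refl[OF borel_partitionD(3)[OF P]] by blast
qed

lemma has_measure_integral_iff_tendsto:
  "has_measure_integral \<mu> f I \<longleftrightarrow> (riemann_sum \<mu> f \<longlongrightarrow> I) riemann_filter"
proof -
  have refines: "refines UNIV Q P \<longleftrightarrow> (\<forall>E\<in>Q. \<exists>E'\<in>P. E \<subseteq> E')"
    if "borel_partition UNIV P" "borel_partition UNIV Q" for P Q :: "'a set set"
    using that by (simp add: refines_def borel_partition_def)
  show ?thesis
    unfolding has_measure_integral_def tendsto_iff eventually_riemann_filter riemann_sum_def
      dist_real_def split_conv
    by (simp add: refines cong: conj_cong)
qed

lemma has_measure_integral_unique:
  "has_measure_integral \<mu> f I \<Longrightarrow> has_measure_integral \<mu> f J \<Longrightarrow> I = J"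
  unfolding has_measure_integral_iff_tendsto using tendsto_unique[OF riemann_filter_neq_bot] .

lemma measure_integral_eqI: "has_measure_integral \<mu> f I \<Longrightarrow> measure_integral \<mu> f = I"
  unfolding measure_integral_def by (blast intro: the_equality has_measure_integral_unique)

lemma has_measure_integral_add_fun:
  assumes "has_measure_integral \<mu> f I" "has_measure_integral \<mu> g J"
  shows "has_measure_integral \<mu> (f + g) (I + J)"
proof -
  have "riemann_sum \<mu> (f + g) = (\<lambda>x. riemann_sum \<mu> f x + riemann_sum \<mu> g x)"
    by (auto simp: riemann_sum_def distrib_right sum.distrib)
  then show ?thesis
    using assms unfolding has_measure_integral_iff_tendsto by (auto intro: tendsto_add)
qed

lemma has_measure_integral_scaleR_fun:
  assumes "has_measure_integral \<mu> f I"
  shows "has_measure_integral \<mu> (c *\<^sub>R f) (c * I)"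
proof -
  have "riemann_sum \<mu> (c *\<^sub>R f) = (\<lambda>x. c * riemann_sum \<mu> f x)"
    by (auto simp: riemann_sum_def scaleR_fun_def sum_distrib_left mult.assoc)
  then show ?thesis
    using assms unfolding has_measure_integral_iff_tendsto by (auto intro: tendsto_mult_left)
qed

lemma has_measure_integral_add_measure:
  assumes "has_measure_integral \<mu> f I" "has_measure_integral \<nu> f J"
  shows "has_measure_integral (\<mu> + \<nu>) f (I + J)"
proof -
  have "riemann_sum (\<mu> + \<nu>) f = (\<lambda>x. riemann_sum \<mu> f x + riemann_sum \<nu> f x)"
    by (auto simp: riemann_sum_def distrib_left sum.distrib)
  then show ?thesis
    using assms unfolding has_measure_integral_iff_tendsto by (auto intro: tendsto_add)
qed

lemma has_measure_integral_scaleR_measure: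
  assumes "has_measure_integral \<mu> f I"
  shows "has_measure_integral (c *\<^sub>R \<mu>) f (c * I)"
proof -
  have "riemann_sum (c *\<^sub>R \<mu>) f = (\<lambda>x. c * riemann_sum \<mu> f x)"
    by (auto simp: riemann_sum_def scaleR_fun_def sum_distrib_left mult_ac)
  then show ?thesis
    using assms unfolding has_measure_integral_iff_tendsto by (auto intro: tendsto_mult_left)
qed

lemma eventually_refines:
  assumes "borel_partition UNIV P"
    and "\<And>Q t. borel_partition UNIV Q \<Longrightarrow> refines UNIV Q P \<Longrightarrow> (\<And>E. E \<in> Q \<Longrightarrow> t E \<in> E) \<Longrightarrow> R (Q, t)"
  shows "eventually R riemann_filter"
  unfolding eventually_riemann_filter using assms by blast

lemma refines_subset_or:
  assumes "refines A Q P" "\<forall>E\<in>P. E \<subseteq> C \<or> E \<subseteq> D" "E \<in> Q"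
  shows "E \<subseteq> C \<or> E \<subseteq> D"
proof -
  obtain W where "W \<in> P" "E \<subseteq> W" using assms(1,3) unfolding refines_def by meson
  then show ?thesis using assms(2) by (meson order_trans)
qed

lemma borel_partition_Compl:
  assumes "B \<in> borel_algebra"
  shows "\<exists>P. borel_partition UNIV P \<and> (\<forall>E\<in>P. E \<subseteq> B \<or> E \<subseteq> - B)"
proof (intro exI conjI)
  let ?g = "\<lambda>x. x \<in> B"
  have "{x. ?g x = k} \<in> borel_algebra" for k
    using assms by (cases k) (auto simp: Collect_neg_eq)
  then show "borel_partition UNIV ((\<lambda>k. {x\<in>UNIV. ?g x = k}) ` ?g ` UNIV)"
    by (intro borel_partition_fibres) auto
qed auto

text \<open>
  The values of the integrand on a null set do not matter, even if it is unbounded there: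
  eventually every block lies in the null set or in its complement.
\<close>

lemma eventually_riemann_sum_null:
  assumes \<mu>: "finite_borel_measure \<mu>" and B: "closed B" and null: "total_variation \<mu> (- B) = 0"
  shows "eventually (\<lambda>(Q, t). borel_partition UNIV Q \<and> (\<forall>E\<in>Q. t E \<in> B \<or> \<mu> E = 0)) riemann_filter"
proof -
  obtain P where P: "borel_partition UNIV P" "\<forall>E\<in>P. E \<subseteq> B \<or> E \<subseteq> - B"
    using borel_partition_Compl[OF closed_in_borel_algebra[OF B]] by (elim exE conjE)
  show ?thesis
  proof (rule eventually_refines[OF P(1)], unfold split_conv, intro conjI ballI)
    fix Q and t :: "'a set \<Rightarrow> 'a" and E
    assume Q: "borel_partition UNIV Q" "refines UNIV Q P" "\<And>E. E \<in> Q \<Longrightarrow> t E \<in> E" and E: "E \<in> Q"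
    have "E \<subseteq> B \<or> E \<subseteq> - B" by (rule refines_subset_or[OF Q(2) P(2) E])
    moreover have "\<mu> E = 0" if "E \<subseteq> - B"
    proof (rule null_subset[OF finite_borel_measureD(1)[OF \<mu>] null _ _ that])
      show "- B \<in> borel_algebra" by (intro Compl_in_borel_algebra closed_in_borel_algebra B)
      show "E \<in> borel_algebra" using borel_partitionD(2)[OF Q(1)] E by (rule subsetD)
    qed
    ultimately show "t E \<in> B \<or> \<mu> E = 0" using Q(3)[OF E] by (meson subsetD)
  qed
qed

lemma has_measure_integral_cong_null:
  assumes "finite_borel_measure \<mu>" "closed B" "total_variation \<mu> (- B) = 0"
    and "\<And>x. x \<in> B \<Longrightarrow> f x = g x" "has_measure_integral \<mu> f I"
  shows "has_measure_integral \<mu> g I"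
proof -
  have "eventually (\<lambda>x. riemann_sum \<mu> f x = riemann_sum \<mu> g x) riemann_filter"
    using eventually_riemann_sum_null[OF assms(1-3)]
  proof eventually_elim
    case (elim x)
    obtain Q t where x: "x = (Q, t)" by (cases x)
    have "f (t E) * \<mu> E = g (t E) * \<mu> E" if "E \<in> Q" for E
      using elim that assms(4) x by fastforce
    then show ?case unfolding x riemann_sum_def split_conv by (intro sum.cong refl)
  qed
  then show ?thesis
    using assms(5) unfolding has_measure_integral_iff_tendsto by (metis tendsto_cong)
qed

text \<open>
  The estimate that makes integration against a measure carried by \<open>B\<close> continuous for \<open>rho B\<close>.
\<close>

lemma has_measure_integral_bound:
  assumes \<mu>: "finite_borel_measure \<mu>" and "closed B" "total_variation \<mu> (- B) = 0"
    and f: "\<And>x. x \<in> B \<Longrightarrow> \<bar>f x\<bar> \<le> c" and c: "0 \<le> c" and "has_measure_integral \<mu> f I"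
  shows "\<bar>I\<bar> \<le> c * enn2real (total_variation \<mu> UNIV)"
proof (rule tendsto_upperbound)
  show "((\<lambda>x. \<bar>riemann_sum \<mu> f x\<bar>) \<longlongrightarrow> \<bar>I\<bar>) riemann_filter"
    using assms unfolding has_measure_integral_iff_tendsto by (auto intro: tendsto_rabs)
  show "eventually (\<lambda>x. \<bar>riemann_sum \<mu> f x\<bar> \<le> c * enn2real (total_variation \<mu> UNIV)) riemann_filter"
    using eventually_riemann_sum_null[OF assms(1-3)]
  proof eventually_elim
    case (elim x)
    obtain Q t where x: "x = (Q, t)" by (cases x)
    have Q: "borel_partition UNIV Q" and t: "\<And>E. E \<in> Q \<Longrightarrow> t E \<in> B \<or> \<mu> E = 0"
      using elim x by auto
    have "\<bar>riemann_sum \<mu> f x\<bar> \<le> (\<Sum>E\<in>Q. \<bar>f (t E) * \<mu> E\<bar>)"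
      by (simp add: x riemann_sum_def sum_abs)
    also have "\<dots> \<le> (\<Sum>E\<in>Q. c * \<bar>\<mu> E\<bar>)"
    proof (rule sum_mono)
      fix E assume "E \<in> Q"
      then show "\<bar>f (t E) * \<mu> E\<bar> \<le> c * \<bar>\<mu> E\<bar>"
        using t f by (cases "\<mu> E = 0") (auto simp: abs_mult intro: mult_right_mono)
    qed
    also have "\<dots> = c * (\<Sum>E\<in>Q. \<bar>\<mu> E\<bar>)"
      by (simp add: sum_distrib_left)
    also have "\<dots> \<le> c * enn2real (total_variation \<mu> UNIV)"
      by (intro mult_left_mono sum_abs_le_enn2real_total_variation \<mu> Q c)
    finally show ?case .
  qed
qed simp

text \<open>The blocks are the sets on which the integer part of \<open>f / e\<close> is constant; boundedness leaves finitely many.\<close>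

lemma borel_partition_small_oscillation:
  fixes f :: "'a::topological_space \<Rightarrow> real"
  assumes f: "continuous_on UNIV f" "\<And>x. \<bar>f x\<bar> \<le> c" and e: "e > 0"
  shows "\<exists>P. borel_partition UNIV P \<and> (\<forall>E\<in>P. \<forall>x\<in>E. \<forall>y\<in>E. \<bar>f x - f y\<bar> \<le> e)"
proof (intro exI conjI)
  let ?g = "\<lambda>x. \<lfloor>f x / e\<rfloor>"
  let ?P = "(\<lambda>k. {x\<in>UNIV. ?g x = k}) ` ?g ` UNIV"
  have "?g x \<in> {\<lfloor>- c / e\<rfloor>..\<lfloor>c / e\<rfloor>}" for x
    using f(2)[of x] e
    by (simp only: atLeastAtMost_iff) (intro conjI floor_mono divide_right_mono; linarith)
  then have "finite (?g ` UNIV)"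
    by (meson finite_atLeastAtMost_int finite_subset image_subsetI)
  moreover have "{x\<in>UNIV. ?g x = k} \<in> borel_algebra" for k
  proof -
    have "{x\<in>UNIV. ?g x = k} = {x. of_int k * e \<le> f x} \<inter> {x. f x < (of_int k + 1) * e}"
      using e by (auto simp: floor_eq_iff pos_le_divide_eq pos_divide_less_eq)
    moreover have "closed {x. of_int k * e \<le> f x}" "open {x. f x < (of_int k + 1) * e}"
      using f(1) by (auto intro: closed_Collect_le open_Collect_less)
    ultimately show ?thesis by auto
  qed
  ultimately show "borel_partition UNIV ?P" by (rule borel_partition_fibres)
  show "\<forall>E\<in>?P. \<forall>x\<in>E. \<forall>y\<in>E. \<bar>f x - f y\<bar> \<le> e"
  proof clarsimp
    fix x y z assume "\<lfloor>f x / e\<rfloor> = \<lfloor>f z / e\<rfloor>" "\<lfloor>f y / e\<rfloor> = \<lfloor>f z / e\<rfloor>"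
    then have "\<bar>f x / e - f y / e\<bar> \<le> 1" by linarith
    then show "\<bar>f x - f y\<bar> \<le> e"
      using e by (simp add: field_simps flip: diff_divide_distrib)
  qed
qed

text \<open>
  The Cauchy property of the Riemann sums: a finer sum is regrouped along the coarser partition, so
  that only the oscillation of \<open>f\<close> on the coarse blocks enters.
\<close>

lemma riemann_sum_refines:
  assumes \<mu>: "finite_borel_measure \<mu>" and P: "borel_partition UNIV P"
    and osc: "\<And>E x y. E \<in> P \<Longrightarrow> x \<in> E \<Longrightarrow> y \<in> E \<Longrightarrow> \<bar>f x - f y\<bar> \<le> e"
    and Q: "borel_partition UNIV Q" "refines UNIV Q P"
    and s: "\<And>E. E \<in> P \<Longrightarrow> s E \<in> E" and t: "\<And>E. E \<in> Q \<Longrightarrow> t E \<in> E"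
    and e: "e \<ge> 0"
  shows "\<bar>riemann_sum \<mu> f (Q, t) - riemann_sum \<mu> f (P, s)\<bar> \<le> e * enn2real (total_variation \<mu> UNIV)"
proof -
  note fin = borel_partitionD(1)[OF Q(1)] borel_partitionD(1)[OF P]
  have "riemann_sum \<mu> f (P, s) = (\<Sum>W\<in>P. \<Sum>E\<in>{E\<in>Q. E \<subseteq> W}. f (s W) * \<mu> E)"
    unfolding riemann_sum_def split_conv
  proof (rule sum.cong[OF refl])
    fix W assume "W \<in> P"
    then show "f (s W) * \<mu> W = (\<Sum>E\<in>{E\<in>Q. E \<subseteq> W}. f (s W) * \<mu> E)"
      using additive_borel_partition[OF finite_borel_measureD(1)[OF \<mu>] borel_partition_restrict[OF Q]]
      by (simp add: sum_distrib_left)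
  qed
  moreover have "riemann_sum \<mu> f (Q, t) = (\<Sum>W\<in>P. \<Sum>E\<in>{E\<in>Q. E \<subseteq> W}. f (t E) * \<mu> E)"
    unfolding riemann_sum_def split_conv by (rule sum_refines[OF fin Q(2)])
  ultimately have "riemann_sum \<mu> f (Q, t) - riemann_sum \<mu> f (P, s)
      = (\<Sum>W\<in>P. \<Sum>E\<in>{E\<in>Q. E \<subseteq> W}. (f (t E) - f (s W)) * \<mu> E)"
    by (simp add: sum_subtractf left_diff_distrib)
  also have "\<bar>\<dots>\<bar> \<le> (\<Sum>W\<in>P. \<Sum>E\<in>{E\<in>Q. E \<subseteq> W}. e * \<bar>\<mu> E\<bar>)"
  proof (intro sum_abs[THEN order_trans] sum_mono)
    fix W E assume "W \<in> P" "E \<in> {E\<in>Q. E \<subseteq> W}"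
    then have "\<bar>f (t E) - f (s W)\<bar> \<le> e"
      using s t by (intro osc) auto
    then show "\<bar>(f (t E) - f (s W)) * \<mu> E\<bar> \<le> e * \<bar>\<mu> E\<bar>"
      by (simp add: abs_mult mult_right_mono)
  qed
  also have "\<dots> = e * (\<Sum>E\<in>Q. \<bar>\<mu> E\<bar>)"
    by (simp add: sum_refines[OF fin Q(2)] sum_distrib_left)
  also have "\<dots> \<le> e * enn2real (total_variation \<mu> UNIV)"
    by (intro mult_left_mono sum_abs_le_enn2real_total_variation \<mu> Q e)
  finally show ?thesis .
qed

text \<open>
  Two fine Riemann sums are compared through the one of the coarse partition that both refine;
  completeness of the reals then provides the limit.
\<close>

lemma bounded_continuous_has_measure_integral:
  fixes f :: "'a::topological_space \<Rightarrow> real"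
  assumes \<mu>: "finite_borel_measure \<mu>" and f: "continuous_on UNIV f" "\<And>x. \<bar>f x\<bar> \<le> c"
  shows "\<exists>I. has_measure_integral \<mu> f I"
proof -
  let ?V = "enn2real (total_variation \<mu> UNIV)"
  let ?F = "filtermap (riemann_sum \<mu> f) riemann_filter"
  have "cauchy_filter ?F"
    unfolding cauchy_filter_metric_filtermap
  proof (intro allI impI)
    fix e :: real assume e: "e > 0"
    define d where "d = e / (2 * ?V + 1)"
    have V: "?V \<ge> 0" by simp
    then have d: "d > 0" using e unfolding d_def by (intro divide_pos_pos) linarith+
    have "2 * ?V + 1 \<noteq> 0" using V by linarith
    then have "d * (2 * ?V + 1) = e" unfolding d_def by simp
    then have small: "2 * (d * ?V) < e" using d by (simp add: algebra_simps)
    obtain P where P: "borel_partition UNIV P" "\<forall>E\<in>P. \<forall>x\<in>E. \<forall>y\<in>E. \<bar>f x - f y\<bar> \<le> d"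
      using borel_partition_small_oscillation[OF f d] by blast
    obtain s where s: "\<forall>E\<in>P. s E \<in> E"
      using borel_partition_tags[OF P(1)] ..
    let ?R = "\<lambda>x. dist (riemann_sum \<mu> f x) (riemann_sum \<mu> f (P, s)) \<le> d * ?V"
    have "eventually ?R riemann_filter"
    proof (rule eventually_refines[OF P(1)])
      fix Q and t :: "'a set \<Rightarrow> 'a"
      assume Q: "borel_partition UNIV Q" "refines UNIV Q P" "\<And>E. E \<in> Q \<Longrightarrow> t E \<in> E"
      have osc: "\<bar>f x - f y\<bar> \<le> d" if "E \<in> P" "x \<in> E" "y \<in> E" for E x y
        using P(2) that by blast
      show "?R (Q, t)"
        unfolding dist_real_def
        using riemann_sum_refines[OF \<mu> P(1) osc Q(1,2) bspec[OF s] Q(3) less_imp_le[OF d]] .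
    qed
    moreover have "dist (riemann_sum \<mu> f x) (riemann_sum \<mu> f y) < e" if "?R x" "?R y" for x y
      using dist_triangle2[of "riemann_sum \<mu> f x" "riemann_sum \<mu> f y" "riemann_sum \<mu> f (P, s)"]
        that small by linarith
    ultimately show "\<exists>R. eventually R riemann_filter \<and>
        (\<forall>x y. R x \<and> R y \<longrightarrow> dist (riemann_sum \<mu> f x) (riemann_sum \<mu> f y) < e)"
      by blast
  qed
  moreover have "?F \<noteq> bot" "?F \<le> principal UNIV" by (simp_all add: filtermap_bot_iff)
  ultimately obtain I where "?F \<le> nhds I"
    using complete_UNIV[where 'a=real] unfolding complete_uniform by meson
  then show ?thesis
    unfolding has_measure_integral_iff_tendsto filterlim_def by (rule exI)
qed

section \<open>A regular measure is determined by its integrals\<close>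

text \<open>
  The positive cone of the bounded continuous functions. Working on the cone alone avoids having to
  extend the positive and negative parts of a functional to differences of its elements.
\<close>

definition BCpos :: "('a::topological_space \<Rightarrow> real) set" where
  "BCpos = {f. continuous_on UNIV f \<and> (\<forall>x. 0 \<le> f x) \<and> (\<exists>c. \<forall>x. f x \<le> c)}"

lemma BCposI: "continuous_on UNIV f \<Longrightarrow> (\<And>x. 0 \<le> f x) \<Longrightarrow> (\<And>x. f x \<le> c) \<Longrightarrow> f \<in> BCpos"
  by (auto simp: BCpos_def)

lemma BCposD:
  assumes "f \<in> BCpos"
  shows "continuous_on UNIV f" "0 \<le> f x" "\<exists>c. \<forall>x. f x \<le> c"
  using assms by (auto simp: BCpos_def)

lemma BCpos_const [intro]: "0 \<le> c \<Longrightarrow> (\<lambda>_. c) \<in> BCpos"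
  by (rule BCposI) auto

lemma BCpos_add [intro]:
  assumes "f \<in> BCpos" "g \<in> BCpos"
  shows "f + g \<in> BCpos"
proof -
  obtain a b where "\<forall>x. f x \<le> a" "\<forall>x. g x \<le> b" using assms by (auto simp: BCpos_def)
  moreover have "continuous_on UNIV (\<lambda>x. f x + g x)"
    by (intro continuous_on_add BCposD assms)
  ultimately show ?thesis
    using assms by (intro BCposI[of _ "a + b"]) (auto simp: plus_fun_def BCposD intro: add_mono)
qed

lemma BCpos_scaleR [intro]:
  assumes "f \<in> BCpos" "0 \<le> c"
  shows "c *\<^sub>R f \<in> BCpos"
proof -
  obtain a where "\<forall>x. f x \<le> a" using assms by (auto simp: BCpos_def)
  moreover have "continuous_on UNIV (\<lambda>x. c * f x)"
    by (intro continuous_on_mult continuous_on_const BCposD assms)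
  ultimately show ?thesis
    using assms by (intro BCposI[of _ "c * a"]) (auto simp: scaleR_fun_def BCposD intro: mult_left_mono)
qed

lemma BCpos_le:
  assumes "g \<in> BCpos" "continuous_on UNIV f" "\<And>x. 0 \<le> f x" "\<And>x. f x \<le> g x"
  shows "f \<in> BCpos"
proof -
  obtain c where "\<forall>x. g x \<le> c" using BCposD(3)[OF assms(1)] ..
  then show ?thesis using assms(2-) by (intro BCposI[of f c]) (auto intro: order_trans)
qed

lemma BCpos_diff:
  assumes "f \<in> BCpos" "g \<in> BCpos" "\<And>x. g x \<le> f x"
  shows "f - g \<in> BCpos"
proof (rule BCpos_le[OF assms(1)])
  show "continuous_on UNIV (f - g)"
    using assms by (auto simp: fun_diff_def BCposD intro: continuous_on_diff)
qed (use assms in \<open>auto simp: BCposD\<close>)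

lemma BCpos_mult_le_one:
  assumes "f \<in> BCpos" "u \<in> BCpos" "\<And>x. u x \<le> 1"
  shows "f * u \<in> BCpos"
proof (rule BCpos_le[OF assms(1)])
  show "continuous_on UNIV (f * u)"
    using assms by (auto simp: times_fun_def BCposD intro: continuous_on_mult)
qed (use assms in \<open>auto simp: BCposD mult_left_le\<close>)

lemma urysohn_BCpos:
  fixes S T :: "'a::metric_space set"
  assumes "closed S" "closed T" "S \<inter> T = {}"
  obtains u where "u \<in> BCpos" "\<And>x. u x \<le> 1" "\<And>x. x \<in> S \<Longrightarrow> u x = 1" "\<And>x. x \<in> T \<Longrightarrow> u x = 0"
proof -
  have "normal_space (euclidean :: 'a topology)"
    by (intro metrizable_imp_normal_space metrizable_space_euclidean)
  then obtain u where u: "continuous_map euclidean (top_of_set {0..1::real}) u" "u ` T \<subseteq> {0}" "u ` S \<subseteq> {1}"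
    using Urysohn_lemma[of euclidean T S 0 1] assms by (auto simp: disjnt_def Int_commute)
  then have "continuous_on UNIV u" "\<And>x. 0 \<le> u x \<and> u x \<le> 1"
    by (auto simp: continuous_map_in_subtopology)
  then show ?thesis
    using u by (intro that[of u] BCposI[of u 1]) auto
qed

lemma borel_partition_adapted:
  assumes "borel_partition UNIV Q" "\<And>E. E \<in> Q \<Longrightarrow> E \<subseteq> W \<or> E \<subseteq> - W"
  shows "borel_partition W {E\<in>Q. E \<subseteq> W}"
proof -
  have "\<Union>{E\<in>Q. E \<subseteq> W} = W"
  proof (intro equalityI subsetI)
    fix x assume x: "x \<in> W"
    have "x \<in> \<Union>Q" using borel_partitionD(4)[OF assms(1)] by simp
    then obtain E where E: "E \<in> Q" "x \<in> E" ..
    then have "E \<subseteq> W" using assms(2)[OF E(1)] x by (meson ComplD subsetD)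
    then show "x \<in> \<Union>{E\<in>Q. E \<subseteq> W}" using E by (intro UnionI[of E]) simp_all
  qed auto
  moreover have "disjoint {E\<in>Q. E \<subseteq> W}"
    using borel_partitionD(5)[OF assms(1)] by (rule pairwise_subset) auto
  ultimately show ?thesis
    using borel_partitionD[OF assms(1)] by (auto simp: borel_partition_def partition_on_def)
qed

text \<open>
  The indicator of a set \<open>A\<close> is close to a Urysohn function between a closed set below and an
  open set above \<open>A\<close>: the two differ only on a set of small variation.
\<close>

lemma closed_regular_eq_0:
  fixes \<mu> :: "'a::metric_space set \<Rightarrow> real"
  assumes \<mu>: "finite_borel_measure \<mu>" and reg: "closed_regular \<mu>"
    and int: "\<And>f. f \<in> BCpos \<Longrightarrow> has_measure_integral \<mu> f 0"
  shows "\<mu> = 0"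
proof
  fix A
  have add: "additive borel_algebra \<mu>" using finite_borel_measureD(1)[OF \<mu>] .
  show "\<mu> A = 0 A"
  proof (cases "A \<in> borel_algebra")
    case False
    then show ?thesis using finite_borel_measureD(3)[OF \<mu>] by simp
  next
    case A: True
    have "\<bar>\<mu> A\<bar> \<le> 0 + e" if e: "e > 0" for e
    proof -
      obtain C U where CU: "closed C" "open U" "C \<subseteq> A" "A \<subseteq> U"
        and small: "total_variation \<mu> (U - C) < ennreal (e/2)"
        using closed_regularD[OF reg A, of "e/2"] e by auto
      let ?W = "U - C"
      define v where "v = enn2real (total_variation \<mu> ?W)"
      have W: "?W \<in> borel_algebra" "A - C \<in> borel_algebra" "C \<in> borel_algebra"
        using CU A by auto
      have v: "total_variation \<mu> ?W = ennreal v" "v \<ge> 0"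
        using small unfolding v_def by (auto simp: ennreal_enn2real_if)
      then have v2: "v < e/2"
        using small by (simp add: ennreal_less_iff)
      have "C \<inter> - U = {}" using CU by blast
      then obtain u where u: "u \<in> BCpos" "\<And>x. u x \<le> 1" "\<And>x. x \<in> C \<Longrightarrow> u x = 1" "\<And>x. x \<in> - U \<Longrightarrow> u x = 0"
        using urysohn_BCpos[OF CU(1) closed_Compl[OF CU(2)]] by blast
      have ev: "eventually (\<lambda>x. \<bar>riemann_sum \<mu> u x - \<mu> C\<bar> \<le> v) riemann_filter"
      proof -
        obtain P1 where P1: "borel_partition UNIV P1" "\<forall>E\<in>P1. E \<subseteq> C \<or> E \<subseteq> - C"
          using borel_partition_Compl[OF W(3)] by (elim exE conjE)
        obtain P2 where P2: "borel_partition UNIV P2" "\<forall>E\<in>P2. E \<subseteq> U \<or> E \<subseteq> - U"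
          using borel_partition_Compl[OF open_in_borel_algebra[OF CU(2)]] by (elim exE conjE)
        obtain P where P: "borel_partition UNIV P" "refines UNIV P P1" "refines UNIV P P2"
          using borel_partition_common_refinement[OF P1(1) P2(1)] by (elim exE conjE)
        show ?thesis
        proof (rule eventually_refines[OF P(1)])
          fix Q and t :: "'a set \<Rightarrow> 'a"
          assume Q: "borel_partition UNIV Q" "refines UNIV Q P" and t: "\<And>E. E \<in> Q \<Longrightarrow> t E \<in> E"
          note QC = refines_subset_or[OF refines_trans[OF Q(2) P(2)] P1(2)]
          note QU = refines_subset_or[OF refines_trans[OF Q(2) P(3)] P2(2)]
          have fin: "finite Q" using borel_partitionD(1)[OF Q(1)] .
          have partC: "borel_partition C {E\<in>Q. E \<subseteq> C}"
            using borel_partition_adapted[OF Q(1) QC] .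
          have partW: "borel_partition ?W {E\<in>Q. E \<subseteq> ?W}"
          proof (rule borel_partition_adapted[OF Q(1)])
            show "E \<subseteq> ?W \<or> E \<subseteq> - ?W" if "E \<in> Q" for E
              using QC[OF that] QU[OF that] by blast
          qed
          have "\<mu> C = (\<Sum>E\<in>Q. if E \<subseteq> C then \<mu> E else 0)"
            using additive_borel_partition[OF add partC] fin by (simp add: sum.inter_filter)
          then have "riemann_sum \<mu> u (Q, t) - \<mu> C
              = (\<Sum>E\<in>Q. u (t E) * \<mu> E - (if E \<subseteq> C then \<mu> E else 0))"
            by (simp add: riemann_sum_def sum_subtractf)
          also have "\<bar>\<dots>\<bar> \<le> (\<Sum>E\<in>Q. if E \<subseteq> ?W then \<bar>\<mu> E\<bar> else 0)"
          proof (intro sum_abs[THEN order_trans] sum_mono)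
            fix E assume E: "E \<in> Q"
            note tE = t[OF E]
            consider "E \<subseteq> C" | "E \<subseteq> ?W" "\<not> E \<subseteq> C" | "E \<subseteq> - U"
              using QC[OF E] QU[OF E] tE by blast
            then show "\<bar>u (t E) * \<mu> E - (if E \<subseteq> C then \<mu> E else 0)\<bar> \<le> (if E \<subseteq> ?W then \<bar>\<mu> E\<bar> else 0)"
            proof cases
              case 1
              then have "u (t E) = 1" using u(3) tE by blast
              then show ?thesis using 1 by simp
            next
              case 2
              have "\<bar>u (t E)\<bar> \<le> 1" using u(2)[of "t E"] BCposD(2)[OF u(1), of "t E"] by simp
              then have "\<bar>u (t E)\<bar> * \<bar>\<mu> E\<bar> \<le> 1 * \<bar>\<mu> E\<bar>" by (intro mult_right_mono) auto
              then show ?thesis using 2 by (simp add: abs_mult)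
            next
              case 3
              then have "u (t E) = 0" "\<not> E \<subseteq> C" using u(4) tE CU by blast+
              then show ?thesis by simp
            qed
          qed
          also have "\<dots> = (\<Sum>E\<in>{E\<in>Q. E \<subseteq> ?W}. \<bar>\<mu> E\<bar>)"
            using fin by (simp add: sum.inter_filter)
          also have "\<dots> \<le> v"
            using sum_abs_le_total_variation[OF partW, of \<mu>] v by simp
          finally show "\<bar>riemann_sum \<mu> u (Q, t) - \<mu> C\<bar> \<le> v" .
        qed
      qed
      have "(riemann_sum \<mu> u \<longlongrightarrow> 0) riemann_filter"
        using int[OF u(1)] by (simp only: has_measure_integral_iff_tendsto)
      then have lim: "((\<lambda>x. \<bar>riemann_sum \<mu> u x - \<mu> C\<bar>) \<longlongrightarrow> \<bar>0 - \<mu> C\<bar>) riemann_filter"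
        by (rule tendsto_rabs[OF tendsto_diff[OF _ tendsto_const]])
      have "\<bar>0 - \<mu> C\<bar> \<le> v"
        using tendsto_upperbound[OF lim ev riemann_filter_neq_bot] .
      moreover have "\<bar>\<mu> (A - C)\<bar> \<le> v"
      proof -
        have "ennreal \<bar>\<mu> (A - C)\<bar> \<le> total_variation \<mu> (A - C)"
          by (rule abs_le_total_variation[OF add W(2)])
        also have "\<dots> \<le> ennreal v"
          unfolding v(1)[symmetric] using CU by (intro total_variation_mono W) auto
        finally show ?thesis using v(2) by simp
      qed
      moreover have "\<mu> (A - C) = \<mu> A - \<mu> C"
        by (rule additive_Diff[OF add W(3) A CU(3)])
      ultimately show "\<bar>\<mu> A\<bar> \<le> 0 + e" using v2 by linarith
    qed
    then have "\<bar>\<mu> A\<bar> \<le> 0" by (rule field_le_epsilon)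
    then show ?thesis by simp
  qed
qed

section \<open>Positive functionals are regular measures\<close>

locale positive_functional =
  fixes \<Lambda> :: "('a::metric_space \<Rightarrow> real) \<Rightarrow> real"
  assumes add: "f \<in> BCpos \<Longrightarrow> g \<in> BCpos \<Longrightarrow> \<Lambda> (f + g) = \<Lambda> f + \<Lambda> g"
    and scaleR: "f \<in> BCpos \<Longrightarrow> 0 \<le> c \<Longrightarrow> \<Lambda> (c *\<^sub>R f) = c * \<Lambda> f"
    and nonneg: "f \<in> BCpos \<Longrightarrow> 0 \<le> \<Lambda> f"
begin

lemma mono:
  assumes "f \<in> BCpos" "g \<in> BCpos" "\<And>x. f x \<le> g x"
  shows "\<Lambda> f \<le> \<Lambda> g"
proof -
  have d: "g - f \<in> BCpos" using BCpos_diff[OF assms(2,1,3)] .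
  have "\<Lambda> (f + (g - f)) = \<Lambda> f + \<Lambda> (g - f)" by (rule add[OF assms(1) d])
  moreover have "f + (g - f) = g" by simp
  ultimately show ?thesis using nonneg[OF d] by simp
qed

lemma const: "0 \<le> c \<Longrightarrow> \<Lambda> (\<lambda>_. c) = c * \<Lambda> (\<lambda>_. 1)"
  using scaleR[OF BCpos_const[of 1], of c] by (simp add: scaleR_fun_def)

definition closed_content :: "'a set \<Rightarrow> real" where
  "closed_content C = (INF f\<in>{f\<in>BCpos. \<forall>x\<in>C. 1 \<le> f x}. \<Lambda> f)"

lemma content_le:
  assumes "f \<in> BCpos" "\<And>x. x \<in> C \<Longrightarrow> 1 \<le> f x"
  shows "closed_content C \<le> \<Lambda> f"
  unfolding closed_content_def using assms
  by (intro cINF_lower) (auto intro!: bdd_belowI[of _ 0] nonneg)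

lemma content_greatest:
  assumes "\<And>f. f \<in> BCpos \<Longrightarrow> (\<And>x. x \<in> C \<Longrightarrow> 1 \<le> f x) \<Longrightarrow> m \<le> \<Lambda> f"
  shows "m \<le> closed_content C"
proof -
  have "(\<lambda>_. 1) \<in> {f\<in>BCpos. \<forall>x\<in>C. 1 \<le> f x}" by auto
  then show ?thesis
    unfolding closed_content_def using assms by (intro cINF_greatest) blast+
qed

lemma content_approx:
  assumes "e > 0"
  obtains f where "f \<in> BCpos" "\<And>x. x \<in> C \<Longrightarrow> 1 \<le> f x" "\<Lambda> f < closed_content C + e"
  using content_greatest[of C "closed_content C + e"] assms by (metis linorder_not_less less_add_same_cancel1)

lemma content_nonneg: "0 \<le> closed_content C"
  by (rule content_greatest) (rule nonneg)

lemma content_mono: "C \<subseteq> D \<Longrightarrow> closed_content C \<le> closed_content D"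
  by (rule content_greatest, rule content_le) auto

lemma content_UNIV: "closed_content UNIV = \<Lambda> (\<lambda>_. 1)"
proof (rule antisym)
  show "closed_content UNIV \<le> \<Lambda> (\<lambda>_. 1)" by (rule content_le) auto
  show "\<Lambda> (\<lambda>_. 1) \<le> closed_content UNIV" by (rule content_greatest, rule mono) auto
qed

lemma content_empty: "closed_content {} = 0"
  using content_le[of "\<lambda>_. 0" "{}"] const[of 0] content_nonneg[of "{}"] by auto

text \<open>
  Splitting \<open>f\<close> as \<open>f * u + f * (1 - u)\<close> with a Urysohn function \<open>u\<close> yields competitors for both sets.
\<close>

lemma content_disjoint:
  assumes "closed K" "closed C" "K \<inter> C = {}" "K \<union> C \<subseteq> D"
  shows "closed_content K + closed_content C \<le> closed_content D"
proof (rule content_greatest)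
  fix f assume f: "f \<in> BCpos" "\<And>x. x \<in> D \<Longrightarrow> 1 \<le> f x"
  obtain u where u: "u \<in> BCpos" "\<And>x. u x \<le> 1" "\<And>x. x \<in> K \<Longrightarrow> u x = 1" "\<And>x. x \<in> C \<Longrightarrow> u x = 0"
    using urysohn_BCpos[OF assms(1-3)] by metis
  have fu: "f * u \<in> BCpos" using BCpos_mult_le_one[OF f(1) u(1,2)] .
  have fu': "f - f * u \<in> BCpos"
    by (rule BCpos_diff[OF f(1) fu]) (use u f in \<open>auto simp: BCposD mult_left_le\<close>)
  have "closed_content K \<le> \<Lambda> (f * u)"
    by (rule content_le[OF fu]) (use assms u f in auto)
  moreover have "closed_content C \<le> \<Lambda> (f - f * u)"
    by (rule content_le[OF fu']) (use assms u f in auto)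
  moreover have "\<Lambda> (f * u + (f - f * u)) = \<Lambda> (f * u) + \<Lambda> (f - f * u)" by (rule add[OF fu fu'])
  ultimately show "closed_content K + closed_content C \<le> \<Lambda> f" by simp
qed

text \<open>
  The tightness that makes the content extend to a measure: if \<open>f\<close> is almost optimal for \<open>C\<close>,
  then on \<open>D\<close> either \<open>f\<close> is almost 1, or we are in a closed set \<open>K\<close> that avoids \<open>C\<close>.
\<close>

lemma content_tight:
  assumes "closed C" "closed D" "C \<subseteq> D" "e > 0"
  obtains K where "closed K" "K \<subseteq> D - C" "closed_content D \<le> closed_content C + closed_content K + e"
proof -
  \<comment> \<open>chosen so that \<open>(1 + d) * (closed_content C + d) + d\<close> exceeds \<open>closed_content C\<close> by at most \<open>e\<close>\<close>
  define d where "d = min 1 (e / (closed_content C + 4))"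
  have c: "closed_content C \<ge> 0" by (rule content_nonneg)
  have d: "0 < d" "d \<le> 1" using assms(4) c by (auto simp: d_def intro!: divide_pos_pos)
  have "d \<le> e / (closed_content C + 4)" by (simp add: d_def)
  then have "d * (closed_content C + 4) \<le> e" using c by (simp add: pos_le_divide_eq)
  have de: "(1 + d) * (closed_content C + d) + d \<le> closed_content C + e"
  proof -
    have "d * d \<le> d * 1" using d by (intro mult_left_mono) auto
    moreover have "(1 + d) * (closed_content C + d) + d = closed_content C + d * (closed_content C + 4) + (d * d - d * 1) - d"
      by (simp add: algebra_simps)
    ultimately show ?thesis using \<open>d * (closed_content C + 4) \<le> e\<close> d(1) by linarith
  qed
  obtain f where f: "f \<in> BCpos" "\<And>x. x \<in> C \<Longrightarrow> 1 \<le> f x" "\<Lambda> f < closed_content C + d"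
    using content_approx[OF d(1)] by metis
  define K where "K = D \<inter> {x. (1 + d) * f x \<le> 1}"
  have cf: "continuous_on UNIV f" using f by (simp add: BCposD)
  have "closed {x. (1 + d) * f x \<le> 1}"
    by (intro closed_Collect_le continuous_on_mult continuous_on_const cf)
  then have K: "closed K" using assms unfolding K_def by auto
  have "K \<subseteq> D - C"
  proof -
    have "\<not> (1 + d) * f x \<le> 1" if "x \<in> C" for x
    proof -
      have "1 < (1 + d) * 1" using d by simp
      also have "\<dots> \<le> (1 + d) * f x" using f(2)[OF that] d by (intro mult_left_mono) auto
      finally show ?thesis by simp
    qed
    then show ?thesis unfolding K_def by blast
  qed
  moreover have "closed_content D \<le> closed_content C + closed_content K + e"
  proof -
    obtain g where g: "g \<in> BCpos" "\<And>x. x \<in> K \<Longrightarrow> 1 \<le> g x" "\<Lambda> g < closed_content K + d"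
      using content_approx[OF d(1)] by metis
    have df: "(1 + d) *\<^sub>R f \<in> BCpos" using f d by auto
    have "closed_content D \<le> \<Lambda> ((1 + d) *\<^sub>R f + g)"
    proof (rule content_le)
      show "(1 + d) *\<^sub>R f + g \<in> BCpos" using df g by auto
      fix x assume "x \<in> D"
      moreover have "0 \<le> f x" "0 \<le> g x" using f g by (auto simp: BCposD)
      ultimately show "1 \<le> ((1 + d) *\<^sub>R f + g) x"
        using g(2)[of x] d by (cases "x \<in> K") (auto simp: K_def scaleR_fun_def intro: add_increasing)
    qed
    also have "\<dots> = (1 + d) * \<Lambda> f + \<Lambda> g"
      using add[OF df g(1)] scaleR[OF f(1), of "1 + d"] d by simp
    also have "\<dots> \<le> (1 + d) * (closed_content C + d) + (closed_content K + d)"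
      using f(3) g(3) d by (intro add_mono mult_left_mono) auto
    also have "\<dots> \<le> closed_content C + closed_content K + e" using de by simp
    finally show ?thesis .
  qed
  ultimately show ?thesis using K that by blast
qed

definition inner_content :: "'a set \<Rightarrow> real" where
  "inner_content A = (SUP K\<in>{K. closed K \<and> K \<subseteq> A}. closed_content K)"

lemma inner_upper:
  assumes "closed K" "K \<subseteq> A"
  shows "closed_content K \<le> inner_content A"
  unfolding inner_content_def using assms
  by (intro cSUP_upper) (auto intro!: bdd_aboveI[of _ "closed_content UNIV"] content_mono)

lemma inner_least:
  assumes "\<And>K. closed K \<Longrightarrow> K \<subseteq> A \<Longrightarrow> closed_content K \<le> m"
  shows "inner_content A \<le> m"
proof -
  have "{} \<in> {K. closed K \<and> K \<subseteq> A}" by auto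
  then show ?thesis unfolding inner_content_def using assms by (intro cSUP_least) blast+
qed

lemma inner_approx:
  assumes "e > 0"
  obtains K where "closed K" "K \<subseteq> A" "inner_content A < closed_content K + e"
proof (rule ccontr)
  assume "\<not> thesis"
  then have "closed_content K \<le> inner_content A - e" if "closed K" "K \<subseteq> A" for K
    using that \<open>\<And>K. closed K \<Longrightarrow> K \<subseteq> A \<Longrightarrow> inner_content A < closed_content K + e \<Longrightarrow> thesis\<close>[of K] by force
  then have "inner_content A \<le> inner_content A - e" by (rule inner_least)
  then show False using assms by simp
qed

lemma inner_closed: "closed C \<Longrightarrow> inner_content C = closed_content C"
  by (intro antisym inner_least inner_upper content_mono) auto

lemma inner_nonneg: "0 \<le> inner_content A"
  using inner_upper[of "{}" A] content_empty by simp

text \<open>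
  Closed subsets of disjoint sets are disjoint, so superadditivity passes from the content to its
  inner measure.
\<close>

lemma inner_superadditive:
  assumes "A \<inter> B = {}" "A \<union> B \<subseteq> D"
  shows "inner_content A + inner_content B \<le> inner_content D"
proof -
  have "closed_content K + closed_content L \<le> inner_content D"
    if K: "closed K" "K \<subseteq> A" and L: "closed L" "L \<subseteq> B" for K L
  proof -
    have "K \<inter> L = {}" using assms K L by blast
    then have "closed_content K + closed_content L \<le> closed_content (K \<union> L)"
      using K L by (intro content_disjoint) auto
    also have "\<dots> \<le> inner_content D" using assms K L by (intro inner_upper) auto
    finally show ?thesis .
  qed
  then have "closed_content K \<le> inner_content D - closed_content L"
    if "closed K" "K \<subseteq> A" "closed L" "L \<subseteq> B" for K L
    using that by (simp add: le_diff_eq)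
  then have "inner_content A \<le> inner_content D - closed_content L" if "closed L" "L \<subseteq> B" for L
    by (rule inner_least) (use that in simp_all)
  then have "closed_content L \<le> inner_content D - inner_content A" if "closed L" "L \<subseteq> B" for L
    using that by (simp add: le_diff_eq add.commute)
  then have "inner_content B \<le> inner_content D - inner_content A" by (rule inner_least)
  then show ?thesis by simp
qed

text \<open>
  As in the theorem of Caratheodory, but for the inner measure, the sets that split every set
  form an algebra on which the inner measure is additive. Tightness says that closed sets split
  closed sets.
\<close>

definition splitting :: "'a set set" where
  "splitting = {A. \<forall>E. inner_content E \<le> inner_content (E \<inter> A) + inner_content (E - A)}"

lemma closed_splitting:
  assumes C: "closed C"
  shows "C \<in> splitting"
  unfolding splitting_def
proof (intro CollectI allI inner_least)
  fix E K :: "'a set" assume K: "closed K" "K \<subseteq> E"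
  show "closed_content K \<le> inner_content (E \<inter> C) + inner_content (E - C)"
  proof (rule field_le_epsilon)
    fix e :: real assume "e > 0"
    then obtain L where L: "closed L" "L \<subseteq> K - K \<inter> C" "closed_content K \<le> closed_content (K \<inter> C) + closed_content L + e"
      using content_tight[of "K \<inter> C" K e] K C by auto
    moreover have "closed_content (K \<inter> C) \<le> inner_content (E \<inter> C)"
      using K C by (intro inner_upper) auto
    moreover have "closed_content L \<le> inner_content (E - C)"
      using K L by (intro inner_upper) auto
    ultimately show "closed_content K \<le> inner_content (E \<inter> C) + inner_content (E - C) + e" by simp
  qed
qed

lemma algebra_splitting: "algebra UNIV splitting"
  unfolding algebra_iff_Un
proof (intro conjI ballI)
  show "{} \<in> splitting" by (rule closed_splitting) simp
  show "UNIV - A \<in> splitting" if "A \<in> splitting" for A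
  proof -
    have "E \<inter> (UNIV - A) = E - A" "E - (UNIV - A) = E \<inter> A" for E by auto
    then show ?thesis using that by (simp add: splitting_def add.commute)
  qed
  show "A \<union> B \<in> splitting" if AB: "A \<in> splitting" "B \<in> splitting" for A B
    unfolding splitting_def
  proof (intro CollectI allI)
    fix E
    have "inner_content E \<le> inner_content (E \<inter> A) + inner_content (E - A)" using AB by (simp add: splitting_def)
    moreover have "inner_content (E - A) \<le> inner_content ((E - A) \<inter> B) + inner_content (E - A - B)"
      using AB by (simp add: splitting_def)
    moreover have "inner_content (E \<inter> A) + inner_content ((E - A) \<inter> B) \<le> inner_content (E \<inter> (A \<union> B))"
      by (rule inner_superadditive) auto
    moreover have "E - A - B = E - (A \<union> B)" by auto
    ultimately show "inner_content E \<le> inner_content (E \<inter> (A \<union> B)) + inner_content (E - (A \<union> B))" by simp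
  qed
qed simp

lemma inner_Un:
  assumes "A \<in> borel_algebra" "A \<inter> B = {}"
  shows "inner_content (A \<union> B) = inner_content A + inner_content B"
proof (rule antisym)
  have "A \<in> splitting"
    using borel_algebra_subset[OF algebra_splitting closed_splitting] assms(1) by blast
  then have "inner_content (A \<union> B) \<le> inner_content ((A \<union> B) \<inter> A) + inner_content ((A \<union> B) - A)"
    unfolding splitting_def by blast
  moreover have "(A \<union> B) \<inter> A = A" "(A \<union> B) - A = B" using assms(2) by auto
  ultimately show "inner_content (A \<union> B) \<le> inner_content A + inner_content B" by simp
  show "inner_content A + inner_content B \<le> inner_content (A \<union> B)" by (rule inner_superadditive) (use assms in auto)
qed

text \<open>
  Measures are 0 outside the algebra by convention, so the inner content has to be cut off there.
\<close>

definition representing_measure :: "'a set \<Rightarrow> real" where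
  "representing_measure A = (if A \<in> borel_algebra then inner_content A else 0)"

lemma additive_representing_measure: "additive borel_algebra representing_measure"
  by (auto simp: additive_def representing_measure_def inner_Un)

lemma total_variation_representing_measure:
  "total_variation representing_measure A \<le> ennreal (representing_measure A)"
  by (rule total_variation_nonneg_measure[OF additive_representing_measure])
    (simp add: representing_measure_def inner_nonneg)

lemma finite_representing_measure: "finite_borel_measure representing_measure"
  unfolding finite_borel_measure_def
proof (intro conjI allI impI)
  show "total_variation representing_measure UNIV < \<infinity>"
    using total_variation_representing_measure by (rule le_less_trans) simp
qed (simp_all add: additive_representing_measure representing_measure_def)

lemma closed_regular_representing_measure: "closed_regular representing_measure"
  unfolding closed_regular_def
proof (intro ballI allI impI)
  fix A :: "'a set" and e :: real assume A: "A \<in> borel_algebra" and e: "e > 0"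
  have e2: "e/2 > 0" using e by simp
  obtain C where C: "closed C" "C \<subseteq> A" "inner_content A < closed_content C + e/2"
    by (rule inner_approx[OF e2])
  obtain K where K: "closed K" "K \<subseteq> - A" "inner_content (- A) < closed_content K + e/2"
    by (rule inner_approx[OF e2])
  have D: "A - C \<in> borel_algebra" "- A - K \<in> borel_algebra" "- K - C \<in> borel_algebra"
    using A C K by auto
  have diff: "inner_content (S - L) = inner_content S - closed_content L" if "closed L" "L \<subseteq> S" for S L
  proof -
    have "L \<union> (S - L) = S" using that(2) by blast
    moreover have "inner_content (L \<union> (S - L)) = inner_content L + inner_content (S - L)"
      by (rule inner_Un) (use that(1) in auto)
    ultimately show ?thesis using inner_closed[OF that(1)] by simp
  qed
  have "inner_content ((A - C) \<union> (- A - K)) = inner_content (A - C) + inner_content (- A - K)"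
    by (rule inner_Un[OF D(1)]) blast
  moreover have "(A - C) \<union> (- A - K) = - K - C" using C(2) K(2) by blast
  ultimately have small: "inner_content (- K - C) < e"
    using diff[OF C(1,2)] diff[OF K(1,2)] C(3) K(3) by simp
  have "total_variation representing_measure (- K - C) \<le> ennreal (representing_measure (- K - C))"
    by (rule total_variation_representing_measure)
  also have "representing_measure (- K - C) = inner_content (- K - C)"
    using D(3) by (simp add: representing_measure_def)
  also have "ennreal (inner_content (- K - C)) < ennreal e"
    by (rule ennreal_lessI[OF e small])
  finally have "total_variation representing_measure (- K - C) < ennreal e" .
  then show "\<exists>C U. closed C \<and> open U \<and> C \<subseteq> A \<and> A \<subseteq> U \<and> total_variation representing_measure (U - C) < ennreal e"
    using C K open_Compl[OF K(1)] by (intro exI[of _ C] exI[of _ "- K"]) blast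
qed

text \<open>A lower Darboux estimate, first for finitely many disjoint closed sets: the function is cut into pieces by Urysohn functions.\<close>

lemma sum_content_le:
  assumes "finite I" "\<And>i. i \<in> I \<Longrightarrow> closed (K i)" "\<And>i j. i \<in> I \<Longrightarrow> j \<in> I \<Longrightarrow> i \<noteq> j \<Longrightarrow> K i \<inter> K j = {}"
    and "f \<in> BCpos" "\<And>i. i \<in> I \<Longrightarrow> 0 \<le> a i" "\<And>i x. i \<in> I \<Longrightarrow> x \<in> K i \<Longrightarrow> a i \<le> f x"
  shows "(\<Sum>i\<in>I. a i * closed_content (K i)) \<le> \<Lambda> f"
  using assms
proof (induction I arbitrary: f rule: finite_induct)
  case empty
  then show ?case by (simp add: nonneg)
next
  case (insert i I)
  have "closed (\<Union>j\<in>I. K j)" using insert by (intro closed_UN) auto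
  moreover have "K i \<inter> (\<Union>j\<in>I. K j) = {}"
  proof -
    have "K i \<inter> K j = {}" if "j \<in> I" for j
      using insert.prems(2)[of i j] insert.hyps that by auto
    then show ?thesis by blast
  qed
  ultimately obtain u where u: "u \<in> BCpos" "\<And>x. u x \<le> 1" "\<And>x. x \<in> K i \<Longrightarrow> u x = 1"
      "\<And>x. x \<in> (\<Union>j\<in>I. K j) \<Longrightarrow> u x = 0"
    using urysohn_BCpos[of "K i" "\<Union>j\<in>I. K j"] insert.prems(1)[of i] by (metis insertI1)
  note f = \<open>f \<in> BCpos\<close>
  have fu: "f * u \<in> BCpos" using BCpos_mult_le_one[OF f u(1,2)] .
  have fu': "f - f * u \<in> BCpos"
    by (rule BCpos_diff[OF f fu]) (use u f in \<open>auto simp: BCposD mult_left_le\<close>)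
  have "(\<Sum>j\<in>I. a j * closed_content (K j)) \<le> \<Lambda> (f - f * u)"
  proof (rule insert.IH)
    show "a j \<le> (f - f * u) x" if "j \<in> I" "x \<in> K j" for j x
    proof -
      have "u x = 0" using u(4) that by blast
      then show ?thesis using insert.prems(5)[of j x] that by simp
    qed
    show "f - f * u \<in> BCpos" by (rule fu')
  qed (use insert.prems in auto)
  moreover have "a i * closed_content (K i) \<le> \<Lambda> (f * u)"
  proof (cases "a i = 0")
    case True
    then show ?thesis using nonneg[OF fu] by simp
  next
    case False
    then have a: "a i > 0" using insert.prems(4)[of i] by simp
    have "closed_content (K i) \<le> \<Lambda> ((1 / a i) *\<^sub>R (f * u))"
    proof (rule content_le)
      show "(1 / a i) *\<^sub>R (f * u) \<in> BCpos" using fu a by (intro BCpos_scaleR) auto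
      show "1 \<le> ((1 / a i) *\<^sub>R (f * u)) x" if "x \<in> K i" for x
        using u(3)[OF that] insert.prems(5)[of i x] that a by (simp add: scaleR_fun_def)
    qed
    also have "\<dots> = 1 / a i * \<Lambda> (f * u)" using a by (intro scaleR fu) auto
    finally show ?thesis using a by (simp add: field_simps)
  qed
  moreover have "\<Lambda> (f * u + (f - f * u)) = \<Lambda> (f * u) + \<Lambda> (f - f * u)" by (rule add[OF fu fu'])
  ultimately show ?case using insert.hyps by simp
qed

lemma lower_sum_le:
  assumes P: "borel_partition UNIV P" and f: "f \<in> BCpos"
    and a: "\<And>E. E \<in> P \<Longrightarrow> 0 \<le> a E" "\<And>E x. E \<in> P \<Longrightarrow> x \<in> E \<Longrightarrow> a E \<le> f x"
  shows "(\<Sum>E\<in>P. a E * inner_content E) \<le> \<Lambda> f"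
proof (rule field_le_epsilon)
  fix e :: real assume e: "e > 0"
  define d where "d = e / ((\<Sum>E\<in>P. a E) + 1)"
  have s: "(\<Sum>E\<in>P. a E) \<ge> 0" using a by (intro sum_nonneg)
  then have d: "d > 0" using e by (simp add: d_def)
  have "d * ((\<Sum>E\<in>P. a E) + 1) = e" using s by (simp add: d_def)
  then have de: "(\<Sum>E\<in>P. a E * d) \<le> e" using d by (simp add: algebra_simps sum_distrib_left)
  have "\<forall>E. \<exists>K. closed K \<and> K \<subseteq> E \<and> inner_content E < closed_content K + d"
    using inner_approx[OF d] by metis
  then obtain K where K: "\<And>E. closed (K E)" "\<And>E. K E \<subseteq> E" "\<And>E. inner_content E < closed_content (K E) + d"
    by metis
  \<comment> \<open>Blocks of a partition are not closed, but closed subsets exhaust them, and these are disjoint.\<close>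
  have "(\<Sum>E\<in>P. a E * inner_content E) \<le> (\<Sum>E\<in>P. a E * (closed_content (K E) + d))"
    using a K by (intro sum_mono mult_left_mono) (auto intro: less_imp_le)
  also have "\<dots> = (\<Sum>E\<in>P. a E * closed_content (K E)) + (\<Sum>E\<in>P. a E * d)"
    by (simp add: distrib_left sum.distrib)
  also have "(\<Sum>E\<in>P. a E * closed_content (K E)) \<le> \<Lambda> f"
  proof (rule sum_content_le)
    show "K E \<inter> K E' = {}" if "E \<in> P" "E' \<in> P" "E \<noteq> E'" for E E'
      using borel_partitionD(5)[OF P] K(2)[of E] K(2)[of E'] that unfolding disjoint_def by blast
    show "a E \<le> f x" if "E \<in> P" "x \<in> K E" for E x
      using a(2)[of E x] K(2)[of E] that by blast
  qed (use K a f borel_partitionD(1)[OF P] in auto)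
  finally show "(\<Sum>E\<in>P. a E * inner_content E) \<le> \<Lambda> f + e" using de by simp
qed

lemma has_measure_integral_representing_measure:
  assumes f: "f \<in> BCpos"
  shows "has_measure_integral representing_measure f (\<Lambda> f)"
  unfolding has_measure_integral_iff_tendsto tendsto_iff
proof (intro allI impI)
  fix e :: real assume e: "e > 0"
  let ?T = "\<Lambda> (\<lambda>_. 1)"
  have T: "?T \<ge> 0" by (rule nonneg) auto
  define d where "d = e / (?T + 1)"
  have d: "d > 0" using e T by (simp add: d_def)
  have "d * (?T + 1) = e" using T by (simp add: d_def)
  then have de: "d * ?T < e" using d by (simp add: algebra_simps)
  obtain c where c: "\<And>x. f x \<le> c" using BCposD(3)[OF f] by blast
  have fc: "continuous_on UNIV f" "\<And>x. \<bar>f x\<bar> \<le> c" using f c by (auto simp: BCposD)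
  have c0: "c \<ge> 0" using c[of undefined] BCposD(2)[OF f, of undefined] by linarith
  obtain P where P: "borel_partition UNIV P" "\<forall>E\<in>P. \<forall>x\<in>E. \<forall>y\<in>E. \<bar>f x - f y\<bar> \<le> d"
    using borel_partition_small_oscillation[OF fc d] by (elim exE conjE)
  show "eventually (\<lambda>x. dist (riemann_sum representing_measure f x) (\<Lambda> f) < e) riemann_filter"
  proof (rule eventually_refines[OF P(1)])
    fix Q and t :: "'a set \<Rightarrow> 'a"
    assume Q: "borel_partition UNIV Q" "refines UNIV Q P" and t: "\<And>E. E \<in> Q \<Longrightarrow> t E \<in> E"
    have osc: "\<bar>f x - f (t E)\<bar> \<le> d" if "E \<in> Q" "x \<in> E" for E x
    proof -
      obtain W where "W \<in> P" "E \<subseteq> W" using Q(2) \<open>E \<in> Q\<close> unfolding refines_def by meson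
      then show ?thesis using P(2) t[OF that(1)] that(2) by (meson subsetD)
    qed
    define R where "R = (\<Sum>E\<in>Q. f (t E) * inner_content E)"
    have rs: "riemann_sum representing_measure f (Q, t) = R"
      unfolding riemann_sum_def R_def split_conv
      using borel_partitionD(2)[OF Q(1)] by (intro sum.cong) (auto simp: representing_measure_def)
    have tot: "(\<Sum>E\<in>Q. inner_content E) = ?T"
    proof -
      have "representing_measure UNIV = (\<Sum>E\<in>Q. representing_measure E)"
        by (rule additive_borel_partition[OF additive_representing_measure Q(1)])
      also have "\<dots> = (\<Sum>E\<in>Q. inner_content E)"
        using borel_partitionD(2)[OF Q(1)] by (intro sum.cong) (auto simp: representing_measure_def)
      finally show ?thesis
        by (simp add: representing_measure_def inner_closed content_UNIV)
    qed
    \<comment> \<open>Lower sums are bounded by \<open>\<Lambda> f\<close>; applied to \<open>c - f\<close>, this bounds upper sums as well.\<close>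
    have "R - d * ?T = (\<Sum>E\<in>Q. (f (t E) - d) * inner_content E)"
      unfolding tot[symmetric] R_def by (simp add: left_diff_distrib sum_subtractf sum_distrib_left)
    also have "\<dots> \<le> (\<Sum>E\<in>Q. max 0 (f (t E) - d) * inner_content E)"
      by (intro sum_mono mult_right_mono inner_nonneg) auto
    also have "\<dots> \<le> \<Lambda> f"
    proof (rule lower_sum_le[OF Q(1) f])
      show "max 0 (f (t E) - d) \<le> f x" if "E \<in> Q" "x \<in> E" for E x
        using osc[OF that] BCposD(2)[OF f, of x] by auto
    qed auto
    finally have lower: "R - d * ?T \<le> \<Lambda> f" .
    have cf: "(\<lambda>_. c) - f \<in> BCpos" by (rule BCpos_diff) (use c0 c f in auto)
    have "\<Lambda> (f + ((\<lambda>_. c) - f)) = \<Lambda> f + \<Lambda> ((\<lambda>_. c) - f)" by (rule add[OF f cf])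
    then have split: "c * ?T = \<Lambda> f + \<Lambda> ((\<lambda>_. c) - f)" using const[OF c0] by simp
    have "c * ?T - R - d * ?T = (\<Sum>E\<in>Q. (c - f (t E) - d) * inner_content E)"
      unfolding tot[symmetric] R_def by (simp add: left_diff_distrib sum_subtractf sum_distrib_left)
    also have "\<dots> \<le> (\<Sum>E\<in>Q. max 0 (c - f (t E) - d) * inner_content E)"
      by (intro sum_mono mult_right_mono inner_nonneg) auto
    also have "\<dots> \<le> \<Lambda> ((\<lambda>_. c) - f)"
    proof (rule lower_sum_le[OF Q(1) cf])
      show "max 0 (c - f (t E) - d) \<le> ((\<lambda>_. c) - f) x" if "E \<in> Q" "x \<in> E" for E x
        using osc[OF that] c[of x] by auto
    qed auto
    finally have "\<Lambda> f \<le> R + d * ?T" using split by simp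
    then have "\<bar>R - \<Lambda> f\<bar> \<le> d * ?T" using lower by simp
    then show "dist (riemann_sum representing_measure f (Q, t)) (\<Lambda> f) < e"
      unfolding rs dist_real_def using de by simp
  qed
qed

text \<open>
  A functional that vanishes on functions vanishing on \<open>B\<close> has its measure carried by \<open>B\<close>: every closed
  set off \<open>B\<close> admits a Urysohn function that the functional annihilates.
\<close>

lemma representing_measure_null:
  assumes B: "closed B" and null: "\<And>f. f \<in> BCpos \<Longrightarrow> (\<And>x. x \<in> B \<Longrightarrow> f x = 0) \<Longrightarrow> \<Lambda> f = 0"
  shows "total_variation representing_measure (- B) = 0"
proof -
  have "inner_content (- B) \<le> 0"
  proof (rule inner_least)
    fix K assume K: "closed K" "K \<subseteq> - B"
    then have "K \<inter> B = {}" by blast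
    then obtain u where u: "u \<in> BCpos" "\<And>x. x \<in> K \<Longrightarrow> u x = 1" "\<And>x. x \<in> B \<Longrightarrow> u x = 0"
      using urysohn_BCpos[OF K(1) B] by metis
    then show "closed_content K \<le> 0" using content_le[of u K] null[of u] by simp
  qed
  then show ?thesis
    using total_variation_representing_measure[of "- B"]
    by (simp add: representing_measure_def ennreal_neg split: if_splits)
qed

end

section \<open>Functionals that are bounded by a supremum over a closed set\<close>

lemma CX_add [intro]: "f \<in> CX \<Longrightarrow> g \<in> CX \<Longrightarrow> f + g \<in> CX"
  unfolding CX_def plus_fun_def by (auto intro: continuous_on_add)

lemma CX_scaleR [intro]: "f \<in> CX \<Longrightarrow> c *\<^sub>R f \<in> CX"
  unfolding CX_def scaleR_fun_def by (auto intro: continuous_on_mult_left)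

lemma CX_zero [intro]: "0 \<in> CX"
  unfolding CX_def zero_fun_def by auto

lemma subspace_CX: "subspace CX"
  by (auto intro!: subspaceI)

lemma CX_diff [intro]: "f \<in> CX \<Longrightarrow> g \<in> CX \<Longrightarrow> f - g \<in> CX"
  by (rule subspace_diff[OF subspace_CX])

lemma BCpos_subset_CX: "BCpos \<subseteq> CX"
  by (auto simp: BCpos_def CX_def)

text \<open>
  A function that is bounded only on \<open>B\<close> is replaced by a bounded one that agrees with it on \<open>B\<close>.
\<close>

lemma truncation:
  fixes f :: "'a::topological_space \<Rightarrow> real"
  assumes "f \<in> CX" "0 \<le> c"
  shows "\<exists>g\<in>CX. (\<forall>x. \<bar>g x\<bar> \<le> c) \<and> (\<forall>x. \<bar>f x\<bar> \<le> c \<longrightarrow> g x = f x)"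
proof (rule bexI[of _ "\<lambda>x. max (- c) (min c (f x))"])
  show "(\<lambda>x. max (- c) (min c (f x))) \<in> CX"
    using assms unfolding CX_def by (auto intro!: continuous_on_max continuous_on_min continuous_on_const)
qed (use assms in auto)

text \<open>
  This is what continuity for the topology of a bornology amounts to, for a single closed member \<open>B\<close>
  of it. The bound is stated with real constants \<open>c\<close>, so that it is void for functions of infinite \<open>rho B\<close>.
\<close>

locale set_bounded_functional =
  fixes F :: "('a::metric_space \<Rightarrow> real) \<Rightarrow> real" and B :: "'a set" and k :: real
  assumes add: "f \<in> CX \<Longrightarrow> g \<in> CX \<Longrightarrow> F (f + g) = F f + F g"
    and scaleR: "f \<in> CX \<Longrightarrow> F (c *\<^sub>R f) = c * F f"
    and closed: "closed B"
    and bound: "f \<in> CX \<Longrightarrow> 0 \<le> c \<Longrightarrow> (\<And>x. x \<in> B \<Longrightarrow> \<bar>f x\<bar> \<le> c) \<Longrightarrow> \<bar>F f\<bar> \<le> k * c"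
begin

lemma zero: "F 0 = 0"
  using scaleR[OF CX_zero, of 0] by simp

lemma vanishes: "f \<in> CX \<Longrightarrow> (\<And>x. x \<in> B \<Longrightarrow> f x = 0) \<Longrightarrow> F f = 0"
  using bound[of f 0] by simp

lemma diff:
  assumes "f \<in> CX" "g \<in> CX"
  shows "F (f - g) = F f - F g"
proof -
  have "F ((f - g) + g) = F (f - g) + F g" by (rule add) (use assms in auto)
  then show ?thesis by simp
qed

text \<open>The positive part of \<open>F\<close> in the order dual, on the positive cone.\<close>

definition pos :: "('a \<Rightarrow> real) \<Rightarrow> real" where
  "pos f = (SUP g\<in>{g\<in>BCpos. \<forall>x. g x \<le> f x}. F g)"

lemma pos_upper:
  assumes "f \<in> BCpos" "g \<in> BCpos" "\<And>x. g x \<le> f x"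
  shows "F g \<le> pos f"
proof -
  obtain c where c: "\<forall>x. f x \<le> c" using BCposD(3)[OF assms(1)] ..
  have "F h \<le> k * max 0 c" if "h \<in> BCpos" "\<forall>x. h x \<le> f x" for h
  proof -
    have "\<bar>h x\<bar> \<le> max 0 c" for x
      using BCposD(2)[OF that(1), of x] order_trans[OF that(2)[rule_format] c[rule_format], of x] by simp
    moreover have "h \<in> CX" using that(1) BCpos_subset_CX by blast
    ultimately have "\<bar>F h\<bar> \<le> k * max 0 c" by (intro bound) auto
    then show ?thesis by simp
  qed
  then have "bdd_above (F ` {g\<in>BCpos. \<forall>x. g x \<le> f x})"
    by (intro bdd_aboveI[of _ "k * max 0 c"]) blast
  then show ?thesis
    unfolding pos_def by (rule cSUP_upper[rotated]) (use assms in simp)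
qed

lemma zero_BCpos: "0 \<in> BCpos"
  unfolding zero_fun_def by (rule BCpos_const) simp

lemma pos_least:
  assumes "f \<in> BCpos" "\<And>g. g \<in> BCpos \<Longrightarrow> (\<And>x. g x \<le> f x) \<Longrightarrow> F g \<le> m"
  shows "pos f \<le> m"
  unfolding pos_def
proof (rule cSUP_least)
  have "0 \<in> {g\<in>BCpos. \<forall>x. g x \<le> f x}" using BCposD(2)[OF assms(1)] zero_BCpos by simp
  then show "{g\<in>BCpos. \<forall>x. g x \<le> f x} \<noteq> {}" by blast
qed (use assms(2) in simp)

lemma pos_scaleR_le:
  assumes "f \<in> BCpos" "0 < c"
  shows "pos (c *\<^sub>R f) \<le> c * pos f"
proof (rule pos_least)
  show "c *\<^sub>R f \<in> BCpos" using assms by (intro BCpos_scaleR) auto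
  fix g assume g: "g \<in> BCpos" "\<And>x. g x \<le> (c *\<^sub>R f) x"
  have "F ((1/c) *\<^sub>R g) \<le> pos f"
  proof (rule pos_upper[OF assms(1)])
    show "(1/c) *\<^sub>R g \<in> BCpos" using assms g by (intro BCpos_scaleR) auto
    show "((1/c) *\<^sub>R g) x \<le> f x" for x
      using g(2)[of x] assms by (simp add: scaleR_fun_def field_simps)
  qed
  moreover have "F ((1/c) *\<^sub>R g) = 1/c * F g"
    using g BCpos_subset_CX by (intro scaleR) blast
  ultimately show "F g \<le> c * pos f" using assms by (simp add: field_simps)
qed

text \<open>
  Additivity on the cone rests on the Riesz decomposition property: what lies below \<open>f + g\<close> is a
  sum of something below \<open>f\<close> and something below \<open>g\<close>.
\<close>

lemma pos_add:
  assumes f: "f \<in> BCpos" and g: "g \<in> BCpos"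
  shows "pos (f + g) = pos f + pos g"
proof (rule antisym)
  have fg: "f + g \<in> BCpos" using f g by auto
  have CX: "h \<in> CX" if "h \<in> BCpos" for h :: "'a \<Rightarrow> real" using that BCpos_subset_CX by blast
  show "pos (f + g) \<le> pos f + pos g"
  proof (rule pos_least[OF fg])
    fix h assume h: "h \<in> BCpos" "\<And>x. h x \<le> (f + g) x"
    define h1 where "h1 = (\<lambda>x. min (h x) (f x))"
    have h1: "h1 \<in> BCpos"
    proof (rule BCpos_le[OF f])
      show "continuous_on UNIV h1"
        unfolding h1_def using BCposD(1)[OF h(1)] BCposD(1)[OF f] by (rule continuous_on_min)
    qed (use BCposD(2)[OF h(1)] BCposD(2)[OF f] in \<open>auto simp: h1_def\<close>)
    have h2: "h - h1 \<in> BCpos" by (rule BCpos_diff[OF h(1) h1]) (simp add: h1_def)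
    have "F h1 \<le> pos f" by (rule pos_upper[OF f h1]) (simp add: h1_def)
    moreover have "F (h - h1) \<le> pos g"
    proof (rule pos_upper[OF g h2])
      show "(h - h1) x \<le> g x" for x
        using h(2)[of x] BCposD(2)[OF g, of x] by (auto simp: h1_def)
    qed
    moreover have "F (h1 + (h - h1)) = F h1 + F (h - h1)" by (rule add[OF CX[OF h1] CX[OF h2]])
    ultimately show "F h \<le> pos f + pos g" by simp
  qed
  have "F h1 + F h2 \<le> pos (f + g)"
    if h1: "h1 \<in> BCpos" "\<And>x. h1 x \<le> f x" and h2: "h2 \<in> BCpos" "\<And>x. h2 x \<le> g x" for h1 h2
  proof -
    have "F (h1 + h2) \<le> pos (f + g)"
      by (rule pos_upper[OF fg BCpos_add[OF h1(1) h2(1)]]) (simp add: add_mono h1(2) h2(2))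
    then show ?thesis using add[OF CX[OF h1(1)] CX[OF h2(1)]] by simp
  qed
  then have "F h1 \<le> pos (f + g) - F h2"
    if "h1 \<in> BCpos" "\<And>x. h1 x \<le> f x" "h2 \<in> BCpos" "\<And>x. h2 x \<le> g x" for h1 h2
    using that by (simp add: le_diff_eq)
  then have "pos f \<le> pos (f + g) - F h2" if "h2 \<in> BCpos" "\<And>x. h2 x \<le> g x" for h2
    by (rule pos_least[OF f]) (use that in simp_all)
  then have "F h2 \<le> pos (f + g) - pos f" if "h2 \<in> BCpos" "\<And>x. h2 x \<le> g x" for h2
    using that by (simp add: le_diff_eq add.commute)
  then have "pos g \<le> pos (f + g) - pos f" by (rule pos_least[OF g])
  then show "pos f + pos g \<le> pos (f + g)" by simp
qed

text \<open>
  The positive part inherits from \<open>F\<close> that it does not see the complement of \<open>B\<close>.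
\<close>

lemma pos_vanishes:
  assumes f: "f \<in> BCpos" "\<And>x. x \<in> B \<Longrightarrow> f x = 0"
  shows "pos f = 0"
proof (rule antisym)
  show "pos f \<le> 0"
  proof (rule pos_least[OF f(1)])
    fix g assume g: "g \<in> BCpos" "\<And>x. g x \<le> f x"
    have "g x = 0" if "x \<in> B" for x
      using BCposD(2)[OF g(1), of x] g(2)[of x] f(2)[OF that] by simp
    then have "F g = 0" using g(1) BCpos_subset_CX by (intro vanishes) auto
    then show "F g \<le> 0" by simp
  qed
  show "0 \<le> pos f" using pos_upper[OF f(1) zero_BCpos] BCposD(2)[OF f(1)] zero by simp
qed

lemma pos_scaleR:
  assumes f: "f \<in> BCpos" and c: "0 \<le> c"
  shows "pos (c *\<^sub>R f) = c * pos f"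
proof (cases "c = 0")
  case True
  then show ?thesis using pos_vanishes[OF zero_BCpos] by simp
next
  case False
  then have c: "c > 0" using c by simp
  have cf: "c *\<^sub>R f \<in> BCpos" using f c by (intro BCpos_scaleR) auto
  have "pos ((1/c) *\<^sub>R (c *\<^sub>R f)) \<le> 1/c * pos (c *\<^sub>R f)"
    by (rule pos_scaleR_le[OF cf]) (use c in simp)
  then have "c * pos f \<le> pos (c *\<^sub>R f)" using c by (simp add: field_simps)
  then show ?thesis using pos_scaleR_le[OF f c] by simp
qed

lemma positive_functional_pos: "positive_functional pos"
proof
  show "0 \<le> pos f" if "f \<in> BCpos" for f
    using pos_upper[OF that zero_BCpos] BCposD(2)[OF that] zero by simp
qed (auto intro: pos_add pos_scaleR)

lemma positive_functional_neg: "positive_functional (\<lambda>f. pos f - F f)"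
proof
  show "0 \<le> pos f - F f" if "f \<in> BCpos" for f
    using pos_upper[OF that that] by simp
  show "pos (f + g) - F (f + g) = (pos f - F f) + (pos g - F g)" if "f \<in> BCpos" "g \<in> BCpos" for f g
    using pos_add[OF that] add[OF subsetD[OF BCpos_subset_CX that(1)] subsetD[OF BCpos_subset_CX that(2)]]
    by simp
  show "pos (c *\<^sub>R f) - F (c *\<^sub>R f) = c * (pos f - F f)" if "f \<in> BCpos" "0 \<le> c" for f c
    using pos_scaleR[OF that] scaleR[OF subsetD[OF BCpos_subset_CX that(1)], of c]
    by (simp add: right_diff_distrib)
qed

text \<open>
  A functional on all continuous functions is determined by the bounded ones, because it does not
  see what happens outside \<open>B\<close>; so the difference of the measures of the two positive functionals
  represents \<open>F\<close> wherever the integral makes sense.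
\<close>

lemma representation:
  "\<exists>\<mu>. finite_borel_measure \<mu> \<and> closed_regular \<mu> \<and> total_variation \<mu> (- B) = 0 \<and>
     (\<forall>f\<in>CX. (\<exists>c\<ge>0. \<forall>x\<in>B. \<bar>f x\<bar> \<le> c) \<longrightarrow> has_measure_integral \<mu> f (F f))"
proof -
  interpret P: positive_functional pos by (rule positive_functional_pos)
  interpret N: positive_functional "\<lambda>f. pos f - F f" by (rule positive_functional_neg)
  define \<mu> where "\<mu> = P.representing_measure + (-1) *\<^sub>R N.representing_measure"
  have fin: "finite_borel_measure \<mu>"
    unfolding \<mu>_def by (intro finite_borel_measure_add finite_borel_measure_scaleR
      P.finite_representing_measure N.finite_representing_measure)
  have reg: "closed_regular \<mu>"
    unfolding \<mu>_def by (intro closed_regular_add closed_regular_scaleR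
      P.closed_regular_representing_measure N.closed_regular_representing_measure)
  have null: "total_variation \<mu> (- B) = 0"
  proof -
    have "total_variation P.representing_measure (- B) = 0"
      by (rule P.representing_measure_null[OF closed pos_vanishes])
    moreover have "total_variation N.representing_measure (- B) = 0"
    proof (rule N.representing_measure_null[OF closed])
      show "pos f - F f = 0" if "f \<in> BCpos" "\<And>x. x \<in> B \<Longrightarrow> f x = 0" for f
        using pos_vanishes[OF that] vanishes[of f] that BCpos_subset_CX by auto
    qed
    ultimately show ?thesis
      using total_variation_add[of P.representing_measure "(-1) *\<^sub>R N.representing_measure" "- B"]
        total_variation_scaleR[of "-1" N.representing_measure "- B"]
      by (simp add: \<mu>_def)
  qed
  have cone: "has_measure_integral \<mu> f (F f)" if "f \<in> BCpos" for f
    using has_measure_integral_add_measure[OF P.has_measure_integral_representing_measure[OF that]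
        has_measure_integral_scaleR_measure[OF N.has_measure_integral_representing_measure[OF that], of "-1"]]
    by (simp add: \<mu>_def)
  have "has_measure_integral \<mu> f (F f)"
    if f: "f \<in> CX" and c: "c \<ge> 0" "\<forall>x\<in>B. \<bar>f x\<bar> \<le> c" for f c
  proof -
    obtain g where g: "g \<in> CX" "\<And>x. \<bar>g x\<bar> \<le> c" "\<And>x. \<bar>f x\<bar> \<le> c \<Longrightarrow> g x = f x"
      using truncation[OF f c(1)] by blast
    have const: "(\<lambda>_. c) \<in> BCpos" by (rule BCpos_const[OF c(1)])
    then have constX: "(\<lambda>_. c) \<in> CX" using BCpos_subset_CX by blast
    have "g + (\<lambda>_. c) \<in> BCpos"
    proof (rule BCposI)
      show "continuous_on UNIV (g + (\<lambda>_. c))" using CX_add[OF g(1) constX] by (simp add: CX_def)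
      show "0 \<le> (g + (\<lambda>_. c)) x" "(g + (\<lambda>_. c)) x \<le> 2 * c" for x
        using g(2)[of x] by (auto simp: abs_le_iff)
    qed
    then have "has_measure_integral \<mu> ((g + (\<lambda>_. c)) + (-1) *\<^sub>R (\<lambda>_. c)) (F (g + (\<lambda>_. c)) + (-1) * F (\<lambda>_. c))"
      by (intro has_measure_integral_add_fun has_measure_integral_scaleR_fun cone const)
    then have "has_measure_integral \<mu> g (F g)"
      using add[OF g(1) constX] by simp
    then have "has_measure_integral \<mu> f (F g)"
      by (rule has_measure_integral_cong_null[OF fin closed null, rotated]) (use g(3) c(2) in auto)
    moreover have "F (f - g) = 0"
      by (rule vanishes) (use f g c(2) in auto)
    ultimately show ?thesis using diff[OF f g(1)] by simp
  qed
  then show ?thesis using fin reg null by blast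
qed

end

section \<open>The measures carried by a bornology\<close>

lemma rho_le_iff: "0 \<le> c \<Longrightarrow> rho B f \<le> ennreal c \<longleftrightarrow> (\<forall>x\<in>B. \<bar>f x\<bar> \<le> c)"
  unfolding rho_def by (simp add: SUP_le_iff)

lemma CX_fin_iff: "f \<in> CX_fin B \<longleftrightarrow> f \<in> CX \<and> (\<exists>c\<ge>0. \<forall>x\<in>B. \<bar>f x\<bar> \<le> c)"
proof -
  have "rho B f < \<infinity> \<longleftrightarrow> (\<exists>c\<ge>0. rho B f \<le> ennreal c)"
  proof
    assume "rho B f < \<infinity>"
    then show "\<exists>c\<ge>0. rho B f \<le> ennreal c" by (cases "rho B f") auto
  next
    assume "\<exists>c\<ge>0. rho B f \<le> ennreal c"
    then show "rho B f < \<infinity>" using le_less_trans[OF _ ennreal_less_top] by auto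
  qed
  then show ?thesis unfolding CX_fin_def using rho_le_iff[of _ B f] by auto
qed

lemma subspace_CX_fin: "subspace (CX_fin B)"
proof (rule subspaceI)
  show "0 \<in> CX_fin B" by (auto simp: CX_fin_iff intro: exI[of _ 0])
  show "f + g \<in> CX_fin B" if fg: "f \<in> CX_fin B" "g \<in> CX_fin B" for f g
  proof -
    obtain a b where "a \<ge> 0" "b \<ge> 0" "\<forall>x\<in>B. \<bar>f x\<bar> \<le> a" "\<forall>x\<in>B. \<bar>g x\<bar> \<le> b"
      using fg unfolding CX_fin_iff by blast
    then have "\<forall>x\<in>B. \<bar>(f + g) x\<bar> \<le> a + b" "a + b \<ge> 0"
      by (auto intro: abs_triangle_ineq[THEN order_trans] add_mono)
    then show ?thesis using fg unfolding CX_fin_iff by blast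
  qed
  show "c *\<^sub>R f \<in> CX_fin B" if f: "f \<in> CX_fin B" for c f
  proof -
    obtain a where "a \<ge> 0" "\<forall>x\<in>B. \<bar>f x\<bar> \<le> a" using f unfolding CX_fin_iff by blast
    then have "\<forall>x\<in>B. \<bar>(c *\<^sub>R f) x\<bar> \<le> \<bar>c\<bar> * a" "\<bar>c\<bar> * a \<ge> 0"
      by (auto simp: scaleR_fun_def abs_mult intro: mult_left_mono)
    then show ?thesis using f unfolding CX_fin_iff by blast
  qed
qed

lemma measures_onD:
  assumes "\<mu> \<in> measures_on \<B>"
  shows "finite_borel_measure \<mu>" "closed_regular \<mu>"
    "\<exists>B\<in>\<B>. closed B \<and> total_variation \<mu> (- B) = 0"
  using assms by (auto simp: measures_on_def Compl_eq_Diff_UNIV)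

lemma measures_onI:
  assumes "finite_borel_measure \<mu>" "closed_regular \<mu>" "B \<in> \<B>" "closed B" "total_variation \<mu> (- B) = 0"
  shows "\<mu> \<in> measures_on \<B>"
  using assms by (auto simp: measures_on_def Compl_eq_Diff_UNIV)

lemma bornology_Un: "bornology \<B> \<Longrightarrow> A \<in> \<B> \<Longrightarrow> B \<in> \<B> \<Longrightarrow> A \<union> B \<in> \<B>"
  unfolding bornology_def by meson

lemma measures_on_add:
  assumes "bornology \<B>" "\<mu> \<in> measures_on \<B>" "\<nu> \<in> measures_on \<B>"
  shows "\<mu> + \<nu> \<in> measures_on \<B>"
proof -
  obtain B where B: "B \<in> \<B>" "closed B" "total_variation \<mu> (- B) = 0"
    using measures_onD(3)[OF assms(2)] by (elim bexE conjE)
  obtain C where C: "C \<in> \<B>" "closed C" "total_variation \<nu> (- C) = 0"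
    using measures_onD(3)[OF assms(3)] by (elim bexE conjE)
  have "- (B \<union> C) \<in> borel_algebra" "- B \<in> borel_algebra" "- C \<in> borel_algebra"
    using B(2) C(2) by (simp_all only: Compl_in_borel_algebra closed_in_borel_algebra closed_Un)
  then have "total_variation \<mu> (- (B \<union> C)) \<le> total_variation \<mu> (- B)"
    "total_variation \<nu> (- (B \<union> C)) \<le> total_variation \<nu> (- C)"
    by (auto intro!: total_variation_mono)
  then have "total_variation \<mu> (- (B \<union> C)) = 0" "total_variation \<nu> (- (B \<union> C)) = 0"
    unfolding B(3) C(3) by simp_all
  then have "total_variation (\<mu> + \<nu>) (- (B \<union> C)) = 0"
    using total_variation_add[of \<mu> \<nu> "- (B \<union> C)"] by simp
  moreover have "closed (B \<union> C)" by (rule closed_Un[OF B(2) C(2)])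
  moreover have "B \<union> C \<in> \<B>" using bornology_Un[OF assms(1)] B C by blast
  ultimately show ?thesis
    by (intro measures_onI finite_borel_measure_add closed_regular_add
        measures_onD(1,2)[OF assms(2)] measures_onD(1,2)[OF assms(3)])
qed

lemma measures_on_scaleR:
  assumes "\<mu> \<in> measures_on \<B>"
  shows "c *\<^sub>R \<mu> \<in> measures_on \<B>"
proof -
  obtain B where B: "B \<in> \<B>" "closed B" "total_variation \<mu> (- B) = 0"
    using measures_onD(3)[OF assms] by (elim bexE conjE)
  then have "total_variation (c *\<^sub>R \<mu>) (- B) = 0"
    using total_variation_scaleR[of c \<mu> "- B"] by simp
  then show ?thesis
    by (intro measures_onI[OF _ _ B(1,2)] finite_borel_measure_scaleR closed_regular_scaleR
        measures_onD(1,2)[OF assms])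
qed

lemma measures_on_diff:
  assumes "bornology \<B>" "\<mu> \<in> measures_on \<B>" "\<nu> \<in> measures_on \<B>"
  shows "\<mu> - \<nu> \<in> measures_on \<B>"
  using measures_on_add[OF assms(1,2) measures_on_scaleR[OF assms(3), of "-1"]] by simp

text \<open>
  Truncation at its bound on the set that carries the measure turns an unbounded integrand into a
  bounded one and leaves the integral unchanged.
\<close>

lemma measures_on_has_integral:
  assumes \<mu>: "\<mu> \<in> measures_on \<B>" and f: "\<And>B. B \<in> \<B> \<Longrightarrow> f \<in> CX_fin B"
  shows "has_measure_integral \<mu> f (measure_integral \<mu> f)"
proof -
  obtain B where B: "B \<in> \<B>" "closed B" "total_variation \<mu> (- B) = 0"
    using measures_onD(3)[OF \<mu>] by (elim bexE conjE)
  obtain c where fX: "f \<in> CX" and c: "c \<ge> 0" "\<forall>x\<in>B. \<bar>f x\<bar> \<le> c"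
    using f[OF B(1)] unfolding CX_fin_iff by (elim exE conjE)
  obtain g where g: "g \<in> CX" "\<And>x. \<bar>g x\<bar> \<le> c" "\<And>x. \<bar>f x\<bar> \<le> c \<Longrightarrow> g x = f x"
    using truncation[OF fX c(1)] by blast
  have "continuous_on UNIV g" using g(1) by (simp add: CX_def)
  from bounded_continuous_has_measure_integral[OF measures_onD(1)[OF \<mu>] this g(2)]
  obtain I where "has_measure_integral \<mu> g I" ..
  then have "has_measure_integral \<mu> f I"
    by (rule has_measure_integral_cong_null[OF measures_onD(1)[OF \<mu>] B(2,3), rotated])
      (use g(3) c(2) in auto)
  then show ?thesis using measure_integral_eqI by metis
qed

lemma measures_on_eqI:
  fixes \<mu> \<nu> :: "'a::metric_space set \<Rightarrow> real"
  assumes "bornology \<B>" "\<mu> \<in> measures_on \<B>" "\<nu> \<in> measures_on \<B>"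
    and eq: "\<And>f. f \<in> BCpos \<Longrightarrow> measure_integral \<mu> f = measure_integral \<nu> f"
  shows "\<mu> = \<nu>"
proof -
  have "\<mu> - \<nu> = 0"
  proof (rule closed_regular_eq_0)
    have d: "\<mu> - \<nu> \<in> measures_on \<B>" by (rule measures_on_diff[OF assms(1-3)])
    show "finite_borel_measure (\<mu> - \<nu>)" "closed_regular (\<mu> - \<nu>)"
      using measures_onD(1,2)[OF d] .
    fix f :: "'a \<Rightarrow> real" assume f: "f \<in> BCpos"
    have "f \<in> CX_fin B" for B
    proof -
      obtain c where c: "\<forall>x. f x \<le> c" using BCposD(3)[OF f] ..
      have "\<bar>f x\<bar> \<le> max 0 c" for x using c[rule_format, of x] BCposD(2)[OF f, of x] by simp
      then show ?thesis
        using f BCpos_subset_CX unfolding CX_fin_iff by (intro conjI exI[of _ "max 0 c"]) auto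
    qed
    then have "has_measure_integral (\<mu> + (-1) *\<^sub>R \<nu>) f (measure_integral \<mu> f + (-1) * measure_integral \<nu> f)"
      by (intro has_measure_integral_add_measure has_measure_integral_scaleR_measure
          measures_on_has_integral[OF assms(2)] measures_on_has_integral[OF assms(3)])
    then show "has_measure_integral (\<mu> - \<nu>) f 0" using eq[OF f] by simp
  qed
  then show ?thesis by simp
qed

section \<open>Topologies induced by seminorms\<close>

text \<open>
  All seminorms of the theorem have this form, with \<open>ev\<close> the evaluation of a function at a point, of a
  functional at a function, or of a measure at an integrand.
\<close>

lemma extended_seminorm_SUP:
  assumes "\<And>x F G. x \<in> A \<Longrightarrow> F \<in> S \<Longrightarrow> G \<in> S \<Longrightarrow> ev (F + G) x = ev F x + ev G x"
    and "\<And>x F c. x \<in> A \<Longrightarrow> F \<in> S \<Longrightarrow> ev (c *\<^sub>R F) x = c * ev F x"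
  shows "extended_seminorm S (\<lambda>F. SUP x\<in>A. ennreal \<bar>ev F x\<bar>)"
  unfolding extended_seminorm_def
proof (intro conjI allI ballI)
  fix c F assume F: "F \<in> S"
  have "(SUP x\<in>A. ennreal \<bar>ev (c *\<^sub>R F) x\<bar>) = (SUP x\<in>A. ennreal \<bar>c\<bar> * ennreal \<bar>ev F x\<bar>)"
    using assms(2)[OF _ F] by (intro SUP_cong refl) (simp add: abs_mult ennreal_mult)
  then show "(SUP x\<in>A. ennreal \<bar>ev (c *\<^sub>R F) x\<bar>) = ennreal \<bar>c\<bar> * (SUP x\<in>A. ennreal \<bar>ev F x\<bar>)"
    by (simp add: SUP_mult_left_ennreal)
next
  fix F G assume FG: "F \<in> S" "G \<in> S"
  show "(SUP x\<in>A. ennreal \<bar>ev (F + G) x\<bar>) \<le> (SUP x\<in>A. ennreal \<bar>ev F x\<bar>) + (SUP x\<in>A. ennreal \<bar>ev G x\<bar>)"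
  proof (rule SUP_least)
    fix x assume x: "x \<in> A"
    have "ennreal \<bar>ev (F + G) x\<bar> \<le> ennreal (\<bar>ev F x\<bar> + \<bar>ev G x\<bar>)"
      unfolding assms(1)[OF x FG] by (rule ennreal_leI[OF abs_triangle_ineq])
    also have "\<dots> = ennreal \<bar>ev F x\<bar> + ennreal \<bar>ev G x\<bar>" by (rule ennreal_plus) auto
    also have "\<dots> \<le> (SUP x\<in>A. ennreal \<bar>ev F x\<bar>) + (SUP x\<in>A. ennreal \<bar>ev G x\<bar>)"
      using x by (intro add_mono SUP_upper)
    finally show "ennreal \<bar>ev (F + G) x\<bar> \<le> (SUP x\<in>A. ennreal \<bar>ev F x\<bar>) + (SUP x\<in>A. ennreal \<bar>ev G x\<bar>)" .
  qed
qed

lemma extended_seminorm_rho: "extended_seminorm CX (rho B)"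
  unfolding rho_def by (rule extended_seminorm_SUP) (auto simp: scaleR_fun_def)

lemma extended_seminormD:
  assumes "extended_seminorm S \<rho>"
  shows "x \<in> S \<Longrightarrow> \<rho> (c *\<^sub>R x) = ennreal \<bar>c\<bar> * \<rho> x"
    and "x \<in> S \<Longrightarrow> y \<in> S \<Longrightarrow> \<rho> (x + y) \<le> \<rho> x + \<rho> y"
  using assms unfolding extended_seminorm_def by blast+

lemma extended_seminorm_zero: "extended_seminorm S \<rho> \<Longrightarrow> 0 \<in> S \<Longrightarrow> \<rho> 0 = 0"
  using extended_seminormD(1)[of S \<rho> 0 0] by simp

lemma extended_seminorm_triangle:
  assumes "extended_seminorm S \<rho>" "subspace S" "x \<in> S" "y \<in> S" "z \<in> S"
  shows "\<rho> (z - x) \<le> \<rho> (z - y) + \<rho> (y - x)"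
  using extended_seminormD(2)[OF assms(1), of "z - y" "y - x"] assms by (simp add: subspace_diff)

text \<open>
  A value \<open>\<infinity>\<close> does no harm: the points of the ball have finite distance to the centre.
\<close>

lemma openin_seminorm_ball:
  assumes \<rho>: "extended_seminorm S \<rho>" and S: "subspace S" and "\<rho> \<in> P" and x: "x \<in> S"
  shows "openin (seminorm_topology S P) {y\<in>S. \<rho> (y - x) < ennreal r}"
  unfolding openin_seminorm_topology
proof (intro conjI ballI)
  fix y assume y: "y \<in> {y\<in>S. \<rho> (y - x) < ennreal r}"
  obtain a where a: "\<rho> (y - x) = ennreal a" "a \<ge> 0"
    using y by (cases "\<rho> (y - x)") auto
  then have ar: "a < r" using y by (simp add: ennreal_less_iff)
  have "\<rho> (z - x) < ennreal r" if z: "z \<in> S" "\<rho> (z - y) < ennreal (r - a)" for z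
  proof -
    have "\<rho> (z - x) \<le> \<rho> (z - y) + \<rho> (y - x)"
      using extended_seminorm_triangle[OF \<rho> S x _ z(1), of y] y by simp
    also have "\<dots> < ennreal (r - a) + ennreal a"
      using z(2) unfolding a(1) by (simp add: ennreal_add_left_cancel_less add.commute)
    also have "\<dots> = ennreal r" using a ar by (simp flip: ennreal_plus)
    finally show ?thesis .
  qed
  then show "\<exists>F r'. finite F \<and> F \<subseteq> P \<and> r' > 0 \<and>
      {z\<in>S. \<forall>\<rho>\<in>F. \<rho> (z - y) < ennreal r'} \<subseteq> {y\<in>S. \<rho> (y - x) < ennreal r}"
    using assms(3) ar by (intro exI[of _ "{\<rho>}"] exI[of _ "r - a"]) auto
qed auto

lemma openin_seminorm_balls:
  assumes "\<And>\<rho>. \<rho> \<in> P \<Longrightarrow> extended_seminorm S \<rho>" and "subspace S" and "x \<in> S"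
    and "finite F" "F \<subseteq> P"
  shows "openin (seminorm_topology S P) {y\<in>S. \<forall>\<rho>\<in>F. \<rho> (y - x) < ennreal r}"
  using assms(4,5)
proof (induction rule: finite_induct)
  case empty
  then show ?case using openin_topspace[of "seminorm_topology S P"] by simp
next
  case (insert \<rho> F)
  have "openin (seminorm_topology S P)
      ({y\<in>S. \<rho> (y - x) < ennreal r} \<inter> {y\<in>S. \<forall>\<rho>\<in>F. \<rho> (y - x) < ennreal r})"
    using insert assms(1-3) by (intro openin_Int openin_seminorm_ball) auto
  moreover have "{y\<in>S. \<rho> (y - x) < ennreal r} \<inter> {y\<in>S. \<forall>\<rho>\<in>F. \<rho> (y - x) < ennreal r}
      = {y\<in>S. \<forall>\<rho>\<in>insert \<rho> F. \<rho> (y - x) < ennreal r}" by blast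
  ultimately show ?case by simp
qed

text \<open>
  With \<open>\<infinity>\<close> as a value, the sets below and above a bound, which generate the topology of the extended
  nonnegative reals, are treated separately; at points of infinite seminorm a whole ball keeps the value \<open>\<infinity>\<close>.
\<close>

lemma extended_seminorm_continuous:
  assumes P: "\<And>\<rho>. \<rho> \<in> P \<Longrightarrow> extended_seminorm S \<rho>" and S: "subspace S" and \<rho>: "\<rho> \<in> P"
  shows "continuous_map (seminorm_topology S P) euclidean \<rho>"
proof -
  let ?T = "seminorm_topology S P"
  note sn = P[OF \<rho>]
  have local: "openin ?T U"
    if US: "U \<subseteq> S" and nbh: "\<And>x. x \<in> U \<Longrightarrow> \<exists>r>0. {y\<in>S. \<rho> (y - x) < ennreal r} \<subseteq> U" for U
    unfolding openin_seminorm_topology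
  proof (intro conjI ballI)
    fix x assume "x \<in> U"
    then obtain r where "r > 0" "{y\<in>S. \<rho> (y - x) < ennreal r} \<subseteq> U" using nbh by blast
    then show "\<exists>F r. finite F \<and> F \<subseteq> P \<and> r > 0 \<and> {y\<in>S. \<forall>\<rho>\<in>F. \<rho> (y - x) < ennreal r} \<subseteq> U"
      using \<rho> by (intro exI[of _ "{\<rho>}"] exI[of _ r]) auto
  qed (rule US)
  have pos: "\<exists>r>0. ennreal r < d" if d: "0 < d" for d
  proof -
    obtain e where "0 < e" "e < d" using dense[OF d] by blast
    then show ?thesis by (cases e) (auto intro!: exI[of _ "enn2real e"])
  qed
  have tri: "\<rho> z \<le> \<rho> y + \<rho> (z - y)" if "y \<in> S" "z \<in> S" for y z
    using extended_seminormD(2)[OF sn, of y "z - y"] that S by (simp add: subspace_diff)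
  have sym: "\<rho> (y - x) = \<rho> (x - y)" if "y \<in> S" "x \<in> S" for x y
    using extended_seminormD(1)[OF sn, of "x - y" "-1"] that S by (simp add: subspace_diff)
  have less: "openin ?T {x\<in>S. \<rho> x < c}" for c
  proof (rule local)
    fix x assume x: "x \<in> {x\<in>S. \<rho> x < c}"
    then have "0 < c - \<rho> x" by (simp add: diff_gt_0_iff_gt_ennreal)
    then obtain r where r: "r > 0" "ennreal r < c - \<rho> x" using pos by blast
    have "\<rho> y < c" if y: "y \<in> S" "\<rho> (y - x) < ennreal r" for y
    proof -
      have "\<rho> y \<le> \<rho> x + \<rho> (y - x)" using tri x y by simp
      also have "\<dots> \<le> \<rho> x + ennreal r" using y by (intro add_left_mono) simp
      also have "\<dots> < c"
        using r(2) x less_le_trans[of "\<rho> x" c top] by (simp add: less_diff_eq_ennreal add.commute)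
      finally show ?thesis .
    qed
    then show "\<exists>r>0. {y\<in>S. \<rho> (y - x) < ennreal r} \<subseteq> {x\<in>S. \<rho> x < c}" using r(1) by blast
  qed auto
  have greater: "openin ?T {x\<in>S. c < \<rho> x}" for c
  proof (rule local)
    fix x assume x: "x \<in> {x\<in>S. c < \<rho> x}"
    then have "0 < \<rho> x - c" by (simp add: diff_gt_0_iff_gt_ennreal)
    then obtain r where r: "r > 0" "ennreal r < \<rho> x - c" using pos by blast
    have "c < \<rho> y" if y: "y \<in> S" "\<rho> (y - x) < ennreal r" for y
    proof (rule ccontr)
      assume "\<not> c < \<rho> y"
      then have le: "\<rho> y \<le> c" by simp
      have "\<rho> x \<le> \<rho> y + \<rho> (x - y)" using tri x y by simp
      also have "\<dots> \<le> c + ennreal r" using le y x sym[of x y] by (intro add_mono) auto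
      also have "\<dots> < \<rho> x"
        using r(2) x less_le_trans[of c "\<rho> x" top] by (simp add: less_diff_eq_ennreal add.commute)
      finally show False by simp
    qed
    then show "\<exists>r>0. {y\<in>S. \<rho> (y - x) < ennreal r} \<subseteq> {x\<in>S. c < \<rho> x}" using r(1) by blast
  qed auto
  have "openin ?T {x\<in>S. \<rho> x \<in> V}" if "open V" for V
    using that unfolding open_generated_order
  proof (induction rule: generate_topology.induct)
    case UNIV
    then show ?case using openin_topspace[of ?T] by simp
  next
    case (Int V W)
    have "{x\<in>S. \<rho> x \<in> V \<inter> W} = {x\<in>S. \<rho> x \<in> V} \<inter> {x\<in>S. \<rho> x \<in> W}" by blast
    then show ?case using Int.IH by (simp add: openin_Int)
  next
    case (UN K)
    have "{x\<in>S. \<rho> x \<in> \<Union>K} = (\<Union>V\<in>K. {x\<in>S. \<rho> x \<in> V})" by blast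
    then show ?case using UN.IH by (auto intro: openin_Union)
  next
    case (Basis V)
    then show ?case using less greater by auto
  qed
  then show ?thesis by (simp add: continuous_map_def)
qed

text \<open>
  Each seminorm of the target is dominated by a single one of the source. For a linear \<open>h\<close> the
  difference \<open>h y - h x\<close> is \<open>h (y - x)\<close>, and the condition becomes the usual one.
\<close>

lemma continuous_map_seminorm_topology:
  assumes h: "\<And>x. x \<in> S \<Longrightarrow> h x \<in> S'"
    and dom: "\<And>\<rho>'. \<rho>' \<in> P' \<Longrightarrow> \<exists>\<rho>\<in>P. \<forall>x\<in>S. \<forall>y\<in>S. \<rho>' (h y - h x) \<le> \<rho> (y - x)"
  shows "continuous_map (seminorm_topology S P) (seminorm_topology S' P') h"
  unfolding continuous_map_def
proof (intro conjI allI impI)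
  show "h \<in> topspace (seminorm_topology S P) \<rightarrow> topspace (seminorm_topology S' P')" using h by simp
  fix V assume V: "openin (seminorm_topology S' P') V"
  obtain sel where sel: "\<And>\<rho>'. \<rho>' \<in> P' \<Longrightarrow> sel \<rho>' \<in> P"
    "\<And>\<rho>' x y. \<rho>' \<in> P' \<Longrightarrow> x \<in> S \<Longrightarrow> y \<in> S \<Longrightarrow> \<rho>' (h y - h x) \<le> sel \<rho>' (y - x)"
    using bchoice[of P' "\<lambda>\<rho>' \<rho>. \<rho> \<in> P \<and> (\<forall>x\<in>S. \<forall>y\<in>S. \<rho>' (h y - h x) \<le> \<rho> (y - x))"] dom by blast
  have "\<exists>F r. finite F \<and> F \<subseteq> P \<and> r > 0 \<and> {y\<in>S. \<forall>\<rho>\<in>F. \<rho> (y - x) < ennreal r} \<subseteq> {x\<in>S. h x \<in> V}"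
    if x: "x \<in> S" "h x \<in> V" for x
  proof -
    obtain F r where F: "finite F" "F \<subseteq> P'" "r > 0" "{y\<in>S'. \<forall>\<rho>\<in>F. \<rho> (y - h x) < ennreal r} \<subseteq> V"
      using bspec[OF conjunct2[OF V[unfolded openin_seminorm_topology]] x(2)] by (elim exE conjE)
    have "h y \<in> V" if y: "y \<in> S" "\<forall>\<rho>\<in>sel ` F. \<rho> (y - x) < ennreal r" for y
    proof -
      have "\<rho> (h y - h x) < ennreal r" if "\<rho> \<in> F" for \<rho>
        using sel(2)[of \<rho> x y] y x that F(2) by (auto intro: le_less_trans)
      then show ?thesis using F(4) h[OF y(1)] by blast
    qed
    moreover have "finite (sel ` F)" "sel ` F \<subseteq> P" using F(1,2) sel(1) by auto
    ultimately show ?thesis using F(3) by (intro exI[of _ "sel ` F"] exI[of _ r]) blast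
  qed
  then show "openin (seminorm_topology S P) {x \<in> topspace (seminorm_topology S P). h x \<in> V}"
    unfolding openin_seminorm_topology by simp
qed

text \<open>
  The domination is stated with radii and not as an inequality between seminorms, so that a supremum
  over an infinite set can be bounded by finitely many seminorms of each factor.
\<close>

lemma continuous_map_prod_seminorm_topology:
  assumes P1: "\<And>\<rho>. \<rho> \<in> P1 \<Longrightarrow> extended_seminorm S1 \<rho>" "subspace S1"
    and P2: "\<And>\<rho>. \<rho> \<in> P2 \<Longrightarrow> extended_seminorm S2 \<rho>" "subspace S2"
    and h: "\<And>a b. a \<in> S1 \<Longrightarrow> b \<in> S2 \<Longrightarrow> h (a, b) \<in> S"
    and dom: "\<And>\<rho> r. \<rho> \<in> P \<Longrightarrow> 0 < r \<Longrightarrow> \<exists>F1 F2 s. finite F1 \<and> F1 \<subseteq> P1 \<and> finite F2 \<and> F2 \<subseteq> P2 \<and> 0 < s \<and>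
      (\<forall>a\<in>S1. \<forall>a'\<in>S1. \<forall>b\<in>S2. \<forall>b'\<in>S2. (\<forall>\<rho>1\<in>F1. \<rho>1 (a' - a) < ennreal s) \<longrightarrow>
        (\<forall>\<rho>2\<in>F2. \<rho>2 (b' - b) < ennreal s) \<longrightarrow> \<rho> (h (a', b') - h (a, b)) < ennreal r)"
  shows "continuous_map (prod_topology (seminorm_topology S1 P1) (seminorm_topology S2 P2))
    (seminorm_topology S P) h"
  unfolding continuous_map_def
proof (intro conjI allI impI)
  let ?T1 = "seminorm_topology S1 P1" and ?T2 = "seminorm_topology S2 P2"
  show "h \<in> topspace (prod_topology ?T1 ?T2) \<rightarrow> topspace (seminorm_topology S P)" using h by auto
  fix V assume V: "openin (seminorm_topology S P) V"
  have "\<exists>U1 U2. openin ?T1 U1 \<and> openin ?T2 U2 \<and> a \<in> U1 \<and> b \<in> U2 \<and>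
      U1 \<times> U2 \<subseteq> {p \<in> topspace (prod_topology ?T1 ?T2). h p \<in> V}"
    if "(a, b) \<in> {p \<in> topspace (prod_topology ?T1 ?T2). h p \<in> V}" for a b
  proof -
    have ab: "a \<in> S1" "b \<in> S2" "h (a, b) \<in> V" using that by auto
    obtain F r where F: "finite F" "F \<subseteq> P" "r > 0" "{y\<in>S. \<forall>\<rho>\<in>F. \<rho> (y - h (a, b)) < ennreal r} \<subseteq> V"
      using bspec[OF conjunct2[OF V[unfolded openin_seminorm_topology]] ab(3)] by (elim exE conjE)
    have "\<exists>U1 U2. openin ?T1 U1 \<and> openin ?T2 U2 \<and> a \<in> U1 \<and> b \<in> U2 \<and>
        (\<forall>a'\<in>U1. \<forall>b'\<in>U2. \<forall>\<rho>\<in>F. \<rho> (h (a', b') - h (a, b)) < ennreal r)"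
      using F(1,2)
    proof (induction rule: finite_induct)
      case empty
      show ?case
        using ab openin_topspace[of ?T1] openin_topspace[of ?T2] by (intro exI[of _ S1] exI[of _ S2]) simp
    next
      case (insert \<rho> F)
      obtain U1 U2 where U: "openin ?T1 U1" "openin ?T2 U2" "a \<in> U1" "b \<in> U2"
        "\<And>a' b' \<rho>. a' \<in> U1 \<Longrightarrow> b' \<in> U2 \<Longrightarrow> \<rho> \<in> F \<Longrightarrow> \<rho> (h (a', b') - h (a, b)) < ennreal r"
        using insert.IH insert.prems by auto
      obtain F1 F2 s where s: "finite F1" "F1 \<subseteq> P1" "finite F2" "F2 \<subseteq> P2" "0 < s"
        and d: "\<forall>a\<in>S1. \<forall>a'\<in>S1. \<forall>b\<in>S2. \<forall>b'\<in>S2. (\<forall>\<rho>1\<in>F1. \<rho>1 (a' - a) < ennreal s) \<longrightarrow>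
          (\<forall>\<rho>2\<in>F2. \<rho>2 (b' - b) < ennreal s) \<longrightarrow> \<rho> (h (a', b') - h (a, b)) < ennreal r"
        using dom[OF subsetD[OF insert.prems insertI1] F(3)] by (elim exE conjE)
      have dom': "\<rho> (h (a', b') - h (a, b)) < ennreal r"
        if "a' \<in> S1" "b' \<in> S2" "\<forall>\<rho>1\<in>F1. \<rho>1 (a' - a) < ennreal s" "\<forall>\<rho>2\<in>F2. \<rho>2 (b' - b) < ennreal s" for a' b'
        using mp[OF mp[OF bspec[OF bspec[OF bspec[OF bspec[OF d ab(1)] that(1)] ab(2)] that(2)] that(3)] that(4)] .
      let ?W1 = "{y\<in>S1. \<forall>\<rho>1\<in>F1. \<rho>1 (y - a) < ennreal s}"
      let ?W2 = "{y\<in>S2. \<forall>\<rho>2\<in>F2. \<rho>2 (y - b) < ennreal s}"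
      have W1: "openin ?T1 ?W1" by (rule openin_seminorm_balls[OF P1 ab(1) s(1,2)])
      have W2: "openin ?T2 ?W2" by (rule openin_seminorm_balls[OF P2 ab(2) s(3,4)])
      have "\<rho>1 (a - a) < ennreal s" if "\<rho>1 \<in> F1" for \<rho>1
        using s(5) extended_seminorm_zero[OF P1(1)[OF subsetD[OF s(2) that]] subspace_0[OF P1(2)]] by simp
      then have "a \<in> ?W1" using ab(1) by simp
      have "\<rho>2 (b - b) < ennreal s" if "\<rho>2 \<in> F2" for \<rho>2
        using s(5) extended_seminorm_zero[OF P2(1)[OF subsetD[OF s(4) that]] subspace_0[OF P2(2)]] by simp
      then have "b \<in> ?W2" using ab(2) by simp
      show ?case
      proof (intro exI[of _ "U1 \<inter> ?W1"] exI[of _ "U2 \<inter> ?W2"] conjI ballI)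
        fix a' b' \<rho>' assume a': "a' \<in> U1 \<inter> ?W1" and b': "b' \<in> U2 \<inter> ?W2" and "\<rho>' \<in> insert \<rho> F"
        then consider "\<rho>' = \<rho>" | "\<rho>' \<in> F" by blast
        then show "\<rho>' (h (a', b') - h (a, b)) < ennreal r"
        proof cases
          case 1
          then show ?thesis using dom'[of a' b'] a' b' by simp
        next
          case 2
          then show ?thesis using U(5)[of a' b' \<rho>'] a' b' by simp
        qed
      qed (use U W1 W2 \<open>a \<in> ?W1\<close> \<open>b \<in> ?W2\<close> in \<open>simp_all add: openin_Int\<close>)
    qed
    then obtain U1 U2 where U: "openin ?T1 U1" "openin ?T2 U2" "a \<in> U1" "b \<in> U2"
      "\<And>a' b' \<rho>. a' \<in> U1 \<Longrightarrow> b' \<in> U2 \<Longrightarrow> \<rho> \<in> F \<Longrightarrow> \<rho> (h (a', b') - h (a, b)) < ennreal r"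
      by auto
    have sub: "U1 \<subseteq> S1" "U2 \<subseteq> S2" using openin_subset[OF U(1)] openin_subset[OF U(2)] by simp_all
    have "h (a', b') \<in> V" if "a' \<in> U1" "b' \<in> U2" for a' b'
      using U(5)[OF that] h[of a' b'] that sub F(4) by blast
    then have "U1 \<times> U2 \<subseteq> {p \<in> topspace (prod_topology ?T1 ?T2). h p \<in> V}"
      using sub by auto
    then show ?thesis using U(1-4) by blast
  qed
  then show "openin (prod_topology ?T1 ?T2) {p \<in> topspace (prod_topology ?T1 ?T2). h p \<in> V}"
    unfolding openin_prod_topology_alt by blast
qed

section \<open>The space of continuous functions with the topology of a bornology\<close>

lemma rho_diff_less_imp_CX_fin:
  assumes "f \<in> CX_fin D" "g \<in> CX" "rho D (g - f) < ennreal r"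
  shows "g \<in> CX_fin D"
proof -
  have f: "f \<in> CX" using assms(1) by (simp add: CX_fin_def)
  have "g - f \<in> CX_fin D"
    using assms f order.strict_trans[OF assms(3) ennreal_less_top] by (auto simp: CX_fin_def)
  then have "f + (g - f) \<in> CX_fin D" by (intro subspace_add[OF subspace_CX_fin assms(1)])
  then show ?thesis by simp
qed

text \<open>
  Each \<open>rho B\<close> is itself one of the continuous extended seminorms that define the finite part.
\<close>

lemma finite_part_tau_subset:
  assumes "B \<in> \<B>"
  shows "finite_part CX (tau \<B>) \<subseteq> CX_fin B"
proof -
  have "extended_seminorm CX (rho B)" by (rule extended_seminorm_rho)
  moreover have "continuous_map (tau \<B>) euclidean (rho B)"
    unfolding tau_def
    by (rule extended_seminorm_continuous[OF _ subspace_CX])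
      (use assms in \<open>auto simp: extended_seminorm_rho\<close>)
  ultimately show ?thesis unfolding finite_part_def CX_fin_def by blast
qed

lemma rho_scaled_ball:
  assumes "f \<in> CX" "0 \<le> c" "\<And>x. x \<in> B \<Longrightarrow> \<bar>f x\<bar> \<le> c" "0 \<le> t" "t * c < r"
  shows "rho B (t *\<^sub>R f) < ennreal r"
proof -
  have "\<bar>(t *\<^sub>R f) x\<bar> \<le> t * c" if "x \<in> B" for x
    using assms(3)[OF that] assms(4) by (simp add: scaleR_fun_def abs_mult mult_left_mono)
  then have "rho B (t *\<^sub>R f) \<le> ennreal (t * c)"
    using assms(2,4) by (subst rho_le_iff) auto
  also have "\<dots> < ennreal r"
    using assms(5) mult_nonneg_nonneg[OF assms(4,2)] by (intro ennreal_lessI) linarith+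
  finally show ?thesis .
qed

text \<open>
  If the finite part is open, it contains a ball of some \<open>rho B\<close>, hence by scaling every function
  with finite \<open>rho B\<close>; passing to a larger set only shrinks the space.
\<close>

lemma fundamental_minimal_member:
  assumes born: "bornology \<B>" and cb: "has_closed_base \<B>" and fund: "fundamental_elcs CX (tau \<B>)"
  shows "\<exists>D\<in>\<B>. closed D \<and> (\<forall>B\<in>\<B>. CX_fin D \<subseteq> CX_fin B)"
proof -
  let ?Z = "finite_part CX (tau \<B>)"
  have "openin (tau \<B>) ?Z" using fund by (simp add: fundamental_elcs_def)
  moreover have "0 \<in> ?Z"
    using CX_zero by (auto simp: finite_part_def extended_seminorm_zero[OF _ CX_zero])
  ultimately obtain B0 r where B0: "B0 \<in> \<B>" "r > 0" "{g\<in>CX. rho B0 (g - 0) < ennreal r} \<subseteq> ?Z"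
    unfolding openin_tau[OF born] by meson
  obtain D where D: "D \<in> \<B>" "closed D" "B0 \<subseteq> D" using cb B0(1) unfolding has_closed_base_def by meson
  have "f \<in> CX_fin B" if B: "B \<in> \<B>" and f: "f \<in> CX_fin D" for f B
  proof -
    obtain c where c: "f \<in> CX" "c \<ge> 0" "\<forall>x\<in>D. \<bar>f x\<bar> \<le> c"
      using f unfolding CX_fin_iff by blast
    define t where "t = r / (c + 1)"
    have t: "t > 0" using c(2) B0(2) by (simp add: t_def)
    have "t * c < r" using c(2) B0(2) by (simp add: t_def field_simps)
    then have "rho B0 (t *\<^sub>R f) < ennreal r"
      using c D(3) t by (intro rho_scaled_ball[of f c]) auto
    then have "t *\<^sub>R f \<in> ?Z" using B0(3) c(1) by auto
    then have "t *\<^sub>R f \<in> CX_fin B" using finite_part_tau_subset[OF B] by blast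
    then have "(1/t) *\<^sub>R (t *\<^sub>R f) \<in> CX_fin B" by (rule subspace_scale[OF subspace_CX_fin])
    then show ?thesis using t by simp
  qed
  then show ?thesis using D(1,2) by blast
qed

text \<open>
  A neighbourhood of 0 on which \<open>\<bar>F\<bar> < 1\<close> contains a ball of some \<open>rho B\<close>, and \<open>B\<close> may be enlarged to a
  closed member. Scaling gives the bound; if \<open>f\<close> vanishes on \<open>B\<close>, all multiples of \<open>f\<close> lie in the ball.
\<close>

lemma dual_set_bounded:
  assumes born: "bornology \<B>" and cb: "has_closed_base \<B>" and F: "F \<in> dual CX (tau \<B>)"
  shows "\<exists>B\<in>\<B>. \<exists>k. set_bounded_functional F B k"
proof -
  have add: "F (f + g) = F f + F g" if "f \<in> CX" "g \<in> CX" for f g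
    using F that by (simp add: dual_def)
  have scale: "F (c *\<^sub>R f) = c * F f" if "f \<in> CX" for c f
    using F that by (simp add: dual_def)
  have "openin (tau \<B>) {f \<in> topspace (tau \<B>). F f \<in> {-1<..<1}}"
    using F by (intro openin_continuous_map_preimage[of _ euclideanreal]) (auto simp: dual_def)
  then have "openin (tau \<B>) {f \<in> CX. F f \<in> {-1<..<1}}" by (simp add: tau_def)
  moreover have "F 0 = 0" using scale[OF CX_zero, of 0] by simp
  then have "0 \<in> {f \<in> CX. F f \<in> {-1<..<1}}" using CX_zero by auto
  ultimately obtain B0 r where B0: "B0 \<in> \<B>" "r > 0"
      "{g\<in>CX. rho B0 (g - 0) < ennreal r} \<subseteq> {f \<in> CX. F f \<in> {-1<..<1}}"
    unfolding openin_tau[OF born] by meson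
  obtain B where B: "B \<in> \<B>" "closed B" "B0 \<subseteq> B" using cb B0(1) unfolding has_closed_base_def by meson
  have small: "t * \<bar>F f\<bar> < 1"
    if f: "f \<in> CX" "0 \<le> c" "\<And>x. x \<in> B \<Longrightarrow> \<bar>f x\<bar> \<le> c" and t: "0 \<le> t" "t * c < r" for f c t
  proof -
    have "rho B0 (t *\<^sub>R f) < ennreal r" using f t B(3) by (intro rho_scaled_ball[of f c]) auto
    then have "t *\<^sub>R f \<in> {f \<in> CX. F f \<in> {-1<..<1}}" using B0(3) CX_scaleR[OF f(1), of t] by auto
    then have "\<bar>t * F f\<bar> < 1" using scale[OF f(1), of t] by auto
    then show ?thesis using t(1) by (simp add: abs_mult)
  qed
  have "set_bounded_functional F B (2 / r)"
  proof
    fix f c assume f: "f \<in> CX" "0 \<le> c" "\<And>x. x \<in> B \<Longrightarrow> \<bar>f x\<bar> \<le> c"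
    show "\<bar>F f\<bar> \<le> 2 / r * c"
    proof (cases "c = 0")
      case True
      have "F f = 0"
      proof (rule ccontr)
        assume "F f \<noteq> 0"
        then show False using small[OF f, of "1 / \<bar>F f\<bar>"] True B0(2) by simp
      qed
      then show ?thesis using True by simp
    next
      case False
      then have "c > 0" using f(2) by simp
      then have "r / (2 * c) * \<bar>F f\<bar> < 1"
        using B0(2) by (intro small[OF f]) (simp_all add: field_simps)
      then show ?thesis using \<open>c > 0\<close> B0(2) by (simp add: field_simps)
    qed
  qed (use add scale B(2) in auto)
  then show ?thesis using B(1) by blast
qed

lemma elcs_boundedD:
  assumes "elcs_bounded S T A" "openin T V" "0 \<in> V" "V \<subseteq> U" "U \<subseteq> S"
  shows "\<exists>r>0. \<exists>E. finite E \<and> E \<subseteq> S \<and> A \<subseteq> {e + r *\<^sub>R u | e u. e \<in> E \<and> u \<in> U}"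
proof -
  have "U \<subseteq> S \<and> (\<exists>V. openin T V \<and> 0 \<in> V \<and> V \<subseteq> U)"
    by (intro conjI exI[of _ V] assms(2-))
  then show ?thesis
    by (rule mp[OF spec[OF conjunct2[OF assms(1)[unfolded elcs_bounded_def]]]])
qed

lemma scaleR_fun_apply: "(c *\<^sub>R f) x = c *\<^sub>R f x"
  by (simp add: scaleR_fun_def)

text \<open>
  By minimality \<open>CX_fin D\<close> is the intersection of all the spaces \<open>CX_fin B\<close>, hence the same
  for every such \<open>D\<close>.
\<close>

locale complemented_finite_part =
  fixes \<B> :: "'a::metric_space set set" and D :: "'a set" and M :: "('a \<Rightarrow> real) set"
  assumes born: "bornology \<B>" and closed_base: "has_closed_base \<B>"
    and D: "D \<in> \<B>"
    and minimal: "B \<in> \<B> \<Longrightarrow> CX_fin D \<subseteq> CX_fin B"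
    and complement: "algebraic_complement CX (CX_fin D) M"
begin

abbreviation "L \<equiv> CX_fin D"
abbreviation "T \<equiv> tau \<B>"
abbreviation "TL \<equiv> subtopology T L"
abbreviation "TM \<equiv> subtopology T M"

lemma subspace_L: "subspace L" by (rule subspace_CX_fin)

lemma subspace_M: "subspace M"
  using complement by (simp add: algebraic_complement_def)

lemma L_subset: "L \<subseteq> CX" by (auto simp: CX_fin_def)

lemma M_subset: "M \<subseteq> CX"
  using complement by (simp add: algebraic_complement_def)

lemma BCpos_subset_L: "BCpos \<subseteq> L"
proof
  fix f assume f: "f \<in> (BCpos :: ('a \<Rightarrow> real) set)"
  obtain c where c: "\<forall>x. f x \<le> c" using BCposD(3)[OF f] ..
  have "\<bar>f x\<bar> \<le> max 0 c" for x using c[rule_format, of x] BCposD(2)[OF f, of x] by simp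
  then show "f \<in> L"
    using f BCpos_subset_CX unfolding CX_fin_iff by (intro conjI exI[of _ "max 0 c"]) auto
qed

lemma topspace_T [simp]: "topspace T = CX" by (simp add: tau_def)

lemma openin_L: "openin T L"
  unfolding openin_tau[OF born]
proof (intro conjI ballI)
  fix f assume "f \<in> L"
  then have "{g\<in>CX. rho D (g - f) < ennreal 1} \<subseteq> L"
    using rho_diff_less_imp_CX_fin[of f D _ 1] by blast
  then show "\<exists>B\<in>\<B>. \<exists>r>0. {g\<in>CX. rho B (g - f) < ennreal r} \<subseteq> L"
    using D by (intro bexI[of _ D] exI[of _ 1]) auto
qed (rule L_subset)

subsection \<open>The decomposition\<close>

definition prL :: "('a \<Rightarrow> real) \<Rightarrow> 'a \<Rightarrow> real" where
  "prL f = (THE l. l \<in> L \<and> f - l \<in> M)"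

definition prM :: "('a \<Rightarrow> real) \<Rightarrow> 'a \<Rightarrow> real" where
  "prM f = f - prL f"

lemma prL_eqI:
  assumes "l \<in> L" "f - l \<in> M"
  shows "prL f = l"
  unfolding prL_def
proof (rule the_equality)
  fix l' assume l': "l' \<in> L \<and> f - l' \<in> M"
  have "l' - l \<in> L" by (rule subspace_diff[OF subspace_L conjunct1[OF l'] assms(1)])
  moreover have "(f - l) - (f - l') \<in> M" by (rule subspace_diff[OF subspace_M assms(2) conjunct2[OF l']])
  then have "l' - l \<in> M" by simp
  ultimately have "l' - l \<in> {0}" using complement unfolding algebraic_complement_def by blast
  then show "l' = l" by simp
qed (use assms in blast)

lemma
  assumes "f \<in> CX"
  shows prL_in: "prL f \<in> L" and prM_in: "prM f \<in> M"
proof -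
  obtain l m where "f = l + m" "l \<in> L" "m \<in> M"
    using complement assms unfolding algebraic_complement_def by blast
  then have "prL f = l" by (intro prL_eqI) auto
  then show "prL f \<in> L" "prM f \<in> M" using \<open>f = l + m\<close> \<open>l \<in> L\<close> \<open>m \<in> M\<close> by (auto simp: prM_def)
qed

lemma prL_add: "f \<in> CX \<Longrightarrow> g \<in> CX \<Longrightarrow> prL (f + g) = prL f + prL g"
  using subspace_add[OF subspace_M prM_in prM_in, of f g]
  by (intro prL_eqI subspace_add[OF subspace_L] prL_in) (simp_all add: prM_def algebra_simps)

lemma prL_scaleR: "f \<in> CX \<Longrightarrow> prL (c *\<^sub>R f) = c *\<^sub>R prL f"
  using subspace_scale[OF subspace_M prM_in, of f c]
  by (intro prL_eqI subspace_scale[OF subspace_L] prL_in) (simp_all add: prM_def scaleR_diff_right)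

lemma prM_add: "f \<in> CX \<Longrightarrow> g \<in> CX \<Longrightarrow> prM (f + g) = prM f + prM g"
  by (simp add: prM_def prL_add)

lemma prM_scaleR: "f \<in> CX \<Longrightarrow> prM (c *\<^sub>R f) = c *\<^sub>R prM f"
  by (simp add: prM_def prL_scaleR scaleR_diff_right)

lemma prL_of_L: "f \<in> L \<Longrightarrow> prL f = f" and prM_of_L: "f \<in> L \<Longrightarrow> prM f = 0"
  using prL_eqI[of f f] subspace_0[OF subspace_M] by (auto simp: prM_def)

lemma prL_of_M: "f \<in> M \<Longrightarrow> prL f = 0" and prM_of_M: "f \<in> M \<Longrightarrow> prM f = f"
  using prL_eqI[of 0 f] subspace_0[OF subspace_L] by (auto simp: prM_def)

subsection \<open>Bounded sets\<close>

lemma bounded_of_L: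
  assumes "elcs_bounded L TL A"
  shows "elcs_bounded CX T A"
  unfolding elcs_bounded_def
proof (intro conjI allI impI)
  show "A \<subseteq> CX" using assms L_subset unfolding elcs_bounded_def by blast
  fix U assume "U \<subseteq> CX \<and> (\<exists>V. openin T V \<and> 0 \<in> V \<and> V \<subseteq> U)"
  then obtain V where V: "openin T V" "0 \<in> V" "V \<subseteq> U" by blast
  have "openin TL (V \<inter> L)" using V(1) by (auto simp: openin_subtopology)
  moreover have "0 \<in> V \<inter> L" using V(2) subspace_0[OF subspace_L] by blast
  moreover have "V \<inter> L \<subseteq> U \<inter> L" using V(3) by blast
  ultimately have "\<exists>r>0. \<exists>E. finite E \<and> E \<subseteq> L \<and> A \<subseteq> {e + r *\<^sub>R u | e u. e \<in> E \<and> u \<in> U \<inter> L}"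
    by (rule elcs_boundedD[OF assms]) simp
  then obtain r E where rE: "r > 0" "finite E" "E \<subseteq> L"
      "A \<subseteq> {e + r *\<^sub>R u | e u. e \<in> E \<and> u \<in> U \<inter> L}"
    by (elim exE conjE)
  have "{e + r *\<^sub>R u | e u. e \<in> E \<and> u \<in> U \<inter> L} \<subseteq> {e + r *\<^sub>R u | e u. e \<in> E \<and> u \<in> U}" by blast
  then have "A \<subseteq> {e + r *\<^sub>R u | e u. e \<in> E \<and> u \<in> U}" using rE(4) by (rule subset_trans[rotated])
  then show "\<exists>r>0. \<exists>E. finite E \<and> E \<subseteq> CX \<and> A \<subseteq> {e + r *\<^sub>R u | e u. e \<in> E \<and> u \<in> U}"
    using rE(1,2) subset_trans[OF rE(3) L_subset] by (intro exI[of _ r] exI[of _ E] conjI)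
qed

lemma bounded_singleton:
  assumes "f \<in> CX"
  shows "elcs_bounded CX T {f}"
  unfolding elcs_bounded_def
proof (intro conjI allI impI)
  fix U assume "U \<subseteq> CX \<and> (\<exists>V. openin T V \<and> 0 \<in> V \<and> V \<subseteq> U)"
  then have "0 \<in> U" by blast
  then have "{f} \<subseteq> {e + 1 *\<^sub>R u | e u. e \<in> {f} \<and> u \<in> U}" by force
  then show "\<exists>r>0. \<exists>E. finite E \<and> E \<subseteq> CX \<and> {f} \<subseteq> {e + r *\<^sub>R u | e u. e \<in> E \<and> u \<in> U}"
    using assms by (intro exI[of _ 1] exI[of _ "{f}"]) auto
qed (use assms in auto)

text \<open>
  A neighbourhood of 0 may be taken inside the open subspace \<open>L\<close>; modulo \<open>L\<close>, a bounded set then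
  consists of the finitely many translation vectors only.
\<close>

lemma bounded_split:
  assumes "elcs_bounded CX T A"
  shows "elcs_bounded L TL (prL ` A)" and "finite (prM ` A)"
proof -
  have A: "A \<subseteq> CX" using assms by (simp add: elcs_bounded_def)
  have cover: "\<exists>r>0. \<exists>E. finite E \<and> E \<subseteq> CX \<and> A \<subseteq> {e + r *\<^sub>R u | e u. e \<in> E \<and> u \<in> U}"
    if U: "U \<subseteq> L" and nbh: "\<exists>V. openin TL V \<and> 0 \<in> V \<and> V \<subseteq> U" for U
  proof -
    obtain V where V: "openin TL V" "0 \<in> V" "V \<subseteq> U" using nbh by blast
    have "openin T V" using V(1) openin_L by (simp add: openin_open_subtopology)
    then show ?thesis by (rule elcs_boundedD[OF assms _ V(2,3) subset_trans[OF U L_subset]])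
  qed
  show "elcs_bounded L TL (prL ` A)"
    unfolding elcs_bounded_def
  proof (intro conjI allI impI)
    show "prL ` A \<subseteq> L" using A prL_in by blast
    fix U assume U: "U \<subseteq> L \<and> (\<exists>V. openin TL V \<and> 0 \<in> V \<and> V \<subseteq> U)"
    obtain r E where rE: "r > 0" "finite E" "E \<subseteq> CX" "A \<subseteq> {e + r *\<^sub>R u | e u. e \<in> E \<and> u \<in> U}"
      using cover[of U] U by blast
    have "prL ` A \<subseteq> {e + r *\<^sub>R u | e u. e \<in> prL ` E \<and> u \<in> U}"
    proof
      fix l assume "l \<in> prL ` A"
      then obtain e u where eu: "l = prL (e + r *\<^sub>R u)" "e \<in> E" "u \<in> U" using rE(4) by blast
      have "e \<in> CX" "u \<in> CX" "u \<in> L" using eu rE(3) U L_subset by blast+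
      then have "l = prL e + r *\<^sub>R u" using eu(1) by (simp add: prL_add CX_scaleR prL_scaleR prL_of_L)
      then show "l \<in> {e + r *\<^sub>R u | e u. e \<in> prL ` E \<and> u \<in> U}" using eu by blast
    qed
    moreover have "finite (prL ` E)" "prL ` E \<subseteq> L" using rE prL_in by blast+
    ultimately show "\<exists>r>0. \<exists>E. finite E \<and> E \<subseteq> L \<and> prL ` A \<subseteq> {e + r *\<^sub>R u | e u. e \<in> E \<and> u \<in> U}"
      using rE(1) by blast
  qed
  have "openin TL L" using openin_L by (simp add: openin_open_subtopology)
  then obtain r E where rE: "r > 0" "finite E" "E \<subseteq> CX" "A \<subseteq> {e + r *\<^sub>R u | e u. e \<in> E \<and> u \<in> L}"
    using cover[of L] subspace_0[OF subspace_L] by blast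
  have "prM ` A \<subseteq> prM ` E"
  proof
    fix m assume "m \<in> prM ` A"
    then obtain e u where eu: "m = prM (e + r *\<^sub>R u)" "e \<in> E" "u \<in> L" using rE(4) by blast
    have "e \<in> CX" "u \<in> CX" using eu rE(3) L_subset by blast+
    then have "m = prM e" using eu by (simp add: prM_add CX_scaleR prM_scaleR prM_of_L)
    then show "m \<in> prM ` E" using eu(2) by blast
  qed
  then show "finite (prM ` A)" using rE(2) by (meson finite_imageI finite_subset)
qed

subsection \<open>Continuous functionals\<close>

text \<open>
  \<open>M\<close> is discrete, because different points of \<open>M\<close> lie in different cosets of the open subspace \<open>L\<close>.
\<close>

lemma openin_TM:
  assumes "U \<subseteq> M"
  shows "openin TM U"
proof -
  let ?W = "\<Union>m\<in>U. {g\<in>CX. g - m \<in> L}"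
  have "openin T ?W"
    unfolding openin_tau[OF born]
  proof (intro conjI ballI)
    fix f assume "f \<in> ?W"
    then obtain m where m: "m \<in> U" "f \<in> CX" "f - m \<in> L" by blast
    have "g - m \<in> L" if g: "g \<in> CX" "rho D (g - f) < ennreal 1" for g
    proof (rule rho_diff_less_imp_CX_fin[OF m(3)])
      show "g - m \<in> CX" using g m assms M_subset by blast
      show "rho D ((g - m) - (f - m)) < ennreal 1" using g(2) by simp
    qed
    then show "\<exists>B\<in>\<B>. \<exists>r>0. {g\<in>CX. rho B (g - f) < ennreal r} \<subseteq> ?W"
      using D m(1) by (intro bexI[of _ D] exI[of _ 1]) auto
  qed auto
  moreover have "U = ?W \<inter> M"
  proof
    show "U \<subseteq> ?W \<inter> M" using assms M_subset subspace_0[OF subspace_L] by force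
    show "?W \<inter> M \<subseteq> U"
    proof
      fix g assume "g \<in> ?W \<inter> M"
      then obtain m where m: "m \<in> U" "g - m \<in> L" "g \<in> M" by blast
      then have "g - m \<in> L \<inter> M" using assms subspace_diff[OF subspace_M] by blast
      then have "g - m \<in> {0}" using complement unfolding algebraic_complement_def by blast
      then show "g \<in> U" using m(1) by simp
    qed
  qed
  ultimately show ?thesis unfolding openin_subtopology by blast
qed

text \<open>
  On a discrete space continuity is no restriction: the dual of \<open>M\<close> is its algebraic dual.
\<close>

lemma dual_M_iff:
  "\<phi> \<in> dual M TM \<longleftrightarrow> (\<forall>x\<in>M. \<forall>y\<in>M. \<phi> (x + y) = \<phi> x + \<phi> y) \<and>
     (\<forall>c. \<forall>x\<in>M. \<phi> (c *\<^sub>R x) = c * \<phi> x) \<and> (\<forall>x. x \<notin> M \<longrightarrow> \<phi> x = 0)"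
proof -
  have "topspace TM = M" using M_subset by auto
  then have "continuous_map TM euclideanreal \<phi>"
    unfolding continuous_map_def by (auto intro: openin_TM)
  then show ?thesis by (auto simp: dual_def)
qed

lemma subspace_dual_M: "subspace (dual M TM)"
  by (rule subspaceI) (auto simp: dual_M_iff scaleR_fun_def distrib_left)

lemma dual_M_zero: "\<phi> \<in> dual M TM \<Longrightarrow> \<phi> 0 = 0"
  using subspace_0[OF subspace_M] unfolding dual_M_iff by (metis mult_zero_left scaleR_zero_left)

lemma subspace_measures: "subspace (measures_on \<B>)"
proof (rule subspaceI)
  show "0 \<in> measures_on \<B>"
  proof -
    obtain C where C: "C \<in> \<B>" "closed C" using closed_base D unfolding has_closed_base_def by meson
    have tv: "total_variation (0 :: 'a set \<Rightarrow> real) A = 0" for A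
    proof -
      have "total_variation (0 :: 'a set \<Rightarrow> real) A \<le> 0" by (rule total_variation_least) simp
      then show ?thesis by simp
    qed
    show ?thesis
    proof (rule measures_onI[OF _ _ C tv])
      show "finite_borel_measure (0 :: 'a set \<Rightarrow> real)"
        by (simp add: finite_borel_measure_def tv additive_def)
      show "closed_regular (0 :: 'a set \<Rightarrow> real)"
        unfolding closed_regular_def
        by (intro ballI allI impI, rule exI[of _ "{}"], rule exI[of _ UNIV]) (simp add: tv)
    qed
  qed
qed (auto intro: measures_on_add[OF born] measures_on_scaleR)

lemma has_integral_L:
  "\<mu> \<in> measures_on \<B> \<Longrightarrow> f \<in> L \<Longrightarrow> has_measure_integral \<mu> f (measure_integral \<mu> f)"
  using minimal by (intro measures_on_has_integral) auto

lemma integral_add_fun: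
  "\<mu> \<in> measures_on \<B> \<Longrightarrow> f \<in> L \<Longrightarrow> g \<in> L \<Longrightarrow>
    measure_integral \<mu> (f + g) = measure_integral \<mu> f + measure_integral \<mu> g"
  by (intro measure_integral_eqI has_measure_integral_add_fun has_integral_L)

lemma integral_scaleR_fun:
  "\<mu> \<in> measures_on \<B> \<Longrightarrow> f \<in> L \<Longrightarrow> measure_integral \<mu> (c *\<^sub>R f) = c * measure_integral \<mu> f"
  by (intro measure_integral_eqI has_measure_integral_scaleR_fun has_integral_L)

lemma integral_add_measure:
  "\<mu> \<in> measures_on \<B> \<Longrightarrow> \<nu> \<in> measures_on \<B> \<Longrightarrow> f \<in> L \<Longrightarrow>
    measure_integral (\<mu> + \<nu>) f = measure_integral \<mu> f + measure_integral \<nu> f"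
  by (intro measure_integral_eqI has_measure_integral_add_measure has_integral_L)

lemma integral_scaleR_measure:
  "\<mu> \<in> measures_on \<B> \<Longrightarrow> f \<in> L \<Longrightarrow> measure_integral (c *\<^sub>R \<mu>) f = c * measure_integral \<mu> f"
  by (intro measure_integral_eqI has_measure_integral_scaleR_measure has_integral_L)

lemma integral_diff_measure:
  assumes "\<mu> \<in> measures_on \<B>" "\<nu> \<in> measures_on \<B>" "f \<in> L"
  shows "measure_integral (\<mu> - \<nu>) f = measure_integral \<mu> f - measure_integral \<nu> f"
  using integral_add_measure[OF subspace_diff[OF subspace_measures assms(1,2)] assms(2,3)] by simp

text \<open>
  Near a point all differences lie in \<open>L\<close>, so a bound on \<open>L\<close> gives continuity on the whole space. The
  union with \<open>D\<close> forces the differences into \<open>L\<close>.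
\<close>

lemma continuous_functional:
  assumes add: "\<And>f g. f \<in> CX \<Longrightarrow> g \<in> CX \<Longrightarrow> F (f + g) = F f + F g"
    and B: "B \<in> \<B>" and bound: "\<And>f c. f \<in> L \<Longrightarrow> 0 \<le> c \<Longrightarrow> (\<And>x. x \<in> B \<Longrightarrow> \<bar>f x\<bar> \<le> c) \<Longrightarrow> \<bar>F f\<bar> \<le> k * c"
  shows "continuous_map T euclideanreal F"
  unfolding continuous_map_def
proof (intro conjI allI impI)
  fix V :: "real set" assume "openin euclideanreal V"
  then have V: "open V" by simp
  show "openin T {f \<in> topspace T. F f \<in> V}"
    unfolding openin_tau[OF born]
  proof (intro conjI ballI)
    fix f assume "f \<in> {f \<in> topspace T. F f \<in> V}"
    then have f: "f \<in> CX" "F f \<in> V" by auto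
    obtain e where e: "e > 0" "ball (F f) e \<subseteq> V" using V f(2) openE by blast
    define r where "r = e / (\<bar>k\<bar> + 1)"
    have r: "r > 0" using e(1) by (simp add: r_def)
    have "r * (\<bar>k\<bar> + 1) = e" by (simp add: r_def)
    then have kr: "\<bar>k\<bar> * r < e" using r by (simp add: algebra_simps)
    have "F g \<in> V" if g: "g \<in> CX" "rho (B \<union> D) (g - f) < ennreal r" for g
    proof -
      have "rho (B \<union> D) (g - f) \<le> ennreal r" using g(2) by simp
      then have small: "\<forall>x\<in>B \<union> D. \<bar>(g - f) x\<bar> \<le> r" using r by (subst (asm) rho_le_iff) auto
      then have "g - f \<in> L"
        using f(1) g(1) r unfolding CX_fin_iff by (intro conjI exI[of _ r]) auto
      then have "\<bar>F (g - f)\<bar> \<le> k * r" using small r by (intro bound) auto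
      also have "\<dots> \<le> \<bar>k\<bar> * r" using r by (intro mult_right_mono) auto
      also have "\<dots> < e" by (rule kr)
      finally have "\<bar>F (g - f)\<bar> < e" .
      moreover have "F ((g - f) + f) = F (g - f) + F f" using f(1) g(1) by (intro add) auto
      ultimately have "F g \<in> ball (F f) e" by (simp add: dist_real_def)
      then show ?thesis using e(2) by blast
    qed
    then show "\<exists>B\<in>\<B>. \<exists>r>0. {g\<in>CX. rho B (g - f) < ennreal r} \<subseteq> {f \<in> topspace T. F f \<in> V}"
      using bornology_Un[OF born B D] r by (intro bexI[of _ "B \<union> D"] exI[of _ r]) auto
  qed auto
qed simp

subsection \<open>The isomorphism\<close>

definition functional_of :: "('a set \<Rightarrow> real) \<times> (('a \<Rightarrow> real) \<Rightarrow> real) \<Rightarrow> ('a \<Rightarrow> real) \<Rightarrow> real" where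
  "functional_of = (\<lambda>(\<mu>, \<phi>) f. if f \<in> CX then measure_integral \<mu> (prL f) + \<phi> (prM f) else 0)"

abbreviation "pairs \<equiv> measures_on \<B> \<times> dual M TM"

lemma functional_of_L:
  "p \<in> pairs \<Longrightarrow> f \<in> L \<Longrightarrow> functional_of p f = measure_integral (fst p) f"
  using L_subset by (auto simp: functional_of_def prL_of_L prM_of_L dual_M_zero)

lemma functional_of_M:
  assumes "p \<in> pairs" "f \<in> M"
  shows "functional_of p f = snd p f"
proof -
  have "measure_integral (fst p) (0 *\<^sub>R 0) = 0 * measure_integral (fst p) 0"
    using assms subspace_0[OF subspace_L] by (intro integral_scaleR_fun) auto
  then show ?thesis
    using assms M_subset by (auto simp: functional_of_def prL_of_M prM_of_M split_beta)
qed

lemma functional_of_add: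
  assumes "p \<in> pairs" "q \<in> pairs"
  shows "functional_of (p + q) = functional_of p + functional_of q"
  using assms by (auto simp: functional_of_def fun_eq_iff integral_add_measure prL_in)

lemma functional_of_scaleR:
  assumes "p \<in> pairs"
  shows "functional_of (c *\<^sub>R p) = c *\<^sub>R functional_of p"
  using assms by (auto simp: functional_of_def fun_eq_iff integral_scaleR_measure prL_in
      scaleR_fun_apply distrib_left)

lemma functional_of_diff:
  assumes "p \<in> pairs" "q \<in> pairs" "f \<in> CX"
  shows "functional_of p f - functional_of q f
    = measure_integral (fst p - fst q) (prL f) + (snd p - snd q) (prM f)"
  using assms by (auto simp: functional_of_def split_beta integral_diff_measure prL_in)

lemma functional_of_in_dual:
  assumes p: "p \<in> pairs"
  shows "functional_of p \<in> dual CX T"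
proof -
  obtain \<mu> \<phi> where p': "p = (\<mu>, \<phi>)" and \<mu>: "\<mu> \<in> measures_on \<B>" and \<phi>: "\<phi> \<in> dual M TM"
    using p by (cases p) auto
  have add: "functional_of p (f + g) = functional_of p f + functional_of p g" if "f \<in> CX" "g \<in> CX" for f g
    using that \<phi> by (simp add: p' functional_of_def CX_add prL_add prM_add prL_in prM_in
        integral_add_fun[OF \<mu>] dual_M_iff)
  have scale: "functional_of p (c *\<^sub>R f) = c * functional_of p f" if "f \<in> CX" for c f
    using that \<phi> by (simp add: p' functional_of_def CX_scaleR prL_scaleR prM_scaleR prL_in prM_in
        integral_scaleR_fun[OF \<mu>] dual_M_iff distrib_left)
  obtain B where B: "B \<in> \<B>" "closed B" "total_variation \<mu> (- B) = 0"
    using measures_onD(3)[OF \<mu>] by (elim bexE conjE)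
  have "continuous_map T euclideanreal (functional_of p)"
  proof (rule continuous_functional[OF add B(1)])
    fix f c assume f: "f \<in> L" "0 \<le> c" "\<And>x. x \<in> B \<Longrightarrow> \<bar>f x\<bar> \<le> c"
    have "\<bar>measure_integral \<mu> f\<bar> \<le> c * enn2real (total_variation \<mu> UNIV)"
      by (rule has_measure_integral_bound[OF measures_onD(1)[OF \<mu>] B(2,3) f(3,2) has_integral_L[OF \<mu> f(1)]])
    then show "\<bar>functional_of p f\<bar> \<le> enn2real (total_variation \<mu> UNIV) * c"
      using functional_of_L[OF p f(1)] by (simp add: p' mult.commute)
  qed
  then show ?thesis using add scale by (simp add: dual_def functional_of_def p')
qed

lemma functional_of_inj: "inj_on functional_of pairs"
proof (rule inj_onI)
  fix p q assume pq: "p \<in> pairs" "q \<in> pairs" "functional_of p = functional_of q"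
  have "fst p = fst q"
  proof (rule measures_on_eqI[OF born])
    fix f assume "f \<in> (BCpos :: ('a \<Rightarrow> real) set)"
    then have "f \<in> L" using BCpos_subset_L by blast
    then show "measure_integral (fst p) f = measure_integral (fst q) f"
      using functional_of_L pq by metis
  qed (use pq in auto)
  moreover have "snd p = snd q"
  proof
    fix f
    show "snd p f = snd q f"
    proof (cases "f \<in> M")
      case True
      then show ?thesis using functional_of_M pq by metis
    next
      case False
      then show ?thesis using pq by (auto simp: dual_M_iff)
    qed
  qed
  ultimately show "p = q" by (simp add: prod_eq_iff)
qed

text \<open>
  The measure comes from \<open>F\<close> on all continuous functions that are bounded on \<open>B\<close>, which include \<open>L\<close> by
  minimality of \<open>D\<close>; the second component is the restriction to \<open>M\<close>, extended by 0.
\<close>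

lemma functional_of_surj:
  assumes F: "F \<in> dual CX T"
  shows "F \<in> functional_of ` pairs"
proof -
  obtain B k where B: "B \<in> \<B>" and "set_bounded_functional F B k"
    using dual_set_bounded[OF born closed_base F] by blast
  then interpret set_bounded_functional F B k by simp
  obtain \<mu> where \<mu>: "finite_borel_measure \<mu>" "closed_regular \<mu>" "total_variation \<mu> (- B) = 0"
    and int: "\<forall>f\<in>CX. (\<exists>c\<ge>0. \<forall>x\<in>B. \<bar>f x\<bar> \<le> c) \<longrightarrow> has_measure_integral \<mu> f (F f)"
    using representation by (elim exE conjE)
  define \<phi> where "\<phi> = (\<lambda>m. if m \<in> M then F m else 0)"
  have "\<mu> \<in> measures_on \<B>" by (rule measures_onI[OF \<mu>(1,2) B closed \<mu>(3)])
  moreover have "\<phi> \<in> dual M TM"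
    unfolding dual_M_iff \<phi>_def
    using subspace_add[OF subspace_M] subspace_scale[OF subspace_M]
      add[OF subsetD[OF M_subset] subsetD[OF M_subset]] scaleR[OF subsetD[OF M_subset]] by auto
  moreover have "F f = functional_of (\<mu>, \<phi>) f" for f
  proof (cases "f \<in> CX")
    case True
    have "prL f \<in> CX_fin B" using minimal[OF B] prL_in[OF True] by blast
    then have "measure_integral \<mu> (prL f) = F (prL f)"
      using int unfolding CX_fin_iff by (intro measure_integral_eqI) blast
    moreover have "F (prL f + prM f) = F (prL f) + F (prM f)"
      using prL_in[OF True] prM_in[OF True] L_subset M_subset by (intro add) auto
    then have "F f = F (prL f) + F (prM f)" by (simp add: prM_def)
    ultimately show ?thesis using True prM_in[OF True] by (simp add: functional_of_def \<phi>_def)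
  next
    case False
    then show ?thesis using F by (simp add: functional_of_def dual_def)
  qed
  ultimately show ?thesis by (intro image_eqI[of _ _ "(\<mu>, \<phi>)"]) auto
qed

abbreviation "seminorms_sigma \<equiv>
  {\<lambda>\<mu>. (SUP f\<in>A. ennreal \<bar>measure_integral \<mu> f\<bar>) | A. elcs_bounded L TL A}"
abbreviation "seminorms_weak_star \<equiv> {\<lambda>\<phi>. ennreal \<bar>\<phi> m\<bar> | m. m \<in> M}"

lemma seminorm_sigma: "\<rho> \<in> seminorms_sigma \<Longrightarrow> extended_seminorm (measures_on \<B>) \<rho>"
proof -
  assume "\<rho> \<in> seminorms_sigma"
  then obtain A where A: "\<rho> = (\<lambda>\<mu>. SUP f\<in>A. ennreal \<bar>measure_integral \<mu> f\<bar>)" "elcs_bounded L TL A"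
    by blast
  then have "A \<subseteq> L" by (simp add: elcs_bounded_def)
  then show ?thesis unfolding A(1)
    by (intro extended_seminorm_SUP integral_add_measure integral_scaleR_measure) auto
qed

lemma seminorm_weak_star: "\<rho> \<in> seminorms_weak_star \<Longrightarrow> extended_seminorm (dual M TM) \<rho>"
proof -
  assume "\<rho> \<in> seminorms_weak_star"
  then obtain m where m: "\<rho> = (\<lambda>\<phi>. ennreal \<bar>\<phi> m\<bar>)" by blast
  have "extended_seminorm (dual M TM) (\<lambda>\<phi>. SUP x\<in>{m}. ennreal \<bar>\<phi> x\<bar>)"
    by (rule extended_seminorm_SUP) (auto simp: scaleR_fun_def)
  then show ?thesis by (simp add: m)
qed

text \<open>
  A bounded set \<open>A\<close> is tested on its two projections: the seminorm of \<open>prL ` A\<close> on the measures, and the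
  finitely many evaluations at points of \<open>prM ` A\<close>. Each contributes less than a third of the radius, so
  that the supremum stays strictly below it.
\<close>

lemma continuous_functional_of:
  "continuous_map (prod_topology (sigma_top \<B> D) (weak_star M TM)) (tau_ucb CX T) functional_of"
  unfolding sigma_top_def weak_star_def tau_ucb_def
proof (rule continuous_map_prod_seminorm_topology[OF seminorm_sigma subspace_measures
      seminorm_weak_star subspace_dual_M])
  show "functional_of (a, b) \<in> dual CX T" if "a \<in> measures_on \<B>" "b \<in> dual M TM" for a b
    using that by (intro functional_of_in_dual) auto
  fix \<rho> :: "(('a \<Rightarrow> real) \<Rightarrow> real) \<Rightarrow> ennreal" and r :: real
  assume "\<rho> \<in> {\<lambda>F. (SUP x\<in>A. ennreal \<bar>F x\<bar>) | A. elcs_bounded CX T A}" and r: "0 < r"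
  then obtain A where \<rho>: "\<rho> = (\<lambda>F. SUP x\<in>A. ennreal \<bar>F x\<bar>)" and A: "elcs_bounded CX T A" by blast
  have AX: "A \<subseteq> CX" using A by (simp add: elcs_bounded_def)
  let ?q = "\<lambda>\<mu>. (SUP f\<in>prL ` A. ennreal \<bar>measure_integral \<mu> f\<bar>)"
  let ?F2 = "(\<lambda>m \<phi>. ennreal \<bar>\<phi> m\<bar>) ` prM ` A"
  have main: "\<rho> (functional_of (a', b') - functional_of (a, b)) < ennreal r"
    if ab: "a \<in> measures_on \<B>" "a' \<in> measures_on \<B>" "b \<in> dual M TM" "b' \<in> dual M TM"
      and q: "?q (a' - a) < ennreal (r/3)" and w: "\<forall>\<rho>2\<in>?F2. \<rho>2 (b' - b) < ennreal (r/3)" for a a' b b'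
  proof -
    have "ennreal \<bar>(functional_of (a', b') - functional_of (a, b)) f\<bar> \<le> ennreal (2 * r / 3)" if f: "f \<in> A" for f
    proof -
      have "ennreal \<bar>measure_integral (a' - a) (prL f)\<bar> < ennreal (r/3)"
        using f by (intro le_less_trans[OF SUP_upper q]) auto
      moreover have "(\<lambda>\<phi>. ennreal \<bar>\<phi> (prM f)\<bar>) \<in> ?F2" using f by blast
      then have "ennreal \<bar>(b' - b) (prM f)\<bar> < ennreal (r/3)" by (rule bspec[OF w])
      ultimately have "\<bar>measure_integral (a' - a) (prL f)\<bar> < r/3" "\<bar>(b' - b) (prM f)\<bar> < r/3"
        by (simp_all only: ennreal_less_iff abs_ge_zero)
      moreover have "(functional_of (a', b') - functional_of (a, b)) f
          = measure_integral (a' - a) (prL f) + (b' - b) (prM f)"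
        using functional_of_diff[of "(a', b')" "(a, b)" f] ab AX f by (auto simp: subset_iff)
      ultimately have "\<bar>(functional_of (a', b') - functional_of (a, b)) f\<bar> \<le> 2 * r / 3"
        by linarith
      then show ?thesis by (rule ennreal_leI)
    qed
    then have "\<rho> (functional_of (a', b') - functional_of (a, b)) \<le> ennreal (2 * r / 3)"
      unfolding \<rho> by (rule SUP_least)
    also have "\<dots> < ennreal r" using r by (intro ennreal_lessI) auto
    finally show ?thesis .
  qed
  have "?q \<in> seminorms_sigma" using bounded_split(1)[OF A] by blast
  moreover have "finite ?F2" using bounded_split(2)[OF A] by blast
  moreover have "?F2 \<subseteq> seminorms_weak_star" using prM_in AX by blast
  ultimately show "\<exists>F1 F2 s. finite F1 \<and> F1 \<subseteq> seminorms_sigma \<and> finite F2 \<and> F2 \<subseteq> seminorms_weak_star \<and> 0 < s \<and>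
      (\<forall>a\<in>measures_on \<B>. \<forall>a'\<in>measures_on \<B>. \<forall>b\<in>dual M TM. \<forall>b'\<in>dual M TM.
        (\<forall>\<rho>1\<in>F1. \<rho>1 (a' - a) < ennreal s) \<longrightarrow> (\<forall>\<rho>2\<in>F2. \<rho>2 (b' - b) < ennreal s) \<longrightarrow>
        \<rho> (functional_of (a', b') - functional_of (a, b)) < ennreal r)"
    using r main by (intro exI[of _ "{?q}"] exI[of _ ?F2] exI[of _ "r/3"] conjI ballI impI) simp_all
qed

definition pair_of :: "(('a \<Rightarrow> real) \<Rightarrow> real) \<Rightarrow> ('a set \<Rightarrow> real) \<times> (('a \<Rightarrow> real) \<Rightarrow> real)" where
  "pair_of = inv_into pairs functional_of"

lemma pair_of_in: "F \<in> dual CX T \<Longrightarrow> pair_of F \<in> pairs"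
  unfolding pair_of_def by (rule inv_into_into) (rule functional_of_surj)

lemma functional_of_pair_of: "F \<in> dual CX T \<Longrightarrow> functional_of (pair_of F) = F"
  unfolding pair_of_def by (rule f_inv_into_f) (rule functional_of_surj)

lemma pair_of_functional_of: "p \<in> pairs \<Longrightarrow> pair_of (functional_of p) = p"
  unfolding pair_of_def by (rule inv_into_f_f[OF functional_of_inj])

text \<open>
  Here the seminorms coincide: bounded subsets of \<open>L\<close>, and points of \<open>M\<close>, are bounded in the whole space.
\<close>

lemma continuous_pair_of:
  "continuous_map (tau_ucb CX T) (prod_topology (sigma_top \<B> D) (weak_star M TM)) pair_of"
  unfolding continuous_map_pairwise
proof
  show "continuous_map (tau_ucb CX T) (sigma_top \<B> D) (fst \<circ> pair_of)"
    unfolding tau_ucb_def sigma_top_def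
  proof (rule continuous_map_seminorm_topology)
    show "(fst \<circ> pair_of) F \<in> measures_on \<B>" if "F \<in> dual CX T" for F
      using pair_of_in[OF that] by auto
    fix \<rho> assume "\<rho> \<in> seminorms_sigma"
    then obtain A where \<rho>: "\<rho> = (\<lambda>\<mu>. SUP f\<in>A. ennreal \<bar>measure_integral \<mu> f\<bar>)" and A: "elcs_bounded L TL A"
      by blast
    have AL: "A \<subseteq> L" using A by (simp add: elcs_bounded_def)
    have "\<rho> ((fst \<circ> pair_of) G - (fst \<circ> pair_of) F) = (SUP f\<in>A. ennreal \<bar>(G - F) f\<bar>)"
      if FG: "F \<in> dual CX T" "G \<in> dual CX T" for F G
      unfolding \<rho>
    proof (rule SUP_cong[OF refl])
      fix f assume "f \<in> A"
      then have f: "f \<in> L" using AL by blast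
      have val: "measure_integral (fst (pair_of H)) f = H f" if "H \<in> dual CX T" for H
        using functional_of_L[OF pair_of_in[OF that] f] functional_of_pair_of[OF that] by simp
      have "measure_integral (fst (pair_of G) - fst (pair_of F)) f = G f - F f"
        using integral_diff_measure[OF _ _ f, of "fst (pair_of G)" "fst (pair_of F)"]
          pair_of_in[OF FG(1)] pair_of_in[OF FG(2)] val[OF FG(1)] val[OF FG(2)] by auto
      then show "ennreal \<bar>measure_integral ((fst \<circ> pair_of) G - (fst \<circ> pair_of) F) f\<bar> = ennreal \<bar>(G - F) f\<bar>"
        by simp
    qed
    then show "\<exists>\<rho>'\<in>{\<lambda>F. (SUP x\<in>A. ennreal \<bar>F x\<bar>) | A. elcs_bounded CX T A}.
        \<forall>F\<in>dual CX T. \<forall>G\<in>dual CX T. \<rho> ((fst \<circ> pair_of) G - (fst \<circ> pair_of) F) \<le> \<rho>' (G - F)"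
      using bounded_of_L[OF A] by (intro bexI[of _ "\<lambda>F. SUP f\<in>A. ennreal \<bar>F f\<bar>"]) auto
  qed
  show "continuous_map (tau_ucb CX T) (weak_star M TM) (snd \<circ> pair_of)"
    unfolding tau_ucb_def weak_star_def
  proof (rule continuous_map_seminorm_topology)
    show "(snd \<circ> pair_of) F \<in> dual M TM" if "F \<in> dual CX T" for F
      using pair_of_in[OF that] by auto
    fix \<rho> assume "\<rho> \<in> seminorms_weak_star"
    then obtain m where \<rho>: "\<rho> = (\<lambda>\<phi>. ennreal \<bar>\<phi> m\<bar>)" and m: "m \<in> M" by blast
    have "snd (pair_of F) m = F m" if "F \<in> dual CX T" for F
      using functional_of_M[OF pair_of_in[OF that] m] functional_of_pair_of[OF that] by simp
    then have "\<rho> ((snd \<circ> pair_of) G - (snd \<circ> pair_of) F) \<le> (SUP f\<in>{m}. ennreal \<bar>(G - F) f\<bar>)"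
      if "F \<in> dual CX T" "G \<in> dual CX T" for F G
      using that by (simp add: \<rho>)
    moreover have "elcs_bounded CX T {m}" using m M_subset by (intro bounded_singleton) blast
    ultimately show "\<exists>\<rho>'\<in>{\<lambda>F. (SUP x\<in>A. ennreal \<bar>F x\<bar>) | A. elcs_bounded CX T A}.
        \<forall>F\<in>dual CX T. \<forall>G\<in>dual CX T. \<rho> ((snd \<circ> pair_of) G - (snd \<circ> pair_of) F) \<le> \<rho>' (G - F)"
      by (intro bexI[of _ "\<lambda>F. SUP f\<in>{m}. ennreal \<bar>F f\<bar>"]) blast+
  qed
qed

lemma tvs_isomorphic_dual:
  "tvs_isomorphic (tau_ucb CX T) (prod_topology (sigma_top \<B> D) (weak_star M TM))"
  unfolding tvs_isomorphic_def
proof (intro exI[of _ pair_of] conjI ballI allI)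
  have dual: "topspace (tau_ucb CX T) = dual CX T" by (simp add: tau_ucb_def)
  have pairs: "topspace (prod_topology (sigma_top \<B> D) (weak_star M TM)) = pairs"
    by (simp add: sigma_top_def weak_star_def)
  have "homeomorphic_maps (tau_ucb CX T) (prod_topology (sigma_top \<B> D) (weak_star M TM)) pair_of functional_of"
    unfolding homeomorphic_maps_def dual pairs
    using continuous_pair_of continuous_functional_of functional_of_pair_of pair_of_functional_of by blast
  then show "homeomorphic_map (tau_ucb CX T) (prod_topology (sigma_top \<B> D) (weak_star M TM)) pair_of"
    by (auto simp: homeomorphic_map_maps)
  fix F c assume "F \<in> topspace (tau_ucb CX T)"
  then have F: "F \<in> dual CX T" by (simp add: dual)
  have sub: "subspace pairs" by (rule subspace_Times[OF subspace_measures subspace_dual_M])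
  have "functional_of (c *\<^sub>R pair_of F) = c *\<^sub>R F"
    using functional_of_scaleR[OF pair_of_in[OF F]] functional_of_pair_of[OF F] by simp
  then show "pair_of (c *\<^sub>R F) = c *\<^sub>R pair_of F"
    using pair_of_functional_of[OF subspace_scale[OF sub pair_of_in[OF F]]] by metis
  fix G assume "G \<in> topspace (tau_ucb CX T)"
  then have G: "G \<in> dual CX T" by (simp add: dual)
  have "functional_of (pair_of F + pair_of G) = F + G"
    using functional_of_add[OF pair_of_in[OF F] pair_of_in[OF G]]
      functional_of_pair_of[OF F] functional_of_pair_of[OF G] by simp
  then show "pair_of (F + G) = pair_of F + pair_of G"
    using pair_of_functional_of[OF subspace_add[OF sub pair_of_in[OF F] pair_of_in[OF G]]] by metis
qed

end

theorem theorem4p11: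
  fixes \<B> :: "'a::metric_space set set"
  assumes "bornology \<B>" and "has_closed_base \<B>"
    and "fundamental_elcs CX (tau \<B>)"
  shows "\<exists>D\<in>\<B>. (\<forall>B\<in>\<B>. CX_fin D \<subseteq> CX_fin B) \<and>
    (\<forall>M. algebraic_complement CX (CX_fin D) M \<longrightarrow>
      tvs_isomorphic (tau_ucb CX (tau \<B>))
        (prod_topology (sigma_top \<B> D) (weak_star M (subtopology (tau \<B>) M))))"
proof -
  obtain D where D: "D \<in> \<B>" "\<forall>B\<in>\<B>. CX_fin D \<subseteq> CX_fin B"
    using fundamental_minimal_member[OF assms] by blast
  have "tvs_isomorphic (tau_ucb CX (tau \<B>))
      (prod_topology (sigma_top \<B> D) (weak_star M (subtopology (tau \<B>) M)))"
    if "algebraic_complement CX (CX_fin D) M" for M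
  proof -
    interpret complemented_finite_part \<B> D M
      using assms D that by unfold_locales auto
    show ?thesis by (rule tvs_isomorphic_dual)
  qed
  then show ?thesis using D by blast
qed

end
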